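(* Let $\alpha\ge0$ be real, $r\ge1$ an integer, $1\le s\le\infty$, $1\le p\le\infty$ and $\mu>r+1-1/s$. Let $C_0>0$ be a constant depending only on $\alpha,r,\mu,s,p$ such that $$R^r_{N,\delta}\bigl(W_s^\mu,\Psi_N,C,\ell_p\bigr)\le C_0\,\delta^{(\mu+1/s-1-r)/(\mu+1/s-1/p)}$$ for all $0<\delta<1$ and all integers $N\ge\delta^{-1/(\mu+1/s-1/p)}$ (such a constant exists). Let $K\ge C_0$ be fixed. Then the quantity $$N_{\min}(\delta)=\min\Bigl\{N\in\mathbb{N}:\ R^r_{N,\delta}\bigl(W_s^\mu,\Psi_N,C,\ell_p\bigr)\le K\,\delta^{(\mu+1/s-1-r)/(\mu+1/s-1/p)}\Bigr\}$$ is defined (i.e. the set is nonempty) for every $0<\delta<1$, and there are constants $0<c'\le c''$, depending only on $\alpha,r,\mu,s,p,K$, such that for every $0<\delta<1$ $$c'\,\delta^{-1/(\mu+1/s-1/p)}\le N_{\min}(\delta)\le c''\,\delta^{-1/(\mu+1/s-1/p)},$$ $$c'\,\delta^{(\mu+1/s-1-r)/(\mu+1/s-1/p)}\le R^r_{N_{\min},\delta}\bigl(W_s^\mu,\Psi_{N_{\min}},C,\ell_p\bigr)\le c''\,\delta^{(\mu+1/s-1-r)/(\mu+1/s-1/p)} .$$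
   Context: $w(t)=t^\alpha e^{-t}$ on $(0,\infty)$; $L_{2,w}$ is the Hilbert space of real-valued functions on $(0,\infty)$ square-summable with weight $w$, with $\langle f,g\rangle=\int_0^\infty w f g\,dt$. $L_k^{(\alpha)}$ are the Laguerre polynomials and $\ell_k^{(\alpha)}=(k!/\Gamma(k+\alpha+1))^{1/2}L_k^{(\alpha)}$, $k\in\mathbb{N}_0$, is the corresponding orthonormal system (a basis of $L_{2,w}$). $C$ is the space of all real-valued continuous functions on $(0,\infty)$ (not necessarily bounded), and $\|g\|_C=\sup_{t>0}|g(t)|\in[0,+\infty]$. Conventions: $1/\infty=0$; $\mathbb{N}=\{1,2,\ldots\}$. With $\underline{k}=\max\{1,k\}$: $\|f\|_{s,\mu}=\bigl(\sum_{k\ge0}\underline{k}^{s\mu}|\langle f,\ell_k^{(\alpha)}\rangle|^s\bigr)^{1/s}$ for $1\le s<\infty$, $\|f\|_{\infty,\mu}=\sup_{k\ge0}\underline{k}^{\mu}|\langle f,\ell_k^{(\alpha)}\rangle|$; here $W_s^\mu$ denotes the unit ball $\{f\in L_{2,w}:\|f\|_{s,\mu}\le1\}$. For $\mu>r+1-1/s$ each $f\in W_s^\mu$ is identified with its representative of class $C^r$ on $(0,\infty)$ (which exists), and $f^{(r)}$ is its $r$-th derivative. $G:L_{2,w}\to\ell_2$, $Gf=(\langle f,\ell_k^{(\alpha)}\rangle)_{k\in\mathbb{N}_0}$. For finite $\Omega\subset\mathbb{N}_0$, $P_\Omega$ is the coordinate projection of sequences keeping the entries with indices in $\Omega$ (others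 set to $0$) and $G_\Omega=P_\Omega G$. A recovery operator is an arbitrary mapping $\psi:\ell_{\max\{p,2\}}\to C$ (no linearity or continuity is required). $\Psi_N$ is the set of all $\psi G_\Omega$ with $\psi$ a recovery operator and $\operatorname{card}(\Omega)\le N$. The error is $$e_\delta(W_s^\mu,\psi G_\Omega,C,\ell_p)=\sup_{f\in W_s^\mu}\ \sup_{\|\boldsymbol{\xi}\|_{\ell_p}\le\delta}\bigl\|\bigl(f^{(r)}-\psi(G_\Omega f+\boldsymbol{\xi})\bigr)\sqrt{w}\bigr\|_C ,$$ the inner supremum being over real sequences $\boldsymbol{\xi}$. The minimal radius of Galerkin information is $R^r_{N,\delta}(W_s^\mu,\Psi_N,C,\ell_p)=\inf_{\psi G_\Omega\in\Psi_N}e_\delta(W_s^\mu,\psi G_\Omega,C,\ell_p)$. *)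

theory Defs
  imports "HOL-Analysis.Analysis"
begin

text \<open>
  Functions on \<open>(0,\<infinity>)\<close> are modelled as functions of type \<open>real \<Rightarrow> real\<close>; their values outside
  \<open>{0<..}\<close> never matter.  The exponents \<open>s\<close> and \<open>p\<close> range over \<open>ennreal\<close>.
\<close>

definition recip :: "ennreal \<Rightarrow> real" where
  "recip s = enn2real (1 / s)"  \<comment> \<open>\<open>1/\<infinity> = 0\<close>\<close>

definition weight :: "real \<Rightarrow> real \<Rightarrow> real" where
  "weight \<alpha> t = t powr \<alpha> * exp (- t)"

definition L2w :: "real \<Rightarrow> (real \<Rightarrow> real) set" where
  "L2w \<alpha> = {f. set_borel_measurable lborel {0<..} f \<and>
                set_integrable lborel {0<..} (\<lambda>t. weight \<alpha> t * (f t)\<^sup>2)}"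

definition inner_w :: "real \<Rightarrow> (real \<Rightarrow> real) \<Rightarrow> (real \<Rightarrow> real) \<Rightarrow> real" where
  "inner_w \<alpha> f g = (LINT t:{0<..}|lborel. weight \<alpha> t * f t * g t)"

definition laguerre :: "real \<Rightarrow> nat \<Rightarrow> real \<Rightarrow> real" where
  "laguerre \<alpha> k t = (\<Sum>j\<le>k. (- 1) ^ j * ((real k + \<alpha>) gchoose (k - j)) * t ^ j / fact j)"

definition laguerre_on :: "real \<Rightarrow> nat \<Rightarrow> real \<Rightarrow> real" where
  "laguerre_on \<alpha> k t = sqrt (fact k / Gamma (real k + \<alpha> + 1)) * laguerre \<alpha> k t"

definition Gcoeff :: "real \<Rightarrow> (real \<Rightarrow> real) \<Rightarrow> (nat \<Rightarrow> real)" where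
  "Gcoeff \<alpha> f = (\<lambda>k. inner_w \<alpha> f (laguerre_on \<alpha> k))"

definition Pcoord :: "nat set \<Rightarrow> (nat \<Rightarrow> real) \<Rightarrow> (nat \<Rightarrow> real)" where
  "Pcoord \<Omega> a = (\<lambda>k. if k \<in> \<Omega> then a k else 0)"

definition seq_norm :: "ennreal \<Rightarrow> real \<Rightarrow> (nat \<Rightarrow> real) \<Rightarrow> ennreal" where
  "seq_norm s \<mu> a =
     (if s = \<infinity> then (SUP k. ennreal (real (max 1 k) powr \<mu> * \<bar>a k\<bar>))
      else let x = (\<lambda>k. real (max 1 k) powr (enn2real s * \<mu>) * \<bar>a k\<bar> powr enn2real s)
           in if summable x then ennreal ((\<Sum>k. x k) powr (1 / enn2real s)) else \<infinity>)"

definition lp_norm :: "ennreal \<Rightarrow> (nat \<Rightarrow> real) \<Rightarrow> ennreal" where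
  "lp_norm p a = seq_norm p 0 a"

definition lp_space :: "ennreal \<Rightarrow> (nat \<Rightarrow> real) set" where
  "lp_space p = {a. lp_norm p a < \<infinity>}"

definition W_ball :: "real \<Rightarrow> ennreal \<Rightarrow> real \<Rightarrow> (real \<Rightarrow> real) set" where
  "W_ball \<alpha> s \<mu> = {f \<in> L2w \<alpha>. seq_norm s \<mu> (Gcoeff \<alpha> f) \<le> 1}"

definition Cr_on :: "nat \<Rightarrow> real set \<Rightarrow> (real \<Rightarrow> real) \<Rightarrow> bool" where
  "Cr_on r S g \<longleftrightarrow> (\<forall>j<r. \<forall>t\<in>S. (deriv ^^ j) g differentiable (at t)) \<and>
                   continuous_on S ((deriv ^^ r) g)"

text \<open>
  Elements of \<open>L2w \<alpha>\<close> are individual functions standing for their almost-everywhere classes.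
  The \<open>r\<close>-th derivative of \<open>f\<close> is that of the \<open>C\<^sup>r\<close> function on \<open>(0,\<infinity>)\<close> in the class of \<open>f\<close>;
  this function is unique on \<open>(0,\<infinity>)\<close> because two continuous functions that agree almost
  everywhere on an open interval agree on it.
\<close>

definition Cr_rep :: "nat \<Rightarrow> (real \<Rightarrow> real) \<Rightarrow> (real \<Rightarrow> real)" where
  "Cr_rep r f = (SOME g. Cr_on r {0<..} g \<and> (AE t in lborel. t > 0 \<longrightarrow> g t = f t))"

definition rth_deriv :: "nat \<Rightarrow> (real \<Rightarrow> real) \<Rightarrow> (real \<Rightarrow> real)" where
  "rth_deriv r f = (deriv ^^ r) (Cr_rep r f)"

definition C_space :: "(real \<Rightarrow> real) set" where
  "C_space = {g. continuous_on {0<..} g}"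

definition C_norm :: "(real \<Rightarrow> real) \<Rightarrow> ennreal" where
  "C_norm g = (SUP t\<in>{0<..}. ennreal \<bar>g t\<bar>)"

text \<open>
  The method \<open>\<psi> G\<^sub>\<Omega>\<close> with \<open>G\<^sub>\<Omega> f = Pcoord \<Omega> (Gcoeff \<alpha> f)\<close> is represented by the pair \<open>(\<psi>, \<Omega>)\<close>, since the noise enters between
  \<open>G\<^sub>\<Omega>\<close> and \<open>\<psi>\<close>.
\<close>

definition Psi :: "ennreal \<Rightarrow> nat \<Rightarrow> (((nat \<Rightarrow> real) \<Rightarrow> (real \<Rightarrow> real)) \<times> nat set) set" where
  "Psi p N = {(\<psi>, \<Omega>). \<psi> \<in> lp_space (max p 2) \<rightarrow> C_space \<and> finite \<Omega> \<and> card \<Omega> \<le> N}"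

definition err ::
  "real \<Rightarrow> nat \<Rightarrow> ennreal \<Rightarrow> real \<Rightarrow> ennreal \<Rightarrow> real \<Rightarrow>
   ((nat \<Rightarrow> real) \<Rightarrow> (real \<Rightarrow> real)) \<Rightarrow> nat set \<Rightarrow> ennreal" where
  "err \<alpha> r s \<mu> p \<delta> \<psi> \<Omega> =
     (SUP f\<in>W_ball \<alpha> s \<mu>. SUP \<xi>\<in>{\<xi>. lp_norm p \<xi> \<le> ennreal \<delta>}.
        C_norm (\<lambda>t. (rth_deriv r f t - \<psi> (\<lambda>k. Pcoord \<Omega> (Gcoeff \<alpha> f) k + \<xi> k) t) * sqrt (weight \<alpha> t)))"

definition radius :: "real \<Rightarrow> nat \<Rightarrow> ennreal \<Rightarrow> real \<Rightarrow> ennreal \<Rightarrow> nat \<Rightarrow> real \<Rightarrow> ennreal" where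
  "radius \<alpha> r s \<mu> p N \<delta> = (INF (\<psi>, \<Omega>)\<in>Psi p N. err \<alpha> r s \<mu> p \<delta> \<psi> \<Omega>)"

definition info_exp :: "ennreal \<Rightarrow> real \<Rightarrow> ennreal \<Rightarrow> real" where
  "info_exp s \<mu> p = - 1 / (\<mu> + recip s - recip p)"

definition rate_exp :: "nat \<Rightarrow> ennreal \<Rightarrow> real \<Rightarrow> ennreal \<Rightarrow> real" where
  "rate_exp r s \<mu> p = (\<mu> + recip s - 1 - real r) / (\<mu> + recip s - recip p)"

definition upper_const :: "real \<Rightarrow> nat \<Rightarrow> ennreal \<Rightarrow> real \<Rightarrow> ennreal \<Rightarrow> real \<Rightarrow> bool" where
  "upper_const \<alpha> r s \<mu> p C\<^sub>0 \<longleftrightarrow>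
     C\<^sub>0 > 0 \<and>
     (\<forall>\<delta> N. 0 < \<delta> \<and> \<delta> < 1 \<and> real N \<ge> \<delta> powr info_exp s \<mu> p \<longrightarrow>
        radius \<alpha> r s \<mu> p N \<delta> \<le> ennreal (C\<^sub>0 * \<delta> powr rate_exp r s \<mu> p))"

definition admissible_N ::
  "real \<Rightarrow> nat \<Rightarrow> ennreal \<Rightarrow> real \<Rightarrow> ennreal \<Rightarrow> real \<Rightarrow> real \<Rightarrow> nat set" where
  "admissible_N \<alpha> r s \<mu> p K \<delta> =
     {N. N \<ge> 1 \<and> radius \<alpha> r s \<mu> p N \<delta> \<le> ennreal (K * \<delta> powr rate_exp r s \<mu> p)}"

definition N_min ::
  "real \<Rightarrow> nat \<Rightarrow> ennreal \<Rightarrow> real \<Rightarrow> ennreal \<Rightarrow> real \<Rightarrow> real \<Rightarrow> nat" where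
  "N_min \<alpha> r s \<mu> p K \<delta> = (LEAST N. N \<in> admissible_N \<alpha> r s \<mu> p K \<delta>)"

end

theory Submission
  imports Defs "HOL-Computational_Algebra.Polynomial"
begin

text \<open>
  Everything rests on the uniform estimate \<open>\<bar>\<ell>\<^sub>k\<^sup>(\<^sup>j\<^sup>) sqrt w\<bar> \<le> C k\<^sup>j\<close>, which is sharp at
  \<open>t \<approx> 1/k\<close>, where the \<open>\<ell>\<^sub>k\<^sup>(\<^sup>j\<^sup>)\<close> all have the sign \<open>(-1)\<^sup>j\<close>.  For \<open>j = 0\<close> it is obtained
  from the power series for \<open>t \<lesssim> 1/k\<close>, from the monotonicity of Sonin's function for
  \<open>1/k \<lesssim> t \<lesssim> k\<close>, and by integrating the derivative of \<open>t w L\<^sub>k\<^sup>2\<close> for \<open>t \<greatersim> k\<close>; the identity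
  \<open>L\<^sub>k' = - (L\<^sub>0 + \<dots> + L\<^sub>k\<^sub>-\<^sub>1)\<close> then gives all \<open>j\<close>.

  A function in \<open>W\<^sub>s\<^sup>\<mu>\<close> coincides almost everywhere with its Laguerre series because \<open>w (f - \<Sum> \<dots>)\<close>
  has exponential decay and vanishing moments, hence is \<open>0\<close>.

  For the upper bound, the coefficients with index below \<open>n \<approx> \<delta> powr (-1 / (\<mu> + 1/s - 1/p))\<close> are
  used; the truncation and the noise errors are then balanced.  For the lower bounds, the
  polynomials with equal coefficients on about \<open>m\<close> indices \<open>k \<approx> m\<close> are evaluated at
  \<open>t = 1 / (9 m)\<close>: with \<open>m \<approx> N\<close> they can avoid \<open>\<Omega>\<close>, with \<open>m \<approx> n\<close> they are hidden by the noise.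
\<close>

section \<open>Laguerre polynomials\<close>

text \<open>The exponents come from one computation. Put \<theta> = \<mu> + 1/s - 1 - r and E =
  \<mu> + 1/s - 1/p. With n coefficients the truncation error is of order n^(-\<theta>) and the
  noise error of order \<delta> n^(r + 1 - 1/p); their quotient is \<delta> n^E, so they meet at n =
  \<delta>^(-1/E). Conversely, about m equal coefficients of size m^(-\<mu> - 1/s) at indices near m
  fit into the unit ball, have l_p norm of order m^(-E), and give an r-th derivative of weighted
  size m m^(-\<mu> - 1/s) m^r = m^(-\<theta>). The two kinds of fooling functions do different work:
  those avoiding \<open>\<Omega>\<close> force the radius to be large for small N and so bound
  \<open>N_min\<close> from below, while those hidden in the noise bound the radius from below for
  every N, in particular for \<open>N_min\<close>. Convergence of the expansion in L_{2,w} would not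
  suffice for the upper bound, because the error is a pointwise one of an r-th derivative. The
  series has to be differentiated term by term and identified with f almost everywhere; hence the
  moment problem.\<close>

definition lagp :: "real \<Rightarrow> nat \<Rightarrow> real poly" where
  "lagp \<alpha> k = (\<Sum>j\<le>k. monom ((- 1) ^ j * ((real k + \<alpha>) gchoose (k - j)) / fact j) j)"

lemma poly_lagp: "poly (lagp \<alpha> k) t = laguerre \<alpha> k t"
  by (simp add: lagp_def laguerre_def poly_sum poly_monom)

lemma coeff_lagp:
  "coeff (lagp \<alpha> k) j = (if j \<le> k then (- 1) ^ j * ((real k + \<alpha>) gchoose (k - j)) / fact j else 0)"
proof -
  have "coeff (lagp \<alpha> k) j =
      (\<Sum>i\<le>k. if i = j then (- 1) ^ i * ((real k + \<alpha>) gchoose (k - i)) / fact i else 0)"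
    by (simp add: lagp_def coeff_sum)
  also have "\<dots> = (if j \<le> k then (- 1) ^ j * ((real k + \<alpha>) gchoose (k - j)) / fact j else 0)"
    by (simp add: sum.delta)
  finally show ?thesis .
qed

lemma lagp_0 [simp]: "lagp \<alpha> 0 = 1"
  by (simp add: lagp_def monom_0)

text \<open>Below the top degree this is Pascal's rule, coefficient by coefficient; the factor
  \<open>Suc j\<close> brought down by differentiation cancels against the factorial. Telescoping
  over n gives \<open>pderiv_lagp\<close>.\<close>

lemma pderiv_lagp_Suc: "pderiv (lagp \<alpha> (Suc n)) = pderiv (lagp \<alpha> n) - lagp \<alpha> n"
proof (rule poly_eqI)
  fix j
  have fact: "of_nat (Suc j) * (if Suc j \<le> N then (- 1) ^ Suc j * b / fact (Suc j) else 0) =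
     (if Suc j \<le> N then - ((- 1) ^ j * b / fact j) else (0::real))" for b N
    by (simp add: divide_simps del: of_nat_Suc)
  consider "j < n" | "j = n" | "j > n" by linarith
  then show "coeff (pderiv (lagp \<alpha> (Suc n))) j = coeff (pderiv (lagp \<alpha> n) - lagp \<alpha> n) j"
  proof cases
    case 1
    define m where "m = n - Suc j"
    have m: "n - j = Suc m" "Suc n - Suc j = Suc m" "n - Suc j = m" using 1 by (auto simp: m_def)
    have "(real (Suc n) + \<alpha>) gchoose Suc m = ((real n + \<alpha>) gchoose m) + ((real n + \<alpha>) gchoose Suc m)"
      using gbinomial_Suc_Suc[of "real n + \<alpha>" m] by (simp add: add_ac)
    with 1 show ?thesis
      by (simp only: coeff_pderiv coeff_lagp m coeff_diff fact) (simp add: m(1) algebra_simps add_divide_distrib)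
  next
    case 2
    then show ?thesis by (simp only: coeff_pderiv coeff_lagp coeff_diff fact) simp
  next
    case 3
    then show ?thesis by (simp add: coeff_pderiv coeff_lagp)
  qed
qed

lemma pderiv_lagp: "pderiv (lagp \<alpha> n) = - (\<Sum>i<n. lagp \<alpha> i)"
  by (induction n) (simp_all add: pderiv_lagp_Suc)

text \<open>The operator t d/dt multiplies the j-th coefficient by j = (n + 1) - (n + 1 - j), and
  the absorption identity for binomial coefficients turns the subtracted multiple into a coefficient
  of L_n.\<close>

lemma X_pderiv_lagp:
  "[:0, 1:] * pderiv (lagp \<alpha> (Suc n)) =
     smult (real (Suc n)) (lagp \<alpha> (Suc n)) - smult (real (Suc n) + \<alpha>) (lagp \<alpha> n)"
proof (rule poly_eqI)
  fix j
  have "real j * coeff (lagp \<alpha> (Suc n)) j =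
     real (Suc n) * coeff (lagp \<alpha> (Suc n)) j - (real (Suc n) + \<alpha>) * coeff (lagp \<alpha> n) j"
  proof -
    consider "j \<le> n" | "j = Suc n" | "j > Suc n" by linarith
    then show ?thesis
    proof cases
      case 1
      define m where "m = n - j"
      have m: "n - j = m" "Suc n - j = Suc m" "real n = real m + real j" using 1 by (auto simp: m_def)
      have "real (Suc m) * ((real (Suc n) + \<alpha>) gchoose (Suc m)) = (real (Suc n) + \<alpha>) * ((real n + \<alpha>) gchoose m)"
        using gbinomial_absorption'[of "Suc m" "real (Suc n) + \<alpha>"] by (simp add: add_ac)
      moreover have "real (Suc m) = real (Suc n) - real j" using m by simp
      ultimately have "(real (Suc n) - real j) * (((real (Suc n) + \<alpha>) gchoose (Suc m)) * ((-1)^j / fact j))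
          = (real (Suc n) + \<alpha>) * (((real n + \<alpha>) gchoose m) * ((-1)^j / fact j))"
        by (simp only: mult.assoc[symmetric])
      moreover have "coeff (lagp \<alpha> (Suc n)) j = ((real (Suc n) + \<alpha>) gchoose (Suc m)) * ((-1)^j / fact j)"
        "coeff (lagp \<alpha> n) j = ((real n + \<alpha>) gchoose m) * ((-1)^j / fact j)"
        using 1 m by (simp_all add: coeff_lagp)
      ultimately show ?thesis by (simp only: left_diff_distrib)
    qed (simp_all add: coeff_lagp)
  qed
  moreover have "coeff ([:0, 1:] * pderiv P) j = real j * coeff P j" for P :: "real poly"
    by (cases j) (simp_all add: coeff_pderiv)
  ultimately show "coeff ([:0, 1:] * pderiv (lagp \<alpha> (Suc n))) j =
     coeff (smult (real (Suc n)) (lagp \<alpha> (Suc n)) - smult (real (Suc n) + \<alpha>) (lagp \<alpha> n)) j"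
    by (simp only: coeff_diff coeff_smult)
qed

text \<open>The three-term recurrence: multiply \<open>pderiv_lagp_Suc\<close> by t and eliminate
  both derivatives with \<open>X_pderiv_lagp\<close>. The lowest index lacks a predecessor and is
  treated in \<open>X_lagp_0\<close>.\<close>

lemma X_lagp:
  "[:0, 1:] * lagp \<alpha> (Suc n) = smult (2 * real n + 3 + \<alpha>) (lagp \<alpha> (Suc n))
     - smult (real n + 2) (lagp \<alpha> (Suc (Suc n))) - smult (real n + 1 + \<alpha>) (lagp \<alpha> n)"
proof (rule poly_ext)
  fix x
  have "poly ([:0,1:] * pderiv (lagp \<alpha> (Suc (Suc n)))) x = poly ([:0,1:] * pderiv (lagp \<alpha> (Suc n)) - [:0,1:] * lagp \<alpha> (Suc n)) x"
    by (subst pderiv_lagp_Suc) (simp add: algebra_simps)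
  then show "poly ([:0, 1:] * lagp \<alpha> (Suc n)) x = poly (smult (2 * real n + 3 + \<alpha>) (lagp \<alpha> (Suc n))
     - smult (real n + 2) (lagp \<alpha> (Suc (Suc n))) - smult (real n + 1 + \<alpha>) (lagp \<alpha> n)) x"
    unfolding X_pderiv_lagp poly_diff by (simp add: algebra_simps)
qed

lemma lagp_1: "lagp \<alpha> (Suc 0) = [:1 + \<alpha>, -1:]"
  by (simp add: lagp_def monom_altdef)

lemma X_lagp_0: "[:0, 1:] * lagp \<alpha> 0 = smult (1 + \<alpha>) (lagp \<alpha> 0) - lagp \<alpha> (Suc 0)"
  by (simp add: lagp_1)

text \<open>Laguerre's equation t y'' + (\<alpha> + 1 - t) y' + n y = 0. Differentiating
  \<open>X_pderiv_lagp\<close> brings in the derivative of the preceding polynomial;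
  \<open>pderiv_lagp_Suc\<close> replaces it by L_n' plus that polynomial, and
  \<open>X_pderiv_lagp\<close> itself removes the latter.\<close>

lemma lagp_ode:
  "[:0, 1:] * pderiv (pderiv (lagp \<alpha> n)) + [:\<alpha> + 1, -1:] * pderiv (lagp \<alpha> n) + smult (real n) (lagp \<alpha> n) = 0"
proof (cases n)
  case (Suc m)
  show ?thesis
  proof (rule poly_ext)
    fix x
    have "pderiv ([:0, 1:] * pderiv (lagp \<alpha> (Suc m))) =
       pderiv (smult (real (Suc m)) (lagp \<alpha> (Suc m)) - smult (real (Suc m) + \<alpha>) (lagp \<alpha> m))"
      by (simp only: X_pderiv_lagp)
    hence 1: "poly (pderiv (lagp \<alpha> (Suc m))) x + x * poly (pderiv (pderiv (lagp \<alpha> (Suc m)))) x =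
       real (Suc m) * poly (pderiv (lagp \<alpha> (Suc m))) x - (real (Suc m) + \<alpha>) * poly (pderiv (lagp \<alpha> m)) x"
      by (simp add: pderiv_mult pderiv_diff pderiv_smult pderiv_pCons poly_eq_poly_eq_iff[symmetric] fun_eq_iff)
    have 2: "poly (pderiv (lagp \<alpha> m)) x = poly (pderiv (lagp \<alpha> (Suc m))) x + poly (lagp \<alpha> m) x"
      by (simp add: pderiv_lagp_Suc)
    have 3: "x * poly (pderiv (lagp \<alpha> (Suc m))) x =
        real (Suc m) * poly (lagp \<alpha> (Suc m)) x - (real (Suc m) + \<alpha>) * poly (lagp \<alpha> m) x"
      using arg_cong[OF X_pderiv_lagp[of \<alpha> m], of "\<lambda>p. poly p x"] by simp
    have "x * poly (pderiv (pderiv (lagp \<alpha> (Suc m)))) x = real (Suc m) * poly (pderiv (lagp \<alpha> (Suc m))) x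
       - (real (Suc m) + \<alpha>) * (poly (pderiv (lagp \<alpha> (Suc m))) x + poly (lagp \<alpha> m) x) - poly (pderiv (lagp \<alpha> (Suc m))) x"
      using 1 unfolding 2 by linarith
    with 3 show "poly ([:0, 1:] * pderiv (pderiv (lagp \<alpha> n)) + [:\<alpha> + 1, -1:] * pderiv (lagp \<alpha> n) + smult (real n) (lagp \<alpha> n)) x = poly 0 x"
      by (simp add: Suc algebra_simps)
  qed
qed simp

section \<open>Orthogonality\<close>

definition wint :: "real \<Rightarrow> real poly \<Rightarrow> real" where
  "wint \<alpha> P = (LINT t:{0<..}|lborel. weight \<alpha> t * poly P t)"

definition lagnorm2 :: "real \<Rightarrow> nat \<Rightarrow> real" where
  "lagnorm2 \<alpha> n = Gamma (real n + \<alpha> + 1) / fact n"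

lemma weight_measurable [measurable]: "weight \<alpha> \<in> borel_measurable borel"
  unfolding weight_def by measurable

lemma poly_borel_measurable [measurable]: "poly (P :: real poly) \<in> borel_measurable borel"
  by (intro borel_measurable_continuous_onI continuous_intros)

lemma weight_nonneg: "weight \<alpha> t \<ge> 0"
  by (simp add: weight_def)

lemma weight_pos: "t > 0 \<Longrightarrow> weight \<alpha> t > 0"
  by (simp add: weight_def)

context
  fixes \<alpha> :: real
  assumes \<alpha>: "\<alpha> \<ge> 0"
begin

lemma has_bochner_integral_weight_power:
  "has_bochner_integral lborel (\<lambda>t. indicator {0<..} t * (weight \<alpha> t * t ^ j)) (Gamma (\<alpha> + real j + 1))"
proof (rule has_bochner_integral_nn_integral)
  have eq: "indicator {0..} t * t powr (\<alpha> + real j + 1 - 1) / exp t = indicator {0<..} t * (weight \<alpha> t * t ^ j)" for t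
    by (auto simp: indicator_def weight_def powr_add powr_realpow exp_minus field_simps)
  show "(\<integral>\<^sup>+ t. ennreal (indicator {0<..} t * (weight \<alpha> t * t ^ j)) \<partial>lborel) = ennreal (Gamma (\<alpha> + real j + 1))"
    using Gamma_conv_nn_integral_real[of "\<alpha> + real j + 1"] \<alpha> unfolding eq by simp
  show "AE t in lborel. 0 \<le> indicator {0<..} t * (weight \<alpha> t * t ^ j)"
    by (auto simp: indicator_def weight_nonneg)
  show "0 \<le> Gamma (\<alpha> + real j + 1)" using \<alpha> by (intro less_imp_le Gamma_real_pos) simp
qed simp

lemma set_integrable_weight_poly: "set_integrable lborel {0<..} (\<lambda>t. weight \<alpha> t * poly P t)"
proof -
  have "integrable lborel (\<lambda>t. \<Sum>i\<le>degree P. coeff P i * (indicator {0<..} t * (weight \<alpha> t * t ^ i)))"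
    using has_bochner_integral_weight_power by (intro Bochner_Integration.integrable_sum integrable_mult_right) (auto simp: has_bochner_integral_iff)
  also have "(\<lambda>t. \<Sum>i\<le>degree P. coeff P i * (indicator {0<..} t * (weight \<alpha> t * t ^ i))) =
     (\<lambda>t. indicator {0<..} t *\<^sub>R (weight \<alpha> t * poly P t))"
    by (simp add: poly_altdef sum_distrib_left sum_distrib_right algebra_simps)
  finally show ?thesis by (simp add: set_integrable_def)
qed

lemma wint_add: "wint \<alpha> (P + Q) = wint \<alpha> P + wint \<alpha> Q"
  unfolding wint_def by (simp add: algebra_simps set_integral_add set_integrable_weight_poly)

lemma wint_smult: "wint \<alpha> (smult c P) = c * wint \<alpha> P"
  unfolding wint_def by (simp flip: set_integral_mult_right add: algebra_simps)

lemma wint_0: "wint \<alpha> 0 = 0"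
  by (simp add: wint_def)

lemma wint_diff: "wint \<alpha> (P - Q) = wint \<alpha> P - wint \<alpha> Q"
  using wint_add[of P "smult (-1) Q"] wint_smult[of "-1" Q] by simp

lemma wint_sum: "wint \<alpha> (\<Sum>i\<in>A. f i) = (\<Sum>i\<in>A. wint \<alpha> (f i))"
  by (induction A rule: infinite_finite_induct) (simp_all add: wint_add wint_0)

lemma wint_monom: "wint \<alpha> (monom c j) = c * Gamma (\<alpha> + real j + 1)"
proof -
  have "wint \<alpha> (monom 1 j) = Gamma (\<alpha> + real j + 1)"
    using has_bochner_integral_weight_power[of j] unfolding wint_def set_lebesgue_integral_def
    by (simp add: has_bochner_integral_iff poly_monom)
  then show ?thesis using wint_smult[of c "monom 1 j"] by (simp add: smult_monom)
qed

lemma integral_weight_abs_poly_le: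
  assumes "\<And>t. t > 0 \<Longrightarrow> \<bar>poly P t\<bar> \<le> poly Q t"
  shows "(LINT t:{0<..}|lborel. weight \<alpha> t * \<bar>poly P t\<bar>) \<le> wint \<alpha> Q"
  unfolding wint_def
proof (rule set_integral_mono)
  have "set_integrable lborel {0<..} (\<lambda>t. \<bar>weight \<alpha> t * poly P t\<bar>)"
    by (rule set_integrable_abs[OF set_integrable_weight_poly])
  then show "set_integrable lborel {0<..} (\<lambda>t. weight \<alpha> t * \<bar>poly P t\<bar>)"
    by (simp add: abs_mult weight_nonneg)
qed (use assms in \<open>auto intro!: set_integrable_weight_poly mult_left_mono simp: weight_nonneg\<close>)

text \<open>\<open>w \<cdot> (t P' + (\<alpha> + 1 - t) P)\<close> is the derivative of \<open>t w P\<close>.\<close>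

lemma wint_total_derivative: "wint \<alpha> ([:0, 1:] * pderiv P + [:\<alpha> + 1, -1:] * P) = 0"
proof -
  define F where "F Q = wint \<alpha> ([:0, 1:] * pderiv Q + [:\<alpha> + 1, -1:] * Q)" for Q
  have "F (P + Q) = F P + F Q" for P Q
    unfolding F_def pderiv_add distrib_left wint_add by simp
  moreover have "F 0 = 0" by (simp add: F_def wint_0)
  ultimately have F_sum: "F (\<Sum>i\<in>A. f i) = (\<Sum>i\<in>A. F (f i))" for A :: "nat set" and f
    by (induction A rule: infinite_finite_induct) simp_all
  have monom: "F (monom c i) = 0" for c i
  proof -
    have "[:0, 1:] * pderiv (monom c i) + [:\<alpha> + 1, -1:] * monom c i =
        monom (c * (real i + \<alpha> + 1)) i - monom c (Suc i)"
      by (rule poly_ext) (cases i; simp add: pderiv_monom poly_monom algebra_simps)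
    moreover have "Gamma (\<alpha> + real (Suc i) + 1) = (\<alpha> + real i + 1) * Gamma (\<alpha> + real i + 1)"
    proof -
      have "\<alpha> + real i + 1 \<notin> \<int>\<^sub>\<le>\<^sub>0" using \<alpha> nonpos_Ints_nonpos[of "\<alpha> + real i + 1"] by auto
      from Gamma_plus1[OF this] show ?thesis by (simp add: add_ac)
    qed
    ultimately show ?thesis unfolding F_def by (simp only: wint_diff wint_monom) (simp add: algebra_simps)
  qed
  have "F P = F (\<Sum>i\<le>degree P. monom (coeff P i) i)" by (simp add: poly_as_sum_of_monoms)
  also have "\<dots> = 0" by (simp add: F_sum monom)
  finally show ?thesis by (simp add: F_def)
qed

lemma wint_lagp_orth:
  assumes "m \<noteq> n"
  shows "wint \<alpha> (lagp \<alpha> m * lagp \<alpha> n) = 0"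
proof -
  let ?L = "lagp \<alpha>"
  \<comment> \<open>The Wronskian, as for any Sturm-Liouville problem: by the differential equation
    the derivative of t w P is (n - m) w L_m L_n, whose integral therefore vanishes.\<close>
  define P where "P = pderiv (?L m) * ?L n - ?L m * pderiv (?L n)"
  have "[:0, 1:] * pderiv P + [:\<alpha> + 1, -1:] * P = smult (real n - real m) (?L m * ?L n)"
  proof (rule poly_ext)
    fix x
    have ode: "x * poly (pderiv (pderiv (?L k))) x = - (\<alpha> + 1 - x) * poly (pderiv (?L k)) x - real k * poly (?L k) x" for k
      using arg_cong[OF lagp_ode[of \<alpha> k], of "\<lambda>p. poly p x"] by (simp add: algebra_simps)
    have "poly ([:0, 1:] * pderiv P + [:\<alpha> + 1, -1:] * P) x =
       (x * poly (pderiv (pderiv (?L m))) x) * poly (?L n) x - poly (?L m) x * (x * poly (pderiv (pderiv (?L n))) x)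
        + (\<alpha> + 1 - x) * (poly (pderiv (?L m)) x * poly (?L n) x - poly (?L m) x * poly (pderiv (?L n)) x)"
      by (simp add: P_def pderiv_diff pderiv_mult algebra_simps)
    also have "\<dots> = (real n - real m) * (poly (?L m) x * poly (?L n) x)"
      unfolding ode by (simp add: algebra_simps)
    finally show "poly ([:0, 1:] * pderiv P + [:\<alpha> + 1, -1:] * P) x = poly (smult (real n - real m) (?L m * ?L n)) x"
      by simp
  qed
  with wint_total_derivative[of P] have "(real n - real m) * wint \<alpha> (?L m * ?L n) = 0"
    by (simp add: wint_smult)
  with assms show ?thesis by simp
qed

text \<open>Both sides are, up to the same sign, the integral of t w L_n L_{n+1}: the three-term
  recurrence is applied to one factor or to the other, and orthogonality leaves one term each
  time.\<close>

lemma wint_lagp_Suc: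
  "(real n + 1) * wint \<alpha> (lagp \<alpha> (Suc n) * lagp \<alpha> (Suc n)) = (real n + 1 + \<alpha>) * wint \<alpha> (lagp \<alpha> n * lagp \<alpha> n)"
proof -
  let ?L = "lagp \<alpha>"
  have "wint \<alpha> (([:0, 1:] * ?L (Suc n)) * ?L n) = - (real n + 1 + \<alpha>) * wint \<alpha> (?L n * ?L n)"
    unfolding X_lagp by (simp add: left_diff_distrib wint_diff wint_smult wint_lagp_orth) algebra
  moreover have "wint \<alpha> (([:0, 1:] * ?L n) * ?L (Suc n)) = - (real n + 1) * wint \<alpha> (?L (Suc n) * ?L (Suc n))"
  proof (cases n)
    case 0
    then show ?thesis unfolding 0 X_lagp_0
      using wint_lagp_orth[of 0 "Suc 0"] by (simp add: left_diff_distrib wint_diff wint_smult)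
  next
    case (Suc m)
    then show ?thesis unfolding Suc X_lagp
      by (simp add: left_diff_distrib wint_diff wint_smult wint_lagp_orth) algebra
  qed
  moreover have "([:0, 1:] * ?L (Suc n)) * ?L n = ([:0, 1:] * ?L n) * ?L (Suc n)"
    by (simp only: mult_ac)
  ultimately show ?thesis by (simp only: mult_minus_left neg_equal_iff_equal)
qed

lemma lagnorm2_pos: "lagnorm2 \<alpha> n > 0"
  using \<alpha> by (auto simp: lagnorm2_def intro!: divide_pos_pos Gamma_real_pos)

lemma lagnorm2_Suc: "lagnorm2 \<alpha> (Suc n) = (real n + 1 + \<alpha>) / (real n + 1) * lagnorm2 \<alpha> n"
proof -
  have "real n + \<alpha> + 1 \<notin> \<int>\<^sub>\<le>\<^sub>0" using \<alpha> nonpos_Ints_nonpos[of "real n + \<alpha> + 1"] by auto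
  from Gamma_plus1[OF this] show ?thesis by (simp add: lagnorm2_def add_ac)
qed

lemma wint_lagp_square: "wint \<alpha> (lagp \<alpha> n * lagp \<alpha> n) = lagnorm2 \<alpha> n"
proof (induction n)
  case 0
  have "wint \<alpha> 1 = Gamma (\<alpha> + 1)" using wint_monom[of 1 0] by (simp add: monom_0 one_pCons)
  then show ?case by (simp add: lagnorm2_def)
next
  case (Suc n)
  then show ?case using wint_lagp_Suc[of n] by (simp add: lagnorm2_Suc field_simps)
qed

text \<open>Since t w P vanishes at 0, it is the integral of its derivative over (0, t]. Taking
  absolute values and enlarging the interval removes the dependence on t.\<close>

lemma boundary_le_wint_derivative:
  assumes "t > 0"
  shows "\<bar>t * weight \<alpha> t * poly P t\<bar> \<le>
    (LINT u:{0<..}|lborel. weight \<alpha> u * \<bar>poly ([:0, 1:] * pderiv P + [:\<alpha> + 1, -1:] * P) u\<bar>)"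
proof -
  define R where "R = [:0, 1:] * pderiv P + [:\<alpha> + 1, -1:] * P"
  define F where "F u = u powr (\<alpha> + 1) * exp (- u) * poly P u" for u
  have "((\<lambda>u. weight \<alpha> u * poly R u) has_integral (F t - F 0)) {0..t}"
  proof (rule fundamental_theorem_of_calculus_interior)
    show "continuous_on {0..t} F"
      unfolding F_def using \<alpha> by (intro continuous_intros continuous_on_powr') auto
    fix u assume "u \<in> {0<..<t}"
    then have u: "u > 0" by simp
    have "(F has_real_derivative (\<alpha> + 1) * u powr \<alpha> * exp (-u) * poly P u
       + u powr (\<alpha> + 1) * (- exp (-u)) * poly P u + u powr (\<alpha> + 1) * exp (-u) * poly (pderiv P) u) (at u)"
      unfolding F_def using u by (auto intro!: derivative_eq_intros simp: algebra_simps)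
    also have "u powr (\<alpha> + 1) = u * u powr \<alpha>" using u by (simp add: powr_add)
    finally have "(F has_real_derivative weight \<alpha> u * poly R u) (at u)"
      by (simp add: R_def weight_def algebra_simps)
    then show "(F has_vector_derivative weight \<alpha> u * poly R u) (at u)"
      by (simp add: has_real_derivative_iff_has_vector_derivative)
  qed (use assms in simp)
  moreover have F0: "F 0 = 0" by (simp add: F_def)
  ultimately have Ft: "integral {0..t} (\<lambda>u. weight \<alpha> u * poly R u) = F t" by (simp add: has_integral_iff)
  have int: "set_integrable lborel {0<..t} (\<lambda>u. weight \<alpha> u * poly R u)"
    by (rule set_integrable_subset[OF set_integrable_weight_poly]) auto
  \<comment> \<open>\<open>0 powr \<alpha>\<close> is 0 for every \<alpha>, including \<alpha> = 0,
    so the weight vanishes at the added endpoint.\<close>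
  have ind: "indicator {0..t} u *\<^sub>R (weight \<alpha> u * poly R u) = indicator {0<..t} u *\<^sub>R (weight \<alpha> u * poly R u)" for u
    by (cases "u = 0") (auto simp: indicator_def weight_def)
  have int': "set_integrable lborel {0..t} (\<lambda>u. weight \<alpha> u * poly R u)"
    using int unfolding set_integrable_def ind .
  have "F t = (LINT u:{0<..t}|lborel. weight \<alpha> u * poly R u)"
    using set_borel_integral_eq_integral(2)[OF int'] Ft unfolding set_lebesgue_integral_def ind by simp
  also have "\<bar>\<dots>\<bar> \<le> (LINT u:{0<..t}|lborel. \<bar>weight \<alpha> u * poly R u\<bar>)"
    using set_integral_norm_bound[OF int] by simp
  also have "\<dots> \<le> (LINT u:{0<..}|lborel. \<bar>weight \<alpha> u * poly R u\<bar>)"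
    unfolding set_lebesgue_integral_def
  proof (rule integral_mono)
    show "integrable lborel (\<lambda>u. indicator {0<..t} u *\<^sub>R \<bar>weight \<alpha> u * poly R u\<bar>)"
      using set_integrable_abs[OF int] by (simp add: set_integrable_def)
    show "integrable lborel (\<lambda>u. indicator {0<..} u *\<^sub>R \<bar>weight \<alpha> u * poly R u\<bar>)"
      using set_integrable_abs[OF set_integrable_weight_poly] by (simp add: set_integrable_def)
  qed (auto simp: indicator_def)
  finally show ?thesis using assms
    by (simp add: F_def R_def abs_mult weight_nonneg) (simp add: weight_def powr_add mult_ac)
qed

text \<open>For P = L_n^2 the recurrences collapse the derivative of t w P to w L_n ((n + 1) L_{n+1}
  - (n + \<alpha>) L_{n-1}). Products are bounded by squares, whose integrals are known and
  comparable for neighbouring indices. The factor n + 1 is harmless once t is at least of order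
  n.\<close>

lemma laguerre_square_bound:
  assumes "t > 0"
  shows "t * weight \<alpha> t * (laguerre \<alpha> n t)\<^sup>2 \<le> (2 + 2 * \<alpha>) * (real n + 1) * lagnorm2 \<alpha> n"
proof -
  let ?L = "lagp \<alpha>"
  define P where "P = ?L n * ?L n"
  have AM: "\<bar>x * y\<bar> \<le> (x * x + y * y) / 2" for x y :: real
    using sum_squares_bound[of "\<bar>x\<bar>" "\<bar>y\<bar>"] by (simp add: power2_eq_square abs_mult)
  have "\<bar>t * weight \<alpha> t * poly P t\<bar> \<le> 
    (LINT u:{0<..}|lborel. weight \<alpha> u * \<bar>poly ([:0, 1:] * pderiv P + [:\<alpha> + 1, -1:] * P) u\<bar>)"
    by (rule boundary_le_wint_derivative[OF assms])
  also have "\<dots> \<le> (2 + 2 * \<alpha>) * (real n + 1) * lagnorm2 \<alpha> n"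
  proof (cases n)
    case 0
    define Q where "Q = smult (1/2) (?L 0 * ?L 0 + ?L (Suc 0) * ?L (Suc 0))"
    have "(LINT u:{0<..}|lborel. weight \<alpha> u * \<bar>poly ([:0, 1:] * pderiv P + [:\<alpha> + 1, -1:] * P) u\<bar>) \<le> wint \<alpha> Q"
    proof (rule integral_weight_abs_poly_le)
      fix u :: real
      show "\<bar>poly ([:0, 1:] * pderiv P + [:\<alpha> + 1, -1:] * P) u\<bar> \<le> poly Q u"
        using AM[of 1 "\<alpha> + 1 - u"] by (simp add: P_def Q_def 0 lagp_1 algebra_simps)
    qed
    also have "\<dots> = (2 + \<alpha>) / 2 * lagnorm2 \<alpha> 0"
      using lagnorm2_Suc[of 0] unfolding Q_def wint_smult wint_add wint_lagp_square by (simp add: field_simps)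
    also have "\<dots> \<le> (2 + 2 * \<alpha>) * (real n + 1) * lagnorm2 \<alpha> n"
      unfolding 0 using \<alpha> lagnorm2_pos[of 0] by (intro mult_right_mono) auto
    finally show ?thesis .
  next
    case (Suc m)
    define Q where "Q = smult ((real n + 1) / 2) (?L n * ?L n + ?L (Suc n) * ?L (Suc n))
      + smult ((real n + \<alpha>) / 2) (?L n * ?L n + ?L m * ?L m)"
    have "(LINT u:{0<..}|lborel. weight \<alpha> u * \<bar>poly ([:0, 1:] * pderiv P + [:\<alpha> + 1, -1:] * P) u\<bar>) \<le> wint \<alpha> Q"
    proof (rule integral_weight_abs_poly_le)
      fix u :: real
      have X1: "u * poly (pderiv (?L n)) u = real n * poly (?L n) u - (real n + \<alpha>) * poly (?L m) u"
        using arg_cong[OF X_pderiv_lagp[of \<alpha> m], of "\<lambda>p. poly p u"] by (simp add: Suc)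
      have X2: "u * poly (?L n) u = (2 * real n + 1 + \<alpha>) * poly (?L n) u - (real n + 1) * poly (?L (Suc n)) u
          - (real n + \<alpha>) * poly (?L m) u"
        using arg_cong[OF X_lagp[of \<alpha> m], of "\<lambda>p. poly p u"] by (simp add: Suc algebra_simps)
      have "poly ([:0, 1:] * pderiv P + [:\<alpha> + 1, -1:] * P) u =
        poly (?L n) u * (2 * (u * poly (pderiv (?L n)) u) + (\<alpha> + 1) * poly (?L n) u - u * poly (?L n) u)"
        by (simp add: P_def pderiv_mult algebra_simps)
      also have "\<dots> = (real n + 1) * (poly (?L n) u * poly (?L (Suc n)) u) - (real n + \<alpha>) * (poly (?L n) u * poly (?L m) u)"
        unfolding X1 X2 by (simp add: algebra_simps)
      also have "\<bar>\<dots>\<bar> \<le> (real n + 1) * \<bar>poly (?L n) u * poly (?L (Suc n)) u\<bar> + (real n + \<alpha>) * \<bar>poly (?L n) u * poly (?L m) u\<bar>"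
        using \<alpha> abs_triangle_ineq4[of "(real n + 1) * (poly (?L n) u * poly (?L (Suc n)) u)" "(real n + \<alpha>) * (poly (?L n) u * poly (?L m) u)"]
        by (simp add: abs_mult)
      also have "\<dots> \<le> (real n + 1) * ((poly (?L n) u * poly (?L n) u + poly (?L (Suc n)) u * poly (?L (Suc n)) u) / 2)
         + (real n + \<alpha>) * ((poly (?L n) u * poly (?L n) u + poly (?L m) u * poly (?L m) u) / 2)"
        using \<alpha> by (intro add_mono mult_left_mono AM) auto
      also have "\<dots> = poly Q u" by (simp add: Q_def)
      finally show "\<bar>poly ([:0, 1:] * pderiv P + [:\<alpha> + 1, -1:] * P) u\<bar> \<le> poly Q u" .
    qed
    also have "\<dots> = (real n + 1) / 2 * (lagnorm2 \<alpha> n + lagnorm2 \<alpha> (Suc n)) + (real n + \<alpha>) / 2 * (lagnorm2 \<alpha> n + lagnorm2 \<alpha> m)"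
      unfolding Q_def wint_smult wint_add wint_lagp_square by simp
    also have "\<dots> \<le> (real n + 1) / 2 * ((2 + \<alpha>) * lagnorm2 \<alpha> n) + ((1 + \<alpha>) * (real n + 1)) / 2 * (2 * lagnorm2 \<alpha> n)"
    proof (intro add_mono mult_left_mono mult_mono divide_right_mono)
      have "(real n + 1 + \<alpha>) / (real n + 1) \<le> 1 + \<alpha>" using \<alpha> by (simp add: field_simps)
      hence "lagnorm2 \<alpha> (Suc n) \<le> (1 + \<alpha>) * lagnorm2 \<alpha> n"
        unfolding lagnorm2_Suc using lagnorm2_pos[of n] by (intro mult_right_mono) auto
      then show "lagnorm2 \<alpha> n + lagnorm2 \<alpha> (Suc n) \<le> (2 + \<alpha>) * lagnorm2 \<alpha> n" by (simp add: algebra_simps)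
      have "1 \<le> (real m + 1 + \<alpha>) / (real m + 1)" using \<alpha> by (simp add: field_simps)
      from mult_right_mono[OF this, of "lagnorm2 \<alpha> m"] lagnorm2_pos[of m]
      have "lagnorm2 \<alpha> m \<le> lagnorm2 \<alpha> n" by (simp add: Suc lagnorm2_Suc)
      then show "lagnorm2 \<alpha> n + lagnorm2 \<alpha> m \<le> 2 * lagnorm2 \<alpha> n" by simp
      show "real n + \<alpha> \<le> (1 + \<alpha>) * (real n + 1)" using \<alpha> by (simp add: algebra_simps)
    qed (use \<alpha> lagnorm2_pos[of n] lagnorm2_pos[of m] in auto)
    also have "\<dots> = ((2 + \<alpha>) / 2 + (1 + \<alpha>)) * (real n + 1) * lagnorm2 \<alpha> n" by (simp add: field_simps)
    also have "\<dots> \<le> (2 + 2 * \<alpha>) * (real n + 1) * lagnorm2 \<alpha> n"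
      using \<alpha> lagnorm2_pos[of n] by (intro mult_right_mono) auto
    finally show ?thesis .
  qed
  finally show ?thesis using assms by (simp add: P_def poly_lagp power2_eq_square abs_mult weight_nonneg)
qed

end

section \<open>Uniform bounds for Laguerre polynomials\<close>

lemma tendsto_pos_imp_bounds:
  fixes X :: "nat \<Rightarrow> real"
  assumes "X \<longlonglongrightarrow> L" "L > 0" "\<And>n. X n > 0"
  shows "\<exists>c C. c > 0 \<and> C > 0 \<and> (\<forall>n. c \<le> X n \<and> X n \<le> C)"
proof -
  from assms(1) obtain C where C: "C > 0" "\<And>n. \<bar>X n\<bar> \<le> C"
    using convergent_imp_Bseq[of X] by (auto simp: convergent_def Bseq_def)
  have "(\<lambda>n. inverse (X n)) \<longlonglongrightarrow> inverse L" using assms by (intro tendsto_intros) auto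
  then obtain D where D: "D > 0" "\<And>n. \<bar>inverse (X n)\<bar> \<le> D"
    using convergent_imp_Bseq[of "\<lambda>n. inverse (X n)"] by (auto simp: convergent_def Bseq_def)
  have "inverse D \<le> X n" for n
    using D(2)[of n] assms(3)[of n] D(1) by (simp add: field_simps)
  moreover have "X n \<le> C" for n using C(2)[of n] by simp
  ultimately show ?thesis using C(1) D(1) by (intro exI[of _ "inverse D"] exI[of _ C]) auto
qed

abbreviation mx :: "nat \<Rightarrow> real" where "mx n \<equiv> real (max 1 n)"

section \<open>Size of the norms and behaviour near the origin\<close>

context
  fixes \<alpha> :: real
  assumes \<alpha>: "\<alpha> \<ge> 0"
begin

text \<open>Gauss's limit formula: the Pochhammer symbol in \<open>Gamma_series\<close> at \<alpha>
  + 1 contains Gamma(n + \<alpha> + 1), so the quotient by n^\<alpha> tends to 1. A positive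
  sequence with a positive limit stays between positive constants, which includes the small
  n.\<close>

lemma lagnorm2_asymp:
  "\<exists>c C. c > 0 \<and> C > 0 \<and> (\<forall>n. c * mx n powr \<alpha> \<le> lagnorm2 \<alpha> n \<and> lagnorm2 \<alpha> n \<le> C * mx n powr \<alpha>)"
proof -
  define X where "X n = lagnorm2 \<alpha> n / mx n powr \<alpha>" for n
  have Gp: "Gamma (\<alpha> + 1) > 0" using \<alpha> by (intro Gamma_real_pos) simp
  have ev: "Gamma (\<alpha> + 1) * (real n / (real n + (\<alpha> + 1))) / Gamma_series (\<alpha> + 1) n = X n" if n: "n \<ge> 1" for n
  proof -
    have "\<alpha> + 1 \<notin> \<int>\<^sub>\<le>\<^sub>0" using \<alpha> nonpos_Ints_nonpos[of "\<alpha> + 1"] by auto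
    then have "pochhammer (\<alpha> + 1) (n + 1) = Gamma (\<alpha> + 1 + real (n + 1)) / Gamma (\<alpha> + 1)"
      by (simp add: pochhammer_Gamma)
    moreover have "real n + \<alpha> + 1 \<notin> \<int>\<^sub>\<le>\<^sub>0" using \<alpha> nonpos_Ints_nonpos[of "real n + \<alpha> + 1"] by auto
    then have "Gamma (\<alpha> + 1 + real (n + 1)) = (real n + \<alpha> + 1) * Gamma (real n + \<alpha> + 1)"
      using Gamma_plus1[of "real n + \<alpha> + 1"] by (simp add: add_ac)
    ultimately have p: "pochhammer (\<alpha> + 1) (n + 1) = (real n + \<alpha> + 1) * Gamma (real n + \<alpha> + 1) / Gamma (\<alpha> + 1)"
      by simp
    have e: "exp ((\<alpha> + 1) * ln (real n)) = real n * real n powr \<alpha>"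
      using n by (simp add: powr_def distrib_right exp_add)
    have pos: "Gamma (real n + \<alpha> + 1) > 0" "real n powr \<alpha> > 0" "real n > 0"
      using \<alpha> n by (auto intro: Gamma_real_pos)
    have GS: "Gamma_series (\<alpha> + 1) n = fact n * (real n * real n powr \<alpha>) / pochhammer (\<alpha> + 1) (n + 1)"
      by (simp only: Gamma_series_def of_real_eq_id id_apply e)
    have m1: "mx n = real n" using n by simp
    show ?thesis using n Gp less_imp_neq[OF Gp] \<alpha> pos unfolding X_def GS lagnorm2_def p m1
      by (simp add: divide_simps add_ac)
  qed
  have "(\<lambda>n. real n / (real n + (\<alpha> + 1))) \<longlonglongrightarrow> 1"
    using \<alpha> by real_asymp
  then have "(\<lambda>n. Gamma (\<alpha> + 1) * (real n / (real n + (\<alpha> + 1))) / Gamma_series (\<alpha> + 1) n) \<longlonglongrightarrow> Gamma (\<alpha> + 1) * 1 / Gamma (\<alpha> + 1)"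
    using Gp by (intro tendsto_intros) auto
  then have "(\<lambda>n. Gamma (\<alpha> + 1) * (real n / (real n + (\<alpha> + 1))) / Gamma_series (\<alpha> + 1) n) \<longlonglongrightarrow> 1"
    using Gp by simp
  then have "X \<longlonglongrightarrow> 1"
    by (rule Lim_transform_eventually) (use ev in \<open>auto intro!: eventually_sequentiallyI[of 1]\<close>)
  from tendsto_pos_imp_bounds[OF this] obtain c C where
    "c > 0" "C > 0" "\<And>n. c \<le> X n \<and> X n \<le> C"
    using lagnorm2_pos[OF \<alpha>] by (auto simp: X_def)
  then show ?thesis
    by (intro exI[of _ c] exI[of _ C]) (auto simp: X_def field_simps)
qed

lemma lagnorm2_mono: "m \<le> n \<Longrightarrow> lagnorm2 \<alpha> m \<le> lagnorm2 \<alpha> n"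
proof (induction rule: dec_induct)
  case (step n)
  have "1 \<le> (real n + 1 + \<alpha>) / (real n + 1)" using \<alpha> by (simp add: field_simps)
  from mult_right_mono[OF this, of "lagnorm2 \<alpha> n"] lagnorm2_pos[OF \<alpha>, of n] step
  show ?case by (simp add: lagnorm2_Suc[OF \<alpha>])
qed simp

text \<open>This is the value L_n(0). It has order n^\<alpha>, whereas the norm of L_n has order
  n^(\<alpha>/2); the surplus n^(\<alpha>/2) is what sqrt w takes away again at t of order
  1/n.\<close>

lemma gbinomial_lagnorm2: "((real n + \<alpha>) gchoose n) = lagnorm2 \<alpha> n / Gamma (\<alpha> + 1)"
proof (induction n)
  case 0
  have "Gamma (\<alpha> + 1) > 0" using \<alpha> by (intro Gamma_real_pos) simp
  then show ?case by (simp add: lagnorm2_def)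
next
  case (Suc n)
  have "real (Suc n) * ((real (Suc n) + \<alpha>) gchoose Suc n) = (real (Suc n) + \<alpha>) * ((real n + \<alpha>) gchoose n)"
    using gbinomial_absorption[of n "real (Suc n) + \<alpha>"] by (simp add: add_ac)
  then have "((real (Suc n) + \<alpha>) gchoose Suc n) = (real (Suc n) + \<alpha>) / real (Suc n) * ((real n + \<alpha>) gchoose n)"
    by (simp add: eq_divide_eq mult_ac del: of_nat_Suc)
  then show ?case unfolding Suc lagnorm2_Suc[OF \<alpha>] by (simp add: add_ac)
qed

text \<open>Passing from the lower index k + 1 = n - j to k multiplies the binomial by (k + 1) /
  (\<alpha> + j + 1), which is at most n. Hence the j-th coefficient of L_n is at most L_n(0) n^j /
  j! in absolute value.\<close>

lemma gbinomial_le: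
  "j \<le> n \<Longrightarrow> 0 \<le> ((real n + \<alpha>) gchoose (n - j)) \<and> ((real n + \<alpha>) gchoose (n - j)) \<le> real n ^ j * ((real n + \<alpha>) gchoose n)"
proof (induction j)
  case 0
  have "Gamma (\<alpha> + 1) > 0" using \<alpha> by (intro Gamma_real_pos) simp
  then show ?case using lagnorm2_pos[OF \<alpha>, of n] by (simp add: gbinomial_lagnorm2)
next
  case (Suc j)
  define k where "k = n - Suc j"
  define x where "x = ((real n + \<alpha>) gchoose k)"
  define y where "y = ((real n + \<alpha>) gchoose Suc k)"
  have nk: "n - j = Suc k" "real n = real k + real j + 1" using Suc.prems by (auto simp: k_def)
  have "(real n + \<alpha> - real k) * x = real (Suc k) * y"
    using gbinomial_mult_1[of "real n + \<alpha>" k] by (simp add: x_def y_def algebra_simps)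
  then have eq: "(\<alpha> + real j + 1) * x = real (Suc k) * y" unfolding nk by (simp add: algebra_simps)
  have IH: "0 \<le> y" "y \<le> real n ^ j * ((real n + \<alpha>) gchoose n)"
    using Suc.IH Suc.prems by (auto simp: nk(1) y_def)
  have x0: "0 \<le> x"
  proof (rule ccontr)
    assume "\<not> 0 \<le> x"
    then have "(\<alpha> + real j + 1) * x < 0" using \<alpha> by (simp add: mult_pos_neg)
    moreover have "real (Suc k) * y \<ge> 0" using IH by (intro mult_nonneg_nonneg) auto
    ultimately show False using eq by linarith
  qed
  have "x \<le> (\<alpha> + real j + 1) * x" using mult_right_mono[of 1 "\<alpha> + real j + 1" x] x0 \<alpha> by simp
  also have "\<dots> \<le> real n * y" unfolding eq using IH nk by (intro mult_right_mono) auto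
  also have "\<dots> \<le> real n * (real n ^ j * ((real n + \<alpha>) gchoose n))" using IH by (intro mult_left_mono) auto
  finally show ?case using x0 by (simp add: x_def k_def mult_ac)
qed

text \<open>By \<open>gbinomial_le\<close> the series of L_n without its constant term is dominated
  by that of L_n(0) exp(n t). This is where the scale 1/n comes from.\<close>

lemma laguerre_near_0:
  assumes "t \<ge> 0"
  shows "\<bar>laguerre \<alpha> n t - ((real n + \<alpha>) gchoose n)\<bar> \<le> ((real n + \<alpha>) gchoose n) * (exp (real n * t) - 1)"
proof -
  define B where "B = ((real n + \<alpha>) gchoose n)"
  have B: "B \<ge> 0" using gbinomial_le[of 0 n] by (simp add: B_def)
  define f where "f j = (- 1) ^ j * ((real n + \<alpha>) gchoose (n - j)) * t ^ j / fact j" for j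
  define g where "g j = B * ((real n * t) ^ j / fact j)" for j
  have fg: "\<bar>f j\<bar> \<le> g j" if "j \<le> n" for j
  proof -
    have "\<bar>f j\<bar> = ((real n + \<alpha>) gchoose (n - j)) * (t ^ j / fact j)"
      using gbinomial_le[OF that] assms by (simp add: f_def abs_mult power_abs)
    also have "\<dots> \<le> (real n ^ j * B) * (t ^ j / fact j)"
      unfolding B_def using gbinomial_le[OF that] assms by (intro mult_right_mono) auto
    also have "\<dots> = g j" by (simp add: g_def power_mult_distrib)
    finally show ?thesis .
  qed
  have split: "(\<Sum>j\<le>n. h j) = h 0 + (\<Sum>j\<in>{1..n}. h j)" for h :: "nat \<Rightarrow> real"
    by (simp add: atMost_atLeast0 sum.atLeast_Suc_atMost)
  have "laguerre \<alpha> n t - B = (\<Sum>j\<in>{1..n}. f j)"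
    using split[of f] unfolding laguerre_def f_def B_def by simp
  also have "\<bar>\<dots>\<bar> \<le> (\<Sum>j\<in>{1..n}. g j)"
    by (rule order.trans[OF sum_abs]) (intro sum_mono fg, auto)
  also have "\<dots> = (\<Sum>j\<le>n. g j) - B" using split[of g] by (simp add: g_def)
  also have "(\<Sum>j\<le>n. g j) = B * (\<Sum>j\<le>n. (real n * t) ^ j / fact j)"
    by (simp add: g_def sum_distrib_left)
  also have "(\<Sum>j\<le>n. (real n * t) ^ j / fact j) \<le> exp (real n * t)"
  proof -
    have "(\<lambda>j. (real n * t) ^ j / fact j) sums exp (real n * t)"
      using exp_converges[of "real n * t"] by (simp add: divide_inverse mult_ac)
    then show ?thesis using assms
      by (intro sums_le[OF _ sums_finite[of "{..n}" "\<lambda>j. if j \<le> n then (real n * t) ^ j / fact j else 0", simplified]])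
         (auto simp: sum.If_cases)
  qed
  then have "B * (\<Sum>j\<le>n. (real n * t) ^ j / fact j) - B \<le> B * exp (real n * t) - B"
    using B by (simp add: mult_left_mono)
  finally show ?thesis by (simp add: B_def algebra_simps)
qed

lemma laguerre_abs_le:
  assumes "t \<ge> 0"
  shows "\<bar>laguerre \<alpha> n t\<bar> \<le> ((real n + \<alpha>) gchoose n) * exp (real n * t)"
proof -
  have "((real n + \<alpha>) gchoose n) \<ge> 0" using gbinomial_le[of 0 n] by simp
  with laguerre_near_0[OF assms, of n] show ?thesis
    unfolding right_diff_distrib by (simp only: abs_le_iff) linarith
qed

lemma laguerre_pos_near_0:
  assumes "t \<ge> 0" "real n * t \<le> 1 / 3"
  shows "laguerre \<alpha> n t \<ge> ((real n + \<alpha>) gchoose n) / 2"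
proof -
  define B where "B = ((real n + \<alpha>) gchoose n)"
  have B: "B \<ge> 0" using gbinomial_le[of 0 n] by (simp add: B_def)
  \<comment> \<open>The threshold 1/3 is small enough for exp(n t) \<le> 13/9 < 3/2, so that L_n
    deviates from L_n(0) by at most one half of it.\<close>
  have "exp (real n * t) \<le> exp (1/3)" using assms by simp
  also have "\<dots> \<le> 1 + 1/3 + (1/3)\<^sup>2" by (rule exp_bound) auto
  also have "\<dots> \<le> 3 / 2" by (simp add: power2_eq_square)
  finally have "B * (exp (real n * t) - 1) \<le> B * (1/2)" using B by (intro mult_left_mono) auto
  with laguerre_near_0[OF assms(1), of n] show ?thesis by (simp add: B_def abs_le_iff)
qed

text \<open>Sonin's function also contains the derivative; this controls it at the left endpoint of
  the oscillatory range.\<close>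

lemma pderiv_laguerre_abs_le:
  assumes "t \<ge> 0"
  shows "\<bar>poly (pderiv (lagp \<alpha> n)) t\<bar> \<le> real n * (((real n + \<alpha>) gchoose n) * exp (real n * t))"
proof -
  have "\<bar>poly (pderiv (lagp \<alpha> n)) t\<bar> \<le> (\<Sum>i<n. \<bar>laguerre \<alpha> i t\<bar>)"
    by (simp add: pderiv_lagp poly_sum poly_lagp sum_abs)
  also have "\<dots> \<le> (\<Sum>i<n. ((real n + \<alpha>) gchoose n) * exp (real n * t))"
  proof (rule sum_mono)
    fix i assume i: "i \<in> {..<n}"
    have G: "Gamma (\<alpha> + 1) > 0" using \<alpha> by (intro Gamma_real_pos) simp
    have "\<bar>laguerre \<alpha> i t\<bar> \<le> ((real i + \<alpha>) gchoose i) * exp (real i * t)" by (rule laguerre_abs_le[OF assms])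
    also have "\<dots> \<le> ((real n + \<alpha>) gchoose n) * exp (real n * t)"
      using i assms G lagnorm2_mono[of i n] lagnorm2_pos[OF \<alpha>, of n] unfolding gbinomial_lagnorm2
      by (intro mult_mono) (auto simp: divide_right_mono intro: mult_right_mono)
    finally show "\<bar>laguerre \<alpha> i t\<bar> \<le> ((real n + \<alpha>) gchoose n) * exp (real n * t)" .
  qed
  finally show ?thesis by simp
qed

text \<open>
  The function \<open>\<phi> = sqrt w \<cdot> L\<^sub>n\<close> satisfies \<open>t (t \<phi>')' + q \<phi> = 0\<close> with
  \<open>q = \<nu> t - t\<^sup>2/4 - \<alpha>\<^sup>2/4\<close>; Sonin's function \<open>\<phi>\<^sup>2 + (t \<phi>')\<^sup>2 / q\<close> then has derivative
  \<open>- (t \<phi>')\<^sup>2 q' / q\<^sup>2\<close>, so it decreases as long as \<open>q > 0\<close> and \<open>q' \<ge> 0\<close>, that is \<open>t \<le> 2\<nu>\<close>.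
  Below \<open>T\<close> stands for \<open>t \<phi>' / sqrt w\<close>.
\<close>

lemma sonin:
  fixes n :: nat
  defines "\<nu> \<equiv> real n + (\<alpha> + 1) / 2"
  defines "q \<equiv> \<lambda>u. \<nu> * u - u\<^sup>2 / 4 - \<alpha>\<^sup>2 / 4"
  defines "T \<equiv> \<lambda>u. (\<alpha> - u) / 2 * poly (lagp \<alpha> n) u + u * poly (pderiv (lagp \<alpha> n)) u"
  assumes "0 < t1" "t1 \<le> t" "t \<le> 2 * \<nu>"
    and q_pos: "\<And>u. t1 \<le> u \<Longrightarrow> u \<le> t \<Longrightarrow> q u > 0"
  shows "weight \<alpha> t * (poly (lagp \<alpha> n) t)\<^sup>2 \<le> weight \<alpha> t1 * ((poly (lagp \<alpha> n) t1)\<^sup>2 + (T t1)\<^sup>2 / q t1)"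
proof -
  define L where "L = poly (lagp \<alpha> n)"
  define L1 where "L1 = poly (pderiv (lagp \<alpha> n))"
  define L2 where "L2 = poly (pderiv (pderiv (lagp \<alpha> n)))"
  define S where "S u = weight \<alpha> u * ((L u)\<^sup>2 + (T u)\<^sup>2 / q u)" for u
  have "S t \<le> S t1"
  proof (rule DERIV_nonpos_imp_nonincreasing[OF assms(5)])
    fix u assume u: "t1 \<le> u" "u \<le> t"
    then have u0: "u > 0" and qu: "q u > 0" using assms q_pos by auto
    \<comment> \<open>The derivative of \<open>T\<close>, after L'' has been eliminated with the
      differential equation.\<close>
    define T1 where "T1 = - (real n + 1 / 2) * L u + (u - \<alpha>) / 2 * L1 u"
    have ode: "u * L2 u = - (\<alpha> + 1 - u) * L1 u - real n * L u"
      using arg_cong[OF lagp_ode[of \<alpha> n], of "\<lambda>p. poly p u"] by (simp add: L_def L1_def L2_def algebra_simps)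
    have dL: "(L has_real_derivative L1 u) (at u)" "(L1 has_real_derivative L2 u) (at u)"
      by (simp_all add: L_def L1_def L2_def poly_DERIV)
    have "(T has_real_derivative (- 1 / 2 * L u + (\<alpha> - u) / 2 * L1 u + (L1 u + u * L2 u))) (at u)"
      unfolding T_def L_def[symmetric] L1_def[symmetric]
      by (auto intro!: derivative_eq_intros dL simp: algebra_simps add_divide_distrib diff_divide_distrib)
    also have "- 1 / 2 * L u + (\<alpha> - u) / 2 * L1 u + (L1 u + u * L2 u) = T1"
      unfolding ode T1_def by (simp add: algebra_simps add_divide_distrib diff_divide_distrib)
    finally have dT: "(T has_real_derivative T1) (at u)" .
    have dq: "(q has_real_derivative (\<nu> - u / 2)) (at u)"
      unfolding q_def by (auto intro!: derivative_eq_intros)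
    have dw: "(weight \<alpha> has_real_derivative (weight \<alpha> u * (\<alpha> / u - 1))) (at u)"
    proof -
      have "(weight \<alpha> has_real_derivative (\<alpha> * u powr (\<alpha> - 1) * exp (- u) - u powr \<alpha> * exp (-u))) (at u)"
        unfolding weight_def[abs_def] using u0 by (auto intro!: derivative_eq_intros)
      also have "u powr (\<alpha> - 1) = u powr \<alpha> / u" using u0 by (simp add: powr_diff)
      finally show ?thesis by (simp add: weight_def[abs_def] algebra_simps)
    qed
    \<comment> \<open>S' / w without the term that comes from differentiating q. It vanishes by the
      equation t (t \<phi>')' + q \<phi> = 0, which here reads (\<alpha> - u) T + 2 u T' = -2 q
      L.\<close>
    define X where "X = (\<alpha> / u - 1) * ((L u)\<^sup>2 + (T u)\<^sup>2 / q u) + 2 * L u * L1 u + 2 * T u * T1 / q u"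
    have "(S has_real_derivative (weight \<alpha> u * (\<alpha> / u - 1) * ((L u)\<^sup>2 + (T u)\<^sup>2 / q u) +
        weight \<alpha> u * (2 * L u * L1 u + (2 * T u * T1 * q u - (T u)\<^sup>2 * (\<nu> - u / 2)) / (q u * q u)))) (at u)"
      unfolding S_def using qu by (auto intro!: derivative_eq_intros dL dT dq dw)
    also have "weight \<alpha> u * (\<alpha> / u - 1) * ((L u)\<^sup>2 + (T u)\<^sup>2 / q u) +
        weight \<alpha> u * (2 * L u * L1 u + (2 * T u * T1 * q u - (T u)\<^sup>2 * (\<nu> - u / 2)) / (q u * q u))
        = weight \<alpha> u * (X - (T u)\<^sup>2 * (\<nu> - u / 2) / (q u * q u))"
    proof -
      have "(2 * T u * T1 * q u - (T u)\<^sup>2 * (\<nu> - u / 2)) / (q u * q u)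
          = 2 * T u * T1 / q u - (T u)\<^sup>2 * (\<nu> - u / 2) / (q u * q u)"
        using qu by (simp add: diff_divide_distrib)
      then show ?thesis unfolding X_def by (simp only: ring_distribs mult.assoc add.assoc diff_conv_add_uminus)
    qed
    also have "X = 0"
    proof -
      have "X * (u * q u) = (\<alpha> - u) * ((L u)\<^sup>2 * q u + (T u)\<^sup>2) + 2 * u * L u * L1 u * q u + 2 * u * T u * T1"
        unfolding X_def using qu u0 by (simp add: field_simps)
      also have "\<dots> = q u * L u * ((\<alpha> - u) * L u + 2 * u * L1 u) + T u * ((\<alpha> - u) * T u + 2 * u * T1)"
        by (simp add: algebra_simps power2_eq_square)
      also have "(\<alpha> - u) * L u + 2 * u * L1 u = 2 * T u"
        by (simp add: T_def L_def L1_def)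
      also have "(\<alpha> - u) * T u + 2 * u * T1 = - 2 * L u * q u"
        unfolding T_def L_def[symmetric] L1_def[symmetric] T1_def q_def \<nu>_def
        by (simp add: field_simps power2_eq_square)
      finally have "X * (u * q u) = 0" by simp
      then show ?thesis using qu u0 by simp
    qed
    finally have "(S has_real_derivative weight \<alpha> u * (0 - (T u)\<^sup>2 * (\<nu> - u / 2) / (q u * q u))) (at u)" .
    moreover have "(T u)\<^sup>2 * (\<nu> - u / 2) / (q u * q u) \<ge> 0"
    proof (intro divide_nonneg_pos mult_nonneg_nonneg)
      show "0 \<le> \<nu> - u / 2" using u assms(6) by linarith
    qed (use qu in auto)
    then have "weight \<alpha> u * (0 - (T u)\<^sup>2 * (\<nu> - u / 2) / (q u * q u)) \<le> 0"
      using weight_nonneg[of \<alpha> u] by (simp add: mult_nonneg_nonneg del: times_divide_eq_right)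
    ultimately show "\<exists>y. (S has_real_derivative y) (at u) \<and> y \<le> 0" by blast
  qed
  moreover have "weight \<alpha> t * (L t)\<^sup>2 \<le> S t"
    unfolding S_def using q_pos[of t] assms(5) by (intro mult_left_mono) (auto simp: weight_nonneg)
  ultimately show ?thesis by (simp add: S_def L_def)
qed

end

section \<open>The weighted estimate, uniform in the degree and on the half-line\<close>

context
  fixes \<alpha> :: real
  assumes \<alpha>: "\<alpha> \<ge> 0"
begin

lemma laguerre_weighted_bound:
  "\<exists>C>0. \<forall>n. \<forall>t>0. weight \<alpha> t * (laguerre \<alpha> n t)\<^sup>2 \<le> C * mx n powr \<alpha>"
proof -
  obtain Ch where Ch: "Ch > 0" "\<And>n. lagnorm2 \<alpha> n \<le> Ch * mx n powr \<alpha>"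
    using lagnorm2_asymp[OF \<alpha>] by auto
  define Cb where "Cb = Ch / Gamma (\<alpha> + 1)"
  have G: "Gamma (\<alpha> + 1) > 0" using \<alpha> by (intro Gamma_real_pos) simp
  have Cb: "Cb > 0" "((real n + \<alpha>) gchoose n) \<le> Cb * mx n powr \<alpha>" for n
    using Ch G by (auto simp: Cb_def gbinomial_lagnorm2[OF \<alpha>] divide_right_mono)
  \<comment> \<open>The small-t range ends at \<open>t1 = c / \<nu>\<close>. This c makes q at least
    c/2 - \<alpha>^2/4 \<ge> 1/2 from there up to 2\<nu>, because u^2/4 \<le> \<nu> u / 2 on that
    range.\<close>
  define c where "c = \<alpha>\<^sup>2 + 1"
  have c: "c > 0" by (simp add: c_def add_nonneg_pos)
  \<comment> \<open>\<open>K1\<close> bounds the power series range, \<open>K2\<close> is the loss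
    through the derivative term of Sonin's function at \<open>t1\<close>, and \<open>K3\<close>
    comes from \<open>laguerre_square_bound\<close>, where n + 1 \<le> 4 t for t \<ge>
    \<nu>.\<close>
  define K1 where "K1 = (2 * c) powr \<alpha> * Cb\<^sup>2 * exp (2 * c)"
  define K2 where "K2 = 1 + 2 * (\<alpha> / 2 + 2 * c)\<^sup>2"
  define K3 where "K3 = 8 * (1 + \<alpha>) * Ch"
  have K: "K1 > 0" "K2 \<ge> 1" "K3 > 0" using c Cb(1) Ch \<alpha> by (auto simp: K1_def K2_def K3_def)
  have main: "weight \<alpha> t * (laguerre \<alpha> n t)\<^sup>2 \<le> (K2 * K1 + K3) * mx n powr \<alpha>" if t: "t > 0" for n t
  proof -
    define \<nu> where "\<nu> = real n + (\<alpha> + 1) / 2"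
    define M where "M = mx n"
    have M: "M \<ge> 1" "M \<le> 2 * \<nu>" "real n + 1 \<le> 2 * M" using \<alpha> by (auto simp: M_def \<nu>_def max_def field_simps)
    have \<nu>: "\<nu> > 0" using \<alpha> by (simp add: \<nu>_def add_nonneg_pos)
    define t1 where "t1 = c / \<nu>"
    define B where "B = ((real n + \<alpha>) gchoose n)"
    have B: "B \<ge> 0" "B \<le> Cb * M powr \<alpha>" using gbinomial_le[OF \<alpha>, of 0 n] Cb(2)[of n] by (auto simp: B_def M_def)
    have t1: "t1 > 0" "real n * t1 \<le> c" "t1 \<le> 2 * c"
    proof -
      show "t1 > 0" using c \<nu> by (simp add: t1_def)
      have "real n * c \<le> \<nu> * c" using c \<alpha> by (intro mult_right_mono) (auto simp: \<nu>_def)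
      then show "real n * t1 \<le> c" using \<nu> by (simp add: t1_def field_simps)
      have "c * 1 \<le> c * (2 * \<nu>)" using c \<alpha> by (intro mult_left_mono) (simp_all add: \<nu>_def add_divide_distrib)
      then show "t1 \<le> 2 * c" using \<nu> by (simp add: t1_def field_simps)
    qed
    \<comment> \<open>Here w is at most of order M^(-\<alpha>), while the square of L_n(0) is of
      order M^(2 \<alpha>). The bound is stated for L_n(0) exp(n u) rather than L_n, so that it also
      serves for \<open>T\<close> at \<open>t1\<close>.\<close>
    have small: "weight \<alpha> u * (B * exp (real n * u))\<^sup>2 \<le> K1 * M powr \<alpha>" if u: "0 < u" "u \<le> t1" for u
    proof -
      have "u \<le> 2 * c / M"
      proof -
        have "c / \<nu> \<le> c / (M / 2)" using M \<nu> c by (intro divide_left_mono) auto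
        then show ?thesis using u by (simp add: t1_def mult_ac)
      qed
      then have "u powr \<alpha> \<le> (2 * c / M) powr \<alpha>" using u \<alpha> by (intro powr_mono2) auto
      also have "\<dots> = (2 * c) powr \<alpha> / M powr \<alpha>" using c M by (intro powr_divide) 
      finally have "u powr \<alpha> * exp (- u) \<le> (2 * c) powr \<alpha> / M powr \<alpha> * 1"
        using u by (intro mult_mono) auto
      then have w: "weight \<alpha> u \<le> (2 * c) powr \<alpha> / M powr \<alpha>" by (simp add: weight_def)
      have "B * exp (real n * u) \<le> (Cb * M powr \<alpha>) * exp c"
      proof (intro mult_mono B)
        have "real n * u \<le> real n * t1" using u by (intro mult_left_mono) auto
        then show "exp (real n * u) \<le> exp c" using t1 by simp
      qed (use Cb in auto)
      then have "(B * exp (real n * u))\<^sup>2 \<le> ((Cb * M powr \<alpha>) * exp c)\<^sup>2"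
        using B by (intro power_mono) auto
      then have "weight \<alpha> u * (B * exp (real n * u))\<^sup>2 \<le> ((2 * c) powr \<alpha> / M powr \<alpha>) * ((Cb * M powr \<alpha>) * exp c)\<^sup>2"
        using w by (intro mult_mono) (auto simp: weight_nonneg)
      also have "\<dots> = K1 * M powr \<alpha>"
        using M by (simp add: K1_def power2_eq_square field_simps flip: exp_add)
      finally show ?thesis .
    qed
    have step: "weight \<alpha> t * (laguerre \<alpha> n t)\<^sup>2 \<le> K1 * M powr \<alpha>" if "t \<le> t1"
    proof -
      have "(laguerre \<alpha> n t)\<^sup>2 \<le> (B * exp (real n * t))\<^sup>2"
        using laguerre_abs_le[OF \<alpha>, of t n] t by (simp add: B_def power2_le_iff_abs_le abs_le_square_iff[symmetric])
      then have "weight \<alpha> t * (laguerre \<alpha> n t)\<^sup>2 \<le> weight \<alpha> t * (B * exp (real n * t))\<^sup>2"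
        by (intro mult_left_mono) (auto simp: weight_nonneg)
      with small[of t] t that show ?thesis by linarith
    qed
    consider "t \<le> t1" | "t \<ge> \<nu>" | "t1 \<le> t" "t \<le> \<nu>" by linarith
    then have "weight \<alpha> t * (laguerre \<alpha> n t)\<^sup>2 \<le> max (K2 * K1) K3 * M powr \<alpha>"
    proof cases
      case 1
      have "K1 \<le> K2 * K1" using K mult_right_mono[of 1 K2 K1] by simp
      then have "K1 * M powr \<alpha> \<le> max (K2 * K1) K3 * M powr \<alpha>" by (intro mult_right_mono) auto
      with step 1 show ?thesis by linarith
    next
      case 2
      have "t * weight \<alpha> t * (laguerre \<alpha> n t)\<^sup>2 \<le> (2 + 2 * \<alpha>) * (real n + 1) * lagnorm2 \<alpha> n"
        by (rule laguerre_square_bound[OF \<alpha> t])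
      also have "\<dots> \<le> (2 + 2 * \<alpha>) * (4 * t) * (Ch * M powr \<alpha>)"
        using M 2 Ch(2)[of n] lagnorm2_pos[OF \<alpha>, of n] \<alpha> \<nu> unfolding M_def
        by (intro mult_mono) auto
      also have "\<dots> = t * (K3 * M powr \<alpha>)" by (simp add: K3_def algebra_simps)
      finally have "weight \<alpha> t * (laguerre \<alpha> n t)\<^sup>2 \<le> K3 * M powr \<alpha>" using t by (simp add: mult.assoc)
      also have "\<dots> \<le> max (K2 * K1) K3 * M powr \<alpha>" by (intro mult_right_mono) auto
      finally show ?thesis .
    next
      case 3
      define q where "q u = \<nu> * u - u\<^sup>2 / 4 - \<alpha>\<^sup>2 / 4" for u
      have q: "q u \<ge> 1 / 2" if "t1 \<le> u" "u \<le> t" for u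
      proof -
        have u: "u \<le> 2 * \<nu>" "u > 0" using that 3 \<nu> t1 by auto
        have "c = \<nu> * t1" using \<nu> by (simp add: t1_def)
        also have "\<dots> \<le> \<nu> * u" using that \<nu> by (intro mult_left_mono) auto
        finally have "c \<le> \<nu> * u" .
        moreover have "u\<^sup>2 \<le> 2 * (\<nu> * u)" using u by (simp add: power2_eq_square)
        ultimately show ?thesis using zero_le_power2[of \<alpha>] unfolding q_def c_def by linarith
      qed
      define L where "L = poly (lagp \<alpha> n) t1"
      define T where "T = (\<alpha> - t1) / 2 * poly (lagp \<alpha> n) t1 + t1 * poly (pderiv (lagp \<alpha> n)) t1"
      have "weight \<alpha> t * (poly (lagp \<alpha> n) t)\<^sup>2 \<le> weight \<alpha> t1 * (L\<^sup>2 + T\<^sup>2 / q t1)"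
        unfolding L_def T_def q_def \<nu>_def
      proof (rule sonin[OF \<alpha> t1(1) 3(1)])
        show "t \<le> 2 * (real n + (\<alpha> + 1) / 2)" 
          using 3(2) \<nu> unfolding \<nu>_def[symmetric] by linarith
        fix u assume "t1 \<le> u" "u \<le> t"
        from q[OF this] show "0 < (real n + (\<alpha> + 1) / 2) * u - u\<^sup>2 / 4 - \<alpha>\<^sup>2 / 4"
          by (simp add: q_def \<nu>_def)
      qed
      also have "\<dots> \<le> weight \<alpha> t1 * (K2 * (B * exp (real n * t1))\<^sup>2)"
      proof (rule mult_left_mono)
        define D where "D = B * exp (real n * t1)"
        have D: "D \<ge> 0" using B by (simp add: D_def)
        have L: "\<bar>L\<bar> \<le> D" using laguerre_abs_le[OF \<alpha>, of t1 n] t1 by (simp add: L_def poly_lagp B_def D_def)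
        have "\<bar>T\<bar> \<le> \<bar>\<alpha> - t1\<bar> / 2 * \<bar>L\<bar> + t1 * \<bar>poly (pderiv (lagp \<alpha> n)) t1\<bar>"
          unfolding T_def L_def[symmetric] using t1 by (intro order.trans[OF abs_triangle_ineq]) (auto simp: abs_mult)
        also have "\<dots> \<le> (\<alpha> + 2 * c) / 2 * D + t1 * (real n * D)"
          using pderiv_laguerre_abs_le[OF \<alpha>, of t1 n] t1 \<alpha> L D
          by (intro add_mono mult_mono mult_left_mono) (auto simp: B_def D_def)
        also have "\<dots> = (\<alpha> + 2 * c) / 2 * D + (real n * t1) * D" by simp
        also have "\<dots> \<le> (\<alpha> + 2 * c) / 2 * D + c * D"
          using t1 D by (intro add_left_mono mult_right_mono) auto
        also have "\<dots> = (\<alpha> / 2 + 2 * c) * D" by (simp add: field_simps)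
        finally have "\<bar>T\<bar> \<le> (\<alpha> / 2 + 2 * c) * D" .
        then have T2: "T\<^sup>2 \<le> ((\<alpha> / 2 + 2 * c) * D)\<^sup>2" using power_mono[of "\<bar>T\<bar>" _ 2] by simp
        have L2: "L\<^sup>2 \<le> D\<^sup>2" using L power_mono[of "\<bar>L\<bar>" D 2] by simp
        have "T\<^sup>2 / q t1 \<le> T\<^sup>2 / (1 / 2)" using q[of t1] 3 by (intro divide_left_mono) auto
        then have "L\<^sup>2 + T\<^sup>2 / q t1 \<le> D\<^sup>2 + 2 * ((\<alpha> / 2 + 2 * c) * D)\<^sup>2" using T2 L2 by simp
        also have "\<dots> = K2 * D\<^sup>2" by (simp only: K2_def power_mult_distrib) (simp add: algebra_simps)
        finally show "L\<^sup>2 + T\<^sup>2 / q t1 \<le> K2 * (B * exp (real n * t1))\<^sup>2" by (simp add: D_def)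
      qed (rule weight_nonneg)
      also have "\<dots> = K2 * (weight \<alpha> t1 * (B * exp (real n * t1))\<^sup>2)" by (simp only: mult_ac)
      also have "\<dots> \<le> K2 * (K1 * M powr \<alpha>)" using small[of t1] t1 K by (intro mult_left_mono) auto
      also have "\<dots> \<le> max (K2 * K1) K3 * M powr \<alpha>" by (simp add: mult_right_mono flip: mult.assoc)
      finally show ?thesis by (simp add: poly_lagp)
    qed
    also have "\<dots> \<le> (K2 * K1 + K3) * M powr \<alpha>"
      using K by (intro mult_right_mono) (auto intro: mult_nonneg_nonneg)
    finally show ?thesis by (simp add: M_def)
  qed
  show ?thesis
    by (rule exI[of _ "K2 * K1 + K3"]) (use main K in \<open>auto intro!: add_pos_pos mult_pos_pos\<close>)
qed

end

section \<open>Orthonormal polynomials: derivatives from above and from below\<close>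

definition lonp :: "real \<Rightarrow> nat \<Rightarrow> real poly" where
  "lonp \<alpha> k = smult (1 / sqrt (lagnorm2 \<alpha> k)) (lagp \<alpha> k)"

lemma laguerre_on_eq_poly: "laguerre_on \<alpha> k = poly (lonp \<alpha> k)"
  by (rule ext) (simp add: laguerre_on_def lonp_def lagnorm2_def poly_lagp real_sqrt_divide)

lemma higher_deriv_poly: "(deriv ^^ j) (poly P) = poly ((pderiv ^^ j) (P :: real poly))"
proof (induction j)
  case (Suc j)
  show ?case unfolding funpow.simps comp_def Suc
    by (rule ext) (simp add: DERIV_imp_deriv poly_DERIV)
qed simp

lemma higher_pderiv_lagp_Suc:
  "(pderiv ^^ Suc j) (lagp \<alpha> k) = - (\<Sum>i<k. (pderiv ^^ j) (lagp \<alpha> i))"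
proof -
  have "(pderiv ^^ Suc j) (lagp \<alpha> k) = (pderiv ^^ j) (smult (-1) (\<Sum>i<k. lagp \<alpha> i))"
    by (simp only: funpow_Suc_right comp_def pderiv_lagp) simp
  then show ?thesis by (simp only: higher_pderiv_smult higher_pderiv_sum) simp
qed

context
  fixes \<alpha> :: real
  assumes \<alpha>: "\<alpha> \<ge> 0"
begin

text \<open>Each differentiation replaces L_k by a sum of k earlier polynomials with the same
  parameter \<alpha>, so it costs a factor k and keeps the weight. The formula with the parameter
  \<alpha> + 1 would change the weight at every step.\<close>

lemma lagp_deriv_weighted_bound:
  "\<exists>C>0. \<forall>j k. \<forall>t>0. \<bar>poly ((pderiv ^^ j) (lagp \<alpha> k)) t\<bar> * sqrt (weight \<alpha> t) \<le> C * mx k powr (\<alpha> / 2) * mx k ^ j"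
proof -
  obtain C where C: "C > 0" "\<And>n t. t > 0 \<Longrightarrow> weight \<alpha> t * (laguerre \<alpha> n t)\<^sup>2 \<le> C * mx n powr \<alpha>"
    using laguerre_weighted_bound[OF \<alpha>] by blast
  have "\<bar>poly ((pderiv ^^ j) (lagp \<alpha> k)) t\<bar> * sqrt (weight \<alpha> t) \<le> sqrt C * mx k powr (\<alpha> / 2) * mx k ^ j" 
    if t: "t > 0" for j k t
  proof (induction j arbitrary: k)
    case 0
    have "\<bar>laguerre \<alpha> k t\<bar> * sqrt (weight \<alpha> t) = sqrt (weight \<alpha> t * (laguerre \<alpha> k t)\<^sup>2)"
      by (simp add: real_sqrt_mult)
    also have "\<dots> \<le> sqrt (C * mx k powr \<alpha>)" using C(2)[OF t] by (intro real_sqrt_le_mono)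
    also have "\<dots> = sqrt C * mx k powr (\<alpha> / 2)" by (simp add: real_sqrt_mult powr_half_sqrt[symmetric] powr_powr)
    finally show ?case by (simp add: poly_lagp)
  next
    case (Suc j)
    let ?w = "sqrt (weight \<alpha> t)"
    have "\<bar>poly ((pderiv ^^ Suc j) (lagp \<alpha> k)) t\<bar> * ?w = \<bar>\<Sum>i<k. poly ((pderiv ^^ j) (lagp \<alpha> i)) t\<bar> * ?w"
      by (simp only: higher_pderiv_lagp_Suc) (simp add: poly_sum)
    also have "\<dots> \<le> (\<Sum>i<k. \<bar>poly ((pderiv ^^ j) (lagp \<alpha> i)) t\<bar> * ?w)"
      unfolding sum_distrib_right[symmetric] by (intro mult_right_mono sum_abs) (simp add: weight_nonneg)
    also have "\<dots> \<le> (\<Sum>i<k. sqrt C * mx k powr (\<alpha> / 2) * mx k ^ j)"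
    proof (rule sum_mono)
      fix i assume i: "i \<in> {..<k}"
      have "\<bar>poly ((pderiv ^^ j) (lagp \<alpha> i)) t\<bar> * ?w \<le> sqrt C * mx i powr (\<alpha> / 2) * mx i ^ j" by (rule Suc.IH)
      also have "\<dots> \<le> sqrt C * mx k powr (\<alpha> / 2) * mx k ^ j"
        using i C(1) \<alpha> by (intro mult_mono mult_left_mono powr_mono2 power_mono) auto
      finally show "\<bar>poly ((pderiv ^^ j) (lagp \<alpha> i)) t\<bar> * ?w \<le> sqrt C * mx k powr (\<alpha> / 2) * mx k ^ j" .
    qed
    also have "\<dots> = real k * (sqrt C * mx k powr (\<alpha> / 2) * mx k ^ j)"
      by (simp only: sum_constant card_lessThan)
    also have "\<dots> \<le> mx k * (sqrt C * mx k powr (\<alpha> / 2) * mx k ^ j)"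
      using C(1) by (intro mult_right_mono) auto
    finally show ?case by (simp only: power_Suc mult_ac)
  qed
  then show ?thesis using C(1) by (intro exI[of _ "sqrt C"]) auto
qed

lemma lonp_deriv_weighted_bound:
  "\<exists>C>0. \<forall>j k. \<forall>t>0. \<bar>poly ((pderiv ^^ j) (lonp \<alpha> k)) t\<bar> * sqrt (weight \<alpha> t) \<le> C * mx k ^ j"
proof -
  obtain C where C: "C > 0" "\<And>j k t. t > 0 \<Longrightarrow> 
      \<bar>poly ((pderiv ^^ j) (lagp \<alpha> k)) t\<bar> * sqrt (weight \<alpha> t) \<le> C * mx k powr (\<alpha> / 2) * mx k ^ j"
    using lagp_deriv_weighted_bound by blast
  obtain c where c: "c > 0" "\<And>n. c * mx n powr \<alpha> \<le> lagnorm2 \<alpha> n"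
    using lagnorm2_asymp[OF \<alpha>] by auto
  have "\<bar>poly ((pderiv ^^ j) (lonp \<alpha> k)) t\<bar> * sqrt (weight \<alpha> t) \<le> C / sqrt c * mx k ^ j" if t: "t > 0" for j k t
  proof -
    have "sqrt c * mx k powr (\<alpha> / 2) = sqrt (c * mx k powr \<alpha>)" 
      by (simp add: real_sqrt_mult powr_half_sqrt[symmetric] powr_powr)
    also have "\<dots> \<le> sqrt (lagnorm2 \<alpha> k)" using c(2)[of k] by (intro real_sqrt_le_mono)
    finally have h: "sqrt c * mx k powr (\<alpha> / 2) \<le> sqrt (lagnorm2 \<alpha> k)" .
    have pos: "mx k powr (\<alpha> / 2) > 0" by simp
    have "\<bar>poly ((pderiv ^^ j) (lonp \<alpha> k)) t\<bar> * sqrt (weight \<alpha> t)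
       = (\<bar>poly ((pderiv ^^ j) (lagp \<alpha> k)) t\<bar> * sqrt (weight \<alpha> t)) / sqrt (lagnorm2 \<alpha> k)"
      using lagnorm2_pos[OF \<alpha>, of k] by (simp add: lonp_def higher_pderiv_smult abs_mult)
    also have "\<dots> \<le> (C * mx k powr (\<alpha> / 2) * mx k ^ j) / (sqrt c * mx k powr (\<alpha> / 2))"
      using C(2)[OF t, where j = j and k = k] C(1) c(1) h pos weight_nonneg[of \<alpha> t] by (intro frac_le) auto
    also have "\<dots> = C / sqrt c * mx k ^ j" using pos by simp
    finally show ?thesis .
  qed
  then show ?thesis using C(1) c(1) by (intro exI[of _ "C / sqrt c"]) auto
qed

text \<open>The same sum, now with all terms of one sign: the upper half of the indices already
  gives the order k^(j+1). The sign statement, valid for all k, is carried through the induction in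
  order to discard the other terms. Halving the index at each step is the reason for
  \<open>2 ^ j \<le> k\<close>.\<close>

lemma lagp_deriv_lower_bound:
  "(\<forall>k t. 0 \<le> t \<and> real k * t \<le> 1 / 3 \<longrightarrow> (-1) ^ j * poly ((pderiv ^^ j) (lagp \<alpha> k)) t \<ge> 0) \<and>
   (\<exists>c>0. \<forall>k t. 0 \<le> t \<and> real k * t \<le> 1 / 3 \<and> 2 ^ j \<le> k \<longrightarrow>
      (-1) ^ j * poly ((pderiv ^^ j) (lagp \<alpha> k)) t \<ge> c * real k powr \<alpha> * real k ^ j)"
proof (induction j)
  case 0
  obtain c where c: "c > 0" "\<And>n. c * mx n powr \<alpha> \<le> lagnorm2 \<alpha> n"
    using lagnorm2_asymp[OF \<alpha>] by auto
  have G: "Gamma (\<alpha> + 1) > 0" using \<alpha> by (intro Gamma_real_pos) simp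
  have L: "laguerre \<alpha> k t \<ge> lagnorm2 \<alpha> k / (2 * Gamma (\<alpha> + 1))" if "0 \<le> t" "real k * t \<le> 1 / 3" for k t
    using laguerre_pos_near_0[OF \<alpha> that] unfolding gbinomial_lagnorm2[OF \<alpha>] by (simp add: mult_ac)
  have "0 \<le> laguerre \<alpha> k t" if "0 \<le> t" "real k * t \<le> 1 / 3" for k t
    by (rule order.trans[OF _ L[OF that]]) (use G lagnorm2_pos[OF \<alpha>, of k] in auto)
  moreover have "(c / (2 * Gamma (\<alpha> + 1))) * real k powr \<alpha> \<le> laguerre \<alpha> k t" 
    if "0 \<le> t" "real k * t \<le> 1 / 3" "1 \<le> k" for k t
  proof (rule order.trans[OF _ L[OF that(1,2)]])
    have "c * real k powr \<alpha> \<le> lagnorm2 \<alpha> k" using c(2)[of k] that(3) by simp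
    from divide_right_mono[OF this, of "2 * Gamma (\<alpha> + 1)"] G
    show "(c / (2 * Gamma (\<alpha> + 1))) * real k powr \<alpha> \<le> lagnorm2 \<alpha> k / (2 * Gamma (\<alpha> + 1))" by simp
  qed
  moreover have "c / (2 * Gamma (\<alpha> + 1)) > 0" using c G by simp
  ultimately show ?case
    by (intro conjI exI[of _ "c / (2 * Gamma (\<alpha> + 1))"] allI impI) (simp_all add: poly_lagp)
next
  case (Suc j)
  define x where "x i t = (-1) ^ j * poly ((pderiv ^^ j) (lagp \<alpha> i)) t" for i t
  from Suc obtain c where c: "c > 0"
    "\<And>k t. 0 \<le> t \<Longrightarrow> real k * t \<le> 1 / 3 \<Longrightarrow> 2 ^ j \<le> k \<Longrightarrow> c * real k powr \<alpha> * real k ^ j \<le> x k t"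
    by (auto simp: x_def)
  have x0: "x k t \<ge> 0" if "0 \<le> t" "real k * t \<le> 1 / 3" for k t using Suc that by (auto simp: x_def)
  have eq: "(-1) ^ Suc j * poly ((pderiv ^^ Suc j) (lagp \<alpha> k)) t = (\<Sum>i<k. x i t)" for k t
    by (simp only: higher_pderiv_lagp_Suc) (simp add: poly_sum x_def sum_distrib_left sum_negf)
  have le: "real i * t \<le> 1 / 3" if "0 \<le> t" "real k * t \<le> 1 / 3" "i < k" for i k t
  proof -
    have "real i * t \<le> real k * t" using that by (intro mult_right_mono) auto
    with that show ?thesis by linarith
  qed
  have low: "c / 3 * (1/2) powr \<alpha> * (1/2) ^ j * real k powr \<alpha> * real k ^ Suc j \<le> (\<Sum>i<k. x i t)"
    if t: "0 \<le> t" "real k * t \<le> 1 / 3" and k: "2 ^ Suc j \<le> k" for k t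
  proof -
    \<comment> \<open>For k \<ge> 2 this upper half contains at least k / 3 indices, and each of
      them is at least 2^j because k \<ge> 2^(j+1).\<close>
    define A where "A = {(k + 1) div 2..<k}"
    have k2: "k \<ge> 2" using k one_le_power[of "2::nat" j] unfolding power_Suc by linarith
    have "k \<le> 3 * card A" using k2 unfolding A_def card_atLeastLessThan by presburger
    then have "real k \<le> real (3 * card A)" by (simp only: of_nat_le_iff)
    then have "real k / 3 \<le> real (card A)" by simp
    then have "real k / 3 * (c * (real k / 2) powr \<alpha> * (real k / 2) ^ j) \<le> real (card A) * (c * (real k / 2) powr \<alpha> * (real k / 2) ^ j)"
      using c(1) by (intro mult_right_mono) auto
    also have "\<dots> = (\<Sum>i\<in>A. c * (real k / 2) powr \<alpha> * (real k / 2) ^ j)" by simp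
    also have "\<dots> \<le> (\<Sum>i\<in>A. x i t)"
    proof (rule sum_mono)
      fix i assume i: "i \<in> A"
      then have i': "i < k" "real k / 2 \<le> real i" "2 ^ j \<le> i" using k by (auto simp: A_def)
      have "c * (real k / 2) powr \<alpha> * (real k / 2) ^ j \<le> c * real i powr \<alpha> * real i ^ j"
        using i' c(1) \<alpha> by (intro mult_mono mult_left_mono powr_mono2 power_mono) auto
      also have "\<dots> \<le> x i t" using c(2)[of t i] t le[of t k i] i' by auto
      finally show "c * (real k / 2) powr \<alpha> * (real k / 2) ^ j \<le> x i t" .
    qed
    also have "\<dots> \<le> (\<Sum>i<k. x i t)"
      using t le[of t k] x0 by (intro sum_mono2) (auto simp: A_def)
    finally show ?thesis
      by (simp add: power_divide powr_divide mult_ac)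
  qed
  have "c / 3 * (1/2) powr \<alpha> * (1/2) ^ j > 0" using c(1) by simp
  moreover have "0 \<le> (\<Sum>i<k. x i t)" if t: "0 \<le> t" "real k * t \<le> 1 / 3" for k t
    using t le[of t k] x0 by (intro sum_nonneg) auto
  ultimately show ?case unfolding eq using low
    by (intro conjI exI[of _ "c / 3 * (1/2) powr \<alpha> * (1/2) ^ j"] allI impI) auto
qed

text \<open>For t of order 1/k the root of the weight is of order k^(-\<alpha>/2), so the product
  has exactly the order of \<open>lonp_deriv_weighted_bound\<close>.\<close>

lemma lonp_deriv_lower_bound:
  "\<exists>c>0. \<forall>k t. 0 \<le> t \<and> real k * t \<le> 1 / 3 \<and> 2 ^ j \<le> k \<longrightarrow>
      (-1) ^ j * poly ((pderiv ^^ j) (lonp \<alpha> k)) t \<ge> c * real k powr (\<alpha> / 2) * real k ^ j"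
proof -
  obtain c where c: "c > 0" "\<And>k t. 0 \<le> t \<Longrightarrow> real k * t \<le> 1 / 3 \<Longrightarrow> 2 ^ j \<le> k \<Longrightarrow>
      (-1) ^ j * poly ((pderiv ^^ j) (lagp \<alpha> k)) t \<ge> c * real k powr \<alpha> * real k ^ j"
    using lagp_deriv_lower_bound[of j] by blast
  obtain C where C: "C > 0" "\<And>n. lagnorm2 \<alpha> n \<le> C * mx n powr \<alpha>"
    using lagnorm2_asymp[OF \<alpha>] by auto
  have "c / sqrt C * real k powr (\<alpha> / 2) * real k ^ j \<le> (-1) ^ j * poly ((pderiv ^^ j) (lonp \<alpha> k)) t"
    if t: "0 \<le> t" "real k * t \<le> 1 / 3" "2 ^ j \<le> k" for k t
  proof -
    have k: "k \<ge> 1" using t(3) order.trans[OF one_le_power[of 2 j] t(3)] by simp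
    have "sqrt (lagnorm2 \<alpha> k) \<le> sqrt (C * real k powr \<alpha>)" using C(2)[of k] k by (intro real_sqrt_le_mono) simp
    also have "\<dots> = sqrt C * real k powr (\<alpha> / 2)" using k by (simp add: real_sqrt_mult powr_half_sqrt[symmetric] powr_powr)
    finally have h: "sqrt (lagnorm2 \<alpha> k) \<le> sqrt C * real k powr (\<alpha> / 2)" .
    have "real k powr \<alpha> = real k powr (\<alpha> / 2) * real k powr (\<alpha> / 2)" by (simp flip: powr_add)
    then have "c / sqrt C * real k powr (\<alpha> / 2) * real k ^ j = (c * real k powr \<alpha> * real k ^ j) / (sqrt C * real k powr (\<alpha> / 2))"
      using k by simp
    also have "\<dots> \<le> ((-1) ^ j * poly ((pderiv ^^ j) (lagp \<alpha> k)) t) / sqrt (lagnorm2 \<alpha> k)"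
      using c(2)[OF t] h lagnorm2_pos[OF \<alpha>, of k] c(1) by (intro frac_le) (auto intro: order.trans[OF _ c(2)[OF t]])
    also have "\<dots> = (-1) ^ j * poly ((pderiv ^^ j) (lonp \<alpha> k)) t"
      by (simp add: lonp_def higher_pderiv_smult)
    finally show ?thesis .
  qed
  then show ?thesis using c(1) C(1) by (intro exI[of _ "c / sqrt C"]) auto
qed

section \<open>Coefficients of polynomials\<close>

lemma inner_w_poly: "inner_w \<alpha> (poly P) (poly Q) = wint \<alpha> (P * Q)"
  by (simp add: inner_w_def wint_def mult_ac)

lemma poly_in_L2w: "poly P \<in> L2w \<alpha>"
proof -
  have "set_integrable lborel {0<..} (\<lambda>t. weight \<alpha> t * poly (P * P) t)"
    by (rule set_integrable_weight_poly[OF \<alpha>])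
  then show ?thesis unfolding L2w_def set_borel_measurable_def by (simp add: power2_eq_square)
qed

lemma wint_lonp: "wint \<alpha> (lonp \<alpha> i * lonp \<alpha> k) = (if i = k then 1 else 0)"
  using lagnorm2_pos[OF \<alpha>, of k]
  by (auto simp: lonp_def wint_smult[OF \<alpha>] wint_lagp_orth[OF \<alpha>] wint_lagp_square[OF \<alpha>])

lemma Gcoeff_poly:
  assumes "finite A"
  shows "Gcoeff \<alpha> (poly (\<Sum>i\<in>A. smult (a i) (lonp \<alpha> i))) = (\<lambda>k. if k \<in> A then a k else 0)"
proof
  fix k
  have "Gcoeff \<alpha> (poly (\<Sum>i\<in>A. smult (a i) (lonp \<alpha> i))) k = (\<Sum>i\<in>A. a i * wint \<alpha> (lonp \<alpha> i * lonp \<alpha> k))"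
    by (simp add: Gcoeff_def laguerre_on_eq_poly inner_w_poly sum_distrib_right wint_sum[OF \<alpha>] wint_smult[OF \<alpha>])
  also have "\<dots> = (if k \<in> A then a k else 0)"
    using assms by (simp add: wint_lonp if_distrib sum.delta cong: if_cong)
  finally show "Gcoeff \<alpha> (poly (\<Sum>i\<in>A. smult (a i) (lonp \<alpha> i))) k = (if k \<in> A then a k else 0)" .
qed

end

section \<open>Determinacy of the moment problem\<close>

lemma exp_sums: "(\<lambda>i. x ^ i / fact i) sums exp (x :: real)"
  using exp_converges[of x] by (simp add: divide_inverse mult_ac)

lemma power_le_fact_mult_exp:
  fixes t :: real
  assumes "t \<ge> 0"
  shows "t ^ j \<le> fact j * 8 ^ j * exp (t / 8)"
proof -
  have s: "(\<lambda>i. (t / 8) ^ i / fact i) sums exp (t / 8)" by (rule exp_sums)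
  have "sum (\<lambda>i. (t / 8) ^ i / fact i) {j} \<le> (\<Sum>i. (t / 8) ^ i / fact i)"
    by (rule sum_le_suminf[OF sums_summable[OF s]]) (use assms in auto)
  then have "t ^ j / (8 ^ j * fact j) \<le> exp (t / 8)"
    unfolding sums_unique[OF s, symmetric] by (simp add: power_divide)
  then show ?thesis by (simp add: divide_le_eq mult_ac)
qed

lemma abs_exp_partial_sum_le:
  fixes x :: real
  shows "\<bar>\<Sum>i<n. x ^ i / fact i\<bar> \<le> exp \<bar>x\<bar>"
proof -
  have s: "(\<lambda>i. \<bar>x\<bar> ^ i / fact i) sums exp \<bar>x\<bar>" by (rule exp_sums)
  have "\<bar>\<Sum>i<n. x ^ i / fact i\<bar> \<le> (\<Sum>i<n. \<bar>x\<bar> ^ i / fact i)"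
    by (rule order.trans[OF sum_abs]) (simp add: power_abs)
  also have "\<dots> \<le> (\<Sum>i. \<bar>x\<bar> ^ i / fact i)"
    by (rule sum_le_suminf[OF sums_summable[OF s]]) auto
  finally show ?thesis unfolding sums_unique[OF s, symmetric] .
qed

context
  fixes H :: "real \<Rightarrow> real"
  assumes H_meas [measurable]: "H \<in> borel_measurable borel"
    and H_supp: "\<And>t. t \<le> 0 \<Longrightarrow> H t = 0"
    and H_int: "integrable lborel (\<lambda>t. H t * exp (t / 4))"
begin

text \<open>The assumed factor exp(t / 4) is spent in two halves: one exp(t / 8) absorbs the power
  of t, the other is left for the exponential.\<close>

lemma integrable_power_exp:
  assumes "s \<le> 1 / 8"
  shows "integrable lborel (\<lambda>t. H t * t ^ j * exp (s * t))"
proof (rule Bochner_Integration.integrable_bound)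
  show "integrable lborel (\<lambda>t. (fact j * 8 ^ j) * (H t * exp (t / 4)))"
    by (intro integrable_mult_right H_int)
  show "AE t in lborel. norm (H t * t ^ j * exp (s * t)) \<le> norm ((fact j * 8 ^ j) * (H t * exp (t / 4)))"
  proof (rule AE_I2)
    fix t :: real
    show "norm (H t * t ^ j * exp (s * t)) \<le> norm ((fact j * 8 ^ j) * (H t * exp (t / 4)))"
    proof (cases "t \<le> 0")
      case False
      have "s * t \<le> 1 / 8 * t" using assms False by (intro mult_right_mono) auto
      then have "t ^ j * exp (s * t) \<le> (fact j * 8 ^ j * exp (t / 8)) * exp (t / 8)"
        using False by (intro mult_mono power_le_fact_mult_exp) auto
      also have "\<dots> = fact j * 8 ^ j * exp (t / 4)" by (simp flip: exp_add)
      finally have "\<bar>H t\<bar> * (t ^ j * exp (s * t)) \<le> \<bar>H t\<bar> * (fact j * 8 ^ j * exp (t / 4))"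
        by (intro mult_left_mono) auto
      then show ?thesis using False by (simp add: abs_mult mult_ac)
    qed (simp add: H_supp)
  qed
qed simp

lemma integrable_power: "integrable lborel (\<lambda>t. H t * t ^ j)"
  using integrable_power_exp[of 0 j] by simp

lemma integrable_H: "integrable lborel H"
  using integrable_power[of 0] by simp

lemma integrable_poly: "integrable lborel (\<lambda>t. H t * poly P t)"
proof -
  have "integrable lborel (\<lambda>t. \<Sum>i\<le>degree P. coeff P i * (H t * t ^ i))"
    by (intro Bochner_Integration.integrable_sum integrable_mult_right integrable_power)
  then show ?thesis by (simp add: poly_altdef sum_distrib_left algebra_simps)
qed

context
  assumes moments: "\<And>j. (\<integral>t. H t * t ^ j \<partial>lborel) = 0"
begin

text \<open>
  Expanding \<open>exp (- t / 8)\<close> in a power series and integrating term by term moves the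
  vanishing moments from \<open>H\<close> to \<open>H \<cdot> exp (- t / 8)\<close>, and so on.
\<close>

lemma exp_moments: "(\<integral>t. H t * t ^ j * exp (- (real m / 8) * t) \<partial>lborel) = 0"
proof (induction m arbitrary: j)
  case 0
  then show ?case using moments by simp
next
  case (Suc m)
  define g where "g n t = H t * t ^ j * exp (- (real m / 8) * t) * (\<Sum>i<n. (- t / 8) ^ i / fact i)" for n t
  have m8: "- (real m / 8) \<le> 1 / 8" by simp
  have "(\<lambda>n. \<integral>t. g n t \<partial>lborel) \<longlonglongrightarrow> (\<integral>t. H t * t ^ j * exp (- (real (Suc m) / 8) * t) \<partial>lborel)"
  proof (rule integral_dominated_convergence)
    \<comment> \<open>Partial sums of exp(-t / 8) are at most exp(t / 8) in absolute value, and the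
      exponential gained so far is at most 1; so one majorant serves for all m.\<close>
    show "integrable lborel (\<lambda>t. norm (H t * t ^ j * exp (1 / 8 * t)))"
      by (intro integrable_norm integrable_power_exp) simp
    show "AE t in lborel. (\<lambda>n. g n t) \<longlonglongrightarrow> H t * t ^ j * exp (- (real (Suc m) / 8) * t)"
    proof (rule AE_I2)
      fix t :: real
      have "(\<lambda>i. (- t / 8) ^ i / fact i) sums exp (- t / 8)" by (rule exp_sums)
      then have "(\<lambda>n. g n t) \<longlonglongrightarrow> H t * t ^ j * exp (- (real m / 8) * t) * exp (- t / 8)"
        unfolding g_def sums_def by (intro tendsto_intros)
      also have "H t * t ^ j * exp (- (real m / 8) * t) * exp (- t / 8) = H t * t ^ j * exp (- (real (Suc m) / 8) * t)"
        by (simp add: mult.assoc field_simps flip: exp_add)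
      finally show "(\<lambda>n. g n t) \<longlonglongrightarrow> H t * t ^ j * exp (- (real (Suc m) / 8) * t)" .
    qed
    show "AE t in lborel. norm (g n t) \<le> norm (H t * t ^ j * exp (1 / 8 * t))" for n
    proof (rule AE_I2)
      fix t :: real
      show "norm (g n t) \<le> norm (H t * t ^ j * exp (1 / 8 * t))"
      proof (cases "t \<le> 0")
        case False
        have "exp (- (real m / 8) * t) * \<bar>\<Sum>i<n. (- t / 8) ^ i / fact i\<bar> \<le> 1 * exp \<bar>- t / 8\<bar>"
          using False by (intro mult_mono abs_exp_partial_sum_le) auto
        then have "\<bar>H t * t ^ j\<bar> * (exp (- (real m / 8) * t) * \<bar>\<Sum>i<n. (- t / 8) ^ i / fact i\<bar>) \<le> \<bar>H t * t ^ j\<bar> * exp (1 / 8 * t)"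
          using False by (intro mult_left_mono) auto
        then show ?thesis unfolding g_def by (simp only: real_norm_def abs_mult abs_exp_cancel mult_ac)
      qed (simp add: H_supp g_def)
    qed
  qed (simp_all add: g_def)
  moreover have "(\<integral>t. g n t \<partial>lborel) = 0" for n
  proof -
    have "g n t = (\<Sum>i<n. ((- 1 / 8) ^ i / fact i) * (H t * t ^ (j + i) * exp (- (real m / 8) * t)))" for t
    proof -
      have "(- t / 8) ^ i = (- 1 / 8) ^ i * t ^ i" for i
        unfolding power_mult_distrib[symmetric] by simp
      then show ?thesis unfolding g_def sum_distrib_left power_add
        by (simp only: mult_ac times_divide_eq_left times_divide_eq_right)
    qed
    then have "(\<integral>t. g n t \<partial>lborel) =
        (\<integral>t. (\<Sum>i<n. ((- 1 / 8) ^ i / fact i) * (H t * t ^ (j + i) * exp (- (real m / 8) * t))) \<partial>lborel)"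
      by presburger
    also have "\<dots> = (\<Sum>i<n. \<integral>t. ((- 1 / 8) ^ i / fact i) * (H t * t ^ (j + i) * exp (- (real m / 8) * t)) \<partial>lborel)"
      by (rule Bochner_Integration.integral_sum) (intro integrable_mult_right integrable_power_exp[OF m8])
    also have "\<dots> = (\<Sum>i<n. 0)"
    proof (rule sum.cong[OF refl])
      fix i
      show "(\<integral>t. ((- 1 / 8) ^ i / fact i) * (H t * t ^ (j + i) * exp (- (real m / 8) * t)) \<partial>lborel) = 0"
        by (subst integral_mult_right_zero, subst Suc.IH, rule mult_zero_right)
    qed
    also have "\<dots> = 0" by simp
    finally show ?thesis .
  qed
  ultimately show ?case by (simp add: LIMSEQ_const_iff)
qed

text \<open>With x = exp(-t / 8), polynomials in x are combinations of the functions exp(-i t / 8)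
  from \<open>exp_moments\<close>. As x stays in [0, 1], the Weierstrass theorem extends the
  vanishing to continuous functions of x, with an error at most e times the integral of |H|.\<close>

lemma integral_continuous_exp_eq_0:
  fixes g :: "real \<Rightarrow> real"
  assumes g: "continuous_on UNIV g" and g1: "\<And>x. \<bar>g x\<bar> \<le> 1"
  shows "(\<integral>t. H t * g (exp (- t / 8)) \<partial>lborel) = 0"
proof -
  have [measurable]: "g \<in> borel_measurable borel" using g by (rule borel_measurable_continuous_onI)
  have int_g: "integrable lborel (\<lambda>t. H t * g (exp (- t / 8)))"
  proof (rule Bochner_Integration.integrable_bound[OF integrable_H])
    show "AE t in lborel. norm (H t * g (exp (- t / 8))) \<le> norm (H t)"
    proof (rule AE_I2)
      fix t show "norm (H t * g (exp (- t / 8))) \<le> norm (H t)"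
        using mult_left_mono[OF g1[of "exp (- t / 8)"], of "\<bar>H t\<bar>"] by (simp add: abs_mult)
    qed
  qed simp
  have bound: "\<bar>\<integral>t. H t * g (exp (- t / 8)) \<partial>lborel\<bar> \<le> e * (\<integral>t. \<bar>H t\<bar> \<partial>lborel)" if e: "e > 0" for e
  proof -
    obtain p where p: "real_polynomial_function p" "\<And>x. x \<in> {0..1} \<Longrightarrow> \<bar>g x - p x\<bar> < e"
      using Stone_Weierstrass_real_polynomial_function[OF compact_Icc[of 0 1] continuous_on_subset[OF g subset_UNIV] e] by blast
    from p(1) obtain a n where an: "p = (\<lambda>x. \<Sum>i\<le>n. a i * x ^ i)"
      unfolding real_polynomial_function_iff_sum by blast
    have pe: "H t * p (exp (- t / 8)) = (\<Sum>i\<le>n. a i * (H t * t ^ 0 * exp (- (real i / 8) * t)))" for t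
    proof -
      have "exp (- t / 8) ^ i = exp (- (real i / 8) * t)" for i
        unfolding exp_of_nat_mult[symmetric] by simp
      then show ?thesis unfolding an sum_distrib_left by (simp only: power_0 mult_1_right mult.left_commute)
    qed
    have m8: "- (real i / 8) \<le> 1 / 8" for i by simp
    have int_p: "integrable lborel (\<lambda>t. H t * p (exp (- t / 8)))"
      unfolding pe by (intro Bochner_Integration.integrable_sum integrable_mult_right integrable_power_exp m8)
    have "(\<integral>t. H t * p (exp (- t / 8)) \<partial>lborel) =
        (\<Sum>i\<le>n. \<integral>t. a i * (H t * t ^ 0 * exp (- (real i / 8) * t)) \<partial>lborel)"
      unfolding pe by (rule Bochner_Integration.integral_sum) (intro integrable_mult_right integrable_power_exp[OF m8])
    also have "\<dots> = (\<Sum>i\<le>n. 0)"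
    proof (rule sum.cong[OF refl])
      fix i
      show "(\<integral>t. a i * (H t * t ^ 0 * exp (- (real i / 8) * t)) \<partial>lborel) = 0"
        by (subst integral_mult_right_zero, subst exp_moments, rule mult_zero_right)
    qed
    finally have "(\<integral>t. H t * p (exp (- t / 8)) \<partial>lborel) = 0" by simp
    then have "(\<integral>t. H t * g (exp (- t / 8)) \<partial>lborel) = (\<integral>t. H t * g (exp (- t / 8)) - H t * p (exp (- t / 8)) \<partial>lborel)"
      using int_g int_p by simp
    also have "\<bar>\<dots>\<bar> \<le> (\<integral>t. \<bar>H t * g (exp (- t / 8)) - H t * p (exp (- t / 8))\<bar> \<partial>lborel)"
      by (rule integral_abs_bound)
    also have "\<dots> \<le> (\<integral>t. e * \<bar>H t\<bar> \<partial>lborel)"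
    proof (rule integral_mono)
      show "integrable lborel (\<lambda>t. e * \<bar>H t\<bar>)" by (intro integrable_mult_right integrable_abs integrable_H)
      show "integrable lborel (\<lambda>t. \<bar>H t * g (exp (- t / 8)) - H t * p (exp (- t / 8))\<bar>)"
        by (intro integrable_abs Bochner_Integration.integrable_diff int_g int_p)
      fix t
      show "\<bar>H t * g (exp (- t / 8)) - H t * p (exp (- t / 8))\<bar> \<le> e * \<bar>H t\<bar>"
      proof (cases "t \<le> 0")
        case False
        then have "\<bar>g (exp (- t / 8)) - p (exp (- t / 8))\<bar> \<le> e" using p(2)[of "exp (- t / 8)"] by simp
        from mult_left_mono[OF this, of "\<bar>H t\<bar>"] show ?thesis
          by (simp add: abs_mult[symmetric] right_diff_distrib mult_ac)
      qed (simp add: H_supp)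
    qed
    also have "\<dots> = e * (\<integral>t. \<bar>H t\<bar> \<partial>lborel)" by simp
    finally show ?thesis .
  qed
  have "\<bar>\<integral>t. H t * g (exp (- t / 8)) \<partial>lborel\<bar> \<le> 0"
  proof (rule field_le_epsilon)
    fix e :: real assume e: "e > 0"
    define I where "I = (\<integral>t. \<bar>H t\<bar> \<partial>lborel)"
    have I: "I \<ge> 0" by (simp add: I_def)
    have "\<bar>\<integral>t. H t * g (exp (- t / 8)) \<partial>lborel\<bar> \<le> e / (I + 1) * I"
      using bound[of "e / (I + 1)"] e I unfolding I_def[symmetric] by (simp only: divide_pos_pos)
    also have "\<dots> \<le> e" using e I by (simp add: field_simps)
    finally show "\<bar>\<integral>t. H t * g (exp (- t / 8)) \<partial>lborel\<bar> \<le> 0 + e" by simp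
  qed
  then show ?thesis by simp
qed

text \<open>The condition t > c means x < exp(-c / 8); the indicator of this set is the pointwise
  limit of the ramps \<open>F n\<close>, which are continuous and bounded by 1.\<close>

lemma integral_greaterThan_eq_0: "(\<integral>t. H t * indicator {c<..} t \<partial>lborel) = 0"
proof -
  define F where "F n x = min 1 (max 0 (real n * (exp (- c / 8) - x)))" for n x
  have F: "continuous_on UNIV (F n)" "\<bar>F n x\<bar> \<le> 1" for n x
    unfolding F_def by (auto intro!: continuous_intros)
  have [measurable]: "F n \<in> borel_measurable borel" for n by (rule borel_measurable_continuous_onI[OF F(1)])
  have "(\<lambda>n. \<integral>t. H t * F n (exp (- t / 8)) \<partial>lborel) \<longlonglongrightarrow> (\<integral>t. H t * indicator {c<..} t \<partial>lborel)"
  proof (rule integral_dominated_convergence)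
    show "integrable lborel (\<lambda>t. norm (H t))" by (intro integrable_norm integrable_H)
    show "AE t in lborel. norm (H t * F n (exp (- t / 8))) \<le> norm (H t)" for n
    proof (rule AE_I2)
      fix t show "norm (H t * F n (exp (- t / 8))) \<le> norm (H t)"
        using mult_left_mono[OF F(2)[of n "exp (- t / 8)"], of "\<bar>H t\<bar>"] by (simp add: abs_mult)
    qed
    show "AE t in lborel. (\<lambda>n. H t * F n (exp (- t / 8))) \<longlonglongrightarrow> H t * indicator {c<..} t"
    proof (rule AE_I2)
      fix t :: real
      have "(\<lambda>n. F n (exp (- t / 8))) \<longlonglongrightarrow> indicator {c<..} t"
      proof (cases "t > c")
        case True
        define d where "d = exp (- c / 8) - exp (- t / 8)"
        have d: "d > 0" using True by (simp add: d_def)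
        have "eventually (\<lambda>n. real n * d \<ge> 1) sequentially"
          using d by real_asymp
        then have "eventually (\<lambda>n. F n (exp (- t / 8)) = 1) sequentially"
          by eventually_elim (simp add: F_def d_def)
        then show ?thesis using True by (simp add: tendsto_eventually)
      next
        case False
        then have "exp (- c / 8) - exp (- t / 8) \<le> 0" by simp
        then have "F n (exp (- t / 8)) = 0" for n
          unfolding F_def by (simp add: mult_nonneg_nonpos max_absorb1)
        then show ?thesis using False by simp
      qed
      then show "(\<lambda>n. H t * F n (exp (- t / 8))) \<longlonglongrightarrow> H t * indicator {c<..} t"
        by (intro tendsto_intros)
    qed
  qed simp_all
  moreover have "(\<integral>t. H t * F n (exp (- t / 8)) \<partial>lborel) = 0" for n
    by (rule integral_continuous_exp_eq_0[OF F])
  ultimately show ?thesis by (simp add: LIMSEQ_const_iff)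
qed

text \<open>The positive and the negative part of H are densities of finite measures that agree on
  all rays, hence everywhere; equal measures have densities that are equal almost
  everywhere.\<close>

lemma AE_eq_0_of_moments: "AE t in lborel. H t = 0"
proof -
  define P where "P t = max 0 (H t)" for t
  define N where "N t = max 0 (- H t)" for t
  have [measurable]: "P \<in> borel_measurable borel" "N \<in> borel_measurable borel"
    unfolding P_def N_def by measurable
  have int: "integrable lborel (\<lambda>t. P t * indicator {c<..} t)" "integrable lborel (\<lambda>t. N t * indicator {c<..} t)" for c
    by (rule Bochner_Integration.integrable_bound[OF integrable_H]; auto simp: P_def N_def indicator_def)+
  have em: "emeasure (density lborel (\<lambda>t. ennreal (P t))) {c<..} = ennreal (\<integral>t. P t * indicator {c<..} t \<partial>lborel)"
    "emeasure (density lborel (\<lambda>t. ennreal (N t))) {c<..} = ennreal (\<integral>t. N t * indicator {c<..} t \<partial>lborel)" for c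
  proof -
    have *: "emeasure (density lborel (\<lambda>t. ennreal (Q t))) {c<..} = ennreal (\<integral>t. Q t * indicator {c<..} t \<partial>lborel)"
      if [measurable]: "Q \<in> borel_measurable borel" and "integrable lborel (\<lambda>t. Q t * indicator {c<..} t)" "\<And>t. Q t \<ge> 0" for Q :: "real \<Rightarrow> real"
    proof -
      have "emeasure (density lborel (\<lambda>t. ennreal (Q t))) {c<..} = (\<integral>\<^sup>+t. ennreal (Q t) * indicator {c<..} t \<partial>lborel)"
        by (subst emeasure_density) auto
      also have "\<dots> = (\<integral>\<^sup>+t. ennreal (Q t * indicator {c<..} t) \<partial>lborel)"
        by (intro nn_integral_cong) (auto simp: indicator_def)
      also have "\<dots> = ennreal (\<integral>t. Q t * indicator {c<..} t \<partial>lborel)"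
        using that by (intro nn_integral_eq_integral) auto
      finally show ?thesis .
    qed
    show "emeasure (density lborel (\<lambda>t. ennreal (P t))) {c<..} = ennreal (\<integral>t. P t * indicator {c<..} t \<partial>lborel)"
      "emeasure (density lborel (\<lambda>t. ennreal (N t))) {c<..} = ennreal (\<integral>t. N t * indicator {c<..} t \<partial>lborel)"
      by (intro * int; simp add: P_def N_def)+
  qed
  have "density lborel (\<lambda>t. ennreal (P t)) = density lborel (\<lambda>t. ennreal (N t))"
  proof (rule measure_eqI_lessThan)
    fix c :: real
    have "(\<integral>t. P t * indicator {c<..} t \<partial>lborel) - (\<integral>t. N t * indicator {c<..} t \<partial>lborel) = (\<integral>t. H t * indicator {c<..} t \<partial>lborel)"
      unfolding Bochner_Integration.integral_diff[OF int, symmetric]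
      by (intro Bochner_Integration.integral_cong) (auto simp: P_def N_def indicator_def)
    then show "emeasure (density lborel (\<lambda>t. ennreal (P t))) {c<..} = emeasure (density lborel (\<lambda>t. ennreal (N t))) {c<..}"
      unfolding em by (simp add: integral_greaterThan_eq_0)
  qed (simp_all add: em)
  from sigma_finite_measure.density_unique[OF lborel.sigma_finite_measure_axioms _ _ this]
  have "AE t in lborel. ennreal (P t) = ennreal (N t)" by measurable
  then show ?thesis by eventually_elim (auto simp: P_def N_def max_def split: if_splits)
qed

end

end

section \<open>Series representation of the derivatives\<close>

lemma higher_deriv_cong_open:
  fixes f g :: "real \<Rightarrow> real"
  assumes "open S" "\<And>t. t \<in> S \<Longrightarrow> f t = g t" "t \<in> S"
  shows "(deriv ^^ j) f t = (deriv ^^ j) g t"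
  using assms(3)
proof (induction j arbitrary: t)
  case (Suc j)
  have "eventually (\<lambda>u. (deriv ^^ j) f u = (deriv ^^ j) g u) (nhds t)"
    using eventually_nhds_in_open[OF assms(1) Suc.prems] by eventually_elim (rule Suc.IH)
  then show ?case by (simp add: deriv_cong_ev)
qed (use assms in auto)

lemma Cr_on_continuous: "Cr_on r S g \<Longrightarrow> continuous_on S g"
proof (cases r)
  case (Suc n)
  assume "Cr_on r S g"
  then have "\<forall>t\<in>S. (deriv ^^ 0) g differentiable (at t)" unfolding Cr_on_def Suc by blast
  then show ?thesis
    by (intro continuous_at_imp_continuous_on ballI differentiable_imp_continuous_within) simp
qed (simp add: Cr_on_def)

lemma AE_eq_continuous_imp_eq:
  fixes f g :: "real \<Rightarrow> real"
  assumes "open S" "continuous_on S f" "continuous_on S g"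
    and "AE t in lborel. t \<in> S \<longrightarrow> f t = g t" and "t \<in> S"
  shows "f t = g t"
proof (rule ccontr)
  assume ne: "f t \<noteq> g t"
  define U where "U = {t \<in> S. f t - g t \<in> - {0}}"
  have "continuous_on S (\<lambda>t. f t - g t)" using assms(2,3) by (intro continuous_intros)
  then have "open U" unfolding U_def
    using continuous_open_preimage[OF _ assms(1), of "\<lambda>t. f t - g t" "- {0}"]
    by (simp add: vimage_def Int_def open_Compl)
  then have "U \<in> sets lborel" by simp
  then have "U \<in> null_sets lborel"
    using assms(4) by (subst AE_iff_null_sets) (auto simp: U_def elim!: eventually_mono)
  then have "negligible U" by (simp add: negligible_iff_null_sets null_sets_completionI)
  moreover have "U \<noteq> {}" using ne assms(5) by (auto simp: U_def)
  ultimately show False using open_not_negligible[OF \<open>open U\<close>] by blast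
qed

text \<open>Removes the choice operator in \<open>Cr_rep\<close>: representatives that are
  continuous and agree almost everywhere agree on all of (0, \<infinity>), and so do their
  derivatives.\<close>

lemma rth_deriv_eq:
  assumes "Cr_on r {0<..} g" "AE t in lborel. t > 0 \<longrightarrow> g t = f t" "t > 0"
  shows "rth_deriv r f t = (deriv ^^ r) g t"
proof -
  have "\<exists>g. Cr_on r {0<..} g \<and> (AE t in lborel. t > 0 \<longrightarrow> g t = f t)" using assms by blast
  from someI_ex[OF this] have h: "Cr_on r {0<..} (Cr_rep r f)" "AE t in lborel. t > 0 \<longrightarrow> Cr_rep r f t = f t"
    unfolding Cr_rep_def by blast+
  have "AE t in lborel. t \<in> {0<..} \<longrightarrow> Cr_rep r f t = g t"
    using h(2) assms(2) by eventually_elim auto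
  then have eq: "Cr_rep r f t = g t" if "t \<in> {0<..}" for t
    using that by (intro AE_eq_continuous_imp_eq[where S = "{0<..}"] Cr_on_continuous[OF h(1)] Cr_on_continuous[OF assms(1)]) auto
  show ?thesis unfolding rth_deriv_def using assms(3)
    by (intro higher_deriv_cong_open[where S = "{0<..}"] eq) auto
qed

lemma Cr_on_poly: "Cr_on r S (poly P)"
  unfolding Cr_on_def higher_deriv_poly
  by (auto intro!: continuous_intros simp: real_differentiable_def intro: poly_DERIV)

lemma rth_deriv_poly: "t > 0 \<Longrightarrow> rth_deriv r (poly P) t = poly ((pderiv ^^ r) P) t"
  using rth_deriv_eq[OF Cr_on_poly[of r "{0<..}" P], of "poly P" t] by (simp add: higher_deriv_poly)

context
  fixes \<alpha> :: real
  assumes \<alpha>: "\<alpha> \<ge> 0"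
begin

text \<open>The substitution t -> c t in the Gamma integral.\<close>

lemma set_integrable_weight_exp:
  assumes "c > 0"
  shows "set_integrable lborel {0<..} (\<lambda>t. t powr \<alpha> * exp (- (c * t)))"
proof -
  have "integrable lborel (\<lambda>t. indicator {0<..} t * weight \<alpha> t)"
    using set_integrable_weight_poly[OF \<alpha>, of 1] by (simp add: set_integrable_def)
  from lborel_integrable_real_affine[OF this, of c 0] assms
  have "integrable lborel (\<lambda>t. (1 / c powr \<alpha>) * (indicator {0<..} (c * t) * weight \<alpha> (c * t)))"
    by (intro integrable_mult_right) simp
  also have "(\<lambda>t. (1 / c powr \<alpha>) * (indicator {0<..} (c * t) * weight \<alpha> (c * t))) = 
      (\<lambda>t. indicator {0<..} t *\<^sub>R (t powr \<alpha> * exp (- (c * t))))"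
    using assms by (auto simp: fun_eq_iff indicator_def weight_def powr_mult zero_less_mult_iff)
  finally show ?thesis by (simp add: set_integrable_def)
qed

end

text \<open>The series differentiated j times term by term. For j = 0 it is the candidate for the
  C^r representative; that the cases j > 0 are its derivatives is
  \<open>higher_deriv_lagser\<close>.\<close>

definition lagser :: "real \<Rightarrow> (nat \<Rightarrow> real) \<Rightarrow> nat \<Rightarrow> real \<Rightarrow> real" where
  "lagser \<alpha> a j t = (\<Sum>k. a k * poly ((pderiv ^^ j) (lonp \<alpha> k)) t)"

section \<open>Convergence, smoothness and coefficients of the Laguerre series\<close>

context
  fixes \<alpha> :: real and a :: "nat \<Rightarrow> real" and r :: nat
  assumes \<alpha>: "\<alpha> \<ge> 0" and a: "summable (\<lambda>k. \<bar>a k\<bar> * mx k ^ r)"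
begin

lemma lagser_term_bound:
  "\<exists>C>0. \<forall>j\<le>r. \<forall>k. \<forall>t>0. \<bar>a k * poly ((pderiv ^^ j) (lonp \<alpha> k)) t\<bar> * sqrt (weight \<alpha> t) \<le> C * (\<bar>a k\<bar> * mx k ^ r)"
proof -
  obtain C where C: "C > 0" "\<And>j k t. t > 0 \<Longrightarrow> \<bar>poly ((pderiv ^^ j) (lonp \<alpha> k)) t\<bar> * sqrt (weight \<alpha> t) \<le> C * mx k ^ j"
    using lonp_deriv_weighted_bound[OF \<alpha>] by blast
  have "\<bar>a k * poly ((pderiv ^^ j) (lonp \<alpha> k)) t\<bar> * sqrt (weight \<alpha> t) \<le> C * (\<bar>a k\<bar> * mx k ^ r)" 
    if "t > 0" "j \<le> r" for j k t
  proof -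
    have "\<bar>poly ((pderiv ^^ j) (lonp \<alpha> k)) t\<bar> * sqrt (weight \<alpha> t) \<le> C * mx k ^ r"
      by (rule order.trans[OF C(2)[OF that(1)]]) (use C(1) that in \<open>auto intro!: mult_left_mono power_increasing\<close>)
    from mult_left_mono[OF this, of "\<bar>a k\<bar>"] show ?thesis by (simp add: abs_mult mult_ac)
  qed
  then show ?thesis using C(1) by blast
qed

lemma lagser_local_bound:
  assumes "0 < x" "x < y"
  shows "\<exists>C. \<forall>j\<le>r. \<forall>k. \<forall>t\<in>{x..y}. norm (a k * poly ((pderiv ^^ j) (lonp \<alpha> k)) t) \<le> C * (\<bar>a k\<bar> * mx k ^ r)"
proof -
  obtain C where C: "C > 0" "\<And>j k t. j \<le> r \<Longrightarrow> t > 0 \<Longrightarrow>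
     \<bar>a k * poly ((pderiv ^^ j) (lonp \<alpha> k)) t\<bar> * sqrt (weight \<alpha> t) \<le> C * (\<bar>a k\<bar> * mx k ^ r)"
    using lagser_term_bound by blast
  \<comment> \<open>A lower bound for sqrt w on [x, y]; dividing by it turns the weighted estimate
    into a plain one on a compact interval, as the M-test needs.\<close>
  define m where "m = sqrt (x powr \<alpha> * exp (- y))"
  have m: "m > 0" using assms by (simp add: m_def)
  have "\<bar>a k * poly ((pderiv ^^ j) (lonp \<alpha> k)) t\<bar> \<le> C / m * (\<bar>a k\<bar> * mx k ^ r)" 
    if "j \<le> r" "t \<in> {x..y}" for j k t
  proof -
    have "m \<le> sqrt (weight \<alpha> t)" unfolding m_def weight_def using that assms \<alpha>
      by (intro real_sqrt_le_mono mult_mono powr_mono2) auto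
    then have "\<bar>a k * poly ((pderiv ^^ j) (lonp \<alpha> k)) t\<bar> * m \<le> \<bar>a k * poly ((pderiv ^^ j) (lonp \<alpha> k)) t\<bar> * sqrt (weight \<alpha> t)"
      by (intro mult_left_mono) auto
    also have "\<dots> \<le> C * (\<bar>a k\<bar> * mx k ^ r)" using C(2)[OF that(1)] that(2) assms(1) by auto
    finally show ?thesis using m by (simp add: pos_le_divide_eq mult_ac)
  qed
  then show ?thesis by (intro exI[of _ "C / m"]) simp
qed

lemma lagser_uniform:
  assumes "0 < x" "x < y" "j \<le> r"
  shows "uniform_limit {x..y} (\<lambda>n t. \<Sum>k<n. a k * poly ((pderiv ^^ j) (lonp \<alpha> k)) t) (lagser \<alpha> a j) sequentially"
proof -
  obtain C where C: "\<And>j k t. j \<le> r \<Longrightarrow> t \<in> {x..y} \<Longrightarrow> norm (a k * poly ((pderiv ^^ j) (lonp \<alpha> k)) t) \<le> C * (\<bar>a k\<bar> * mx k ^ r)"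
    using lagser_local_bound[OF assms(1,2)] by blast
  show ?thesis unfolding lagser_def[abs_def]
    by (rule Weierstrass_m_test[where M = "\<lambda>k. C * (\<bar>a k\<bar> * mx k ^ r)"])
       (use C assms(3) a in \<open>auto intro: summable_mult\<close>)
qed

lemma lagser_summable:
  assumes "t > 0" "j \<le> r"
  shows "summable (\<lambda>k. \<bar>a k * poly ((pderiv ^^ j) (lonp \<alpha> k)) t\<bar>)"
proof -
  have "t < t + 1" by simp
  from lagser_local_bound[OF assms(1) this] obtain C where C: "\<And>j k u. j \<le> r \<Longrightarrow> u \<in> {t..t+1} \<Longrightarrow> norm (a k * poly ((pderiv ^^ j) (lonp \<alpha> k)) u) \<le> C * (\<bar>a k\<bar> * mx k ^ r)"
    by blast
  show ?thesis
    by (rule summable_comparison_test[OF _ summable_mult[OF a, of C]]) (use C[OF assms(2), of t] in auto)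
qed

lemma lagser_has_derivative:
  assumes "t > 0" "j < r"
  shows "(lagser \<alpha> a j has_real_derivative lagser \<alpha> a (Suc j) t) (at t)"
proof -
  define f where "f i k x = a k * poly ((pderiv ^^ i) (lonp \<alpha> k)) x" for i k x
  have "((\<lambda>x. \<Sum>k. f j k x) has_real_derivative (\<Sum>k. f (Suc j) k t)) (at t)"
  proof (rule has_field_derivative_series'(2)[where S = "{t / 2..2 * t}" and f = "f j" and f' = "f (Suc j)" and x0 = t])
    show "(f j k has_real_derivative f (Suc j) k x) (at x within {t / 2..2 * t})" for k x
      unfolding f_def funpow.simps comp_def by (rule has_field_derivative_at_within, rule DERIV_cmult, rule poly_DERIV)
    have "uniform_limit {t / 2..2 * t} (\<lambda>n x. \<Sum>i<n. f (Suc j) i x) (lagser \<alpha> a (Suc j)) sequentially"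
      unfolding f_def by (rule lagser_uniform) (use assms in auto)
    then show "uniformly_convergent_on {t / 2..2 * t} (\<lambda>n x. \<Sum>i<n. f (Suc j) i x)"
      unfolding uniformly_convergent_on_def by blast
    show "summable (\<lambda>n. f j n t)"
      unfolding f_def by (rule summable_rabs_cancel[OF lagser_summable]) (use assms in auto)
  qed (use assms in auto)
  then show ?thesis unfolding f_def lagser_def[abs_def] .
qed

lemma lagser_continuous: "continuous_on {0<..} (lagser \<alpha> a r)"
proof (rule continuous_at_imp_continuous_on, rule ballI)
  fix t :: real assume t: "t \<in> {0<..}"
  have "continuous_on {t / 2..2 * t} (lagser \<alpha> a r)"
    by (rule uniform_limit_theorem[OF _ lagser_uniform]) (use t in \<open>auto intro!: always_eventually continuous_intros\<close>)
  then show "isCont (lagser \<alpha> a r) t"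
    by (rule continuous_on_interior) (use t in auto)
qed

lemma higher_deriv_lagser:
  "j \<le> r \<Longrightarrow> t > 0 \<Longrightarrow> (deriv ^^ j) (lagser \<alpha> a 0) t = lagser \<alpha> a j t"
proof (induction j arbitrary: t)
  case (Suc j)
  have "(deriv ^^ Suc j) (lagser \<alpha> a 0) t = deriv ((deriv ^^ j) (lagser \<alpha> a 0)) t" by simp
  also have "\<dots> = (deriv ^^ 1) (lagser \<alpha> a j) t"
    using higher_deriv_cong_open[of "{0<..}" "(deriv ^^ j) (lagser \<alpha> a 0)" "lagser \<alpha> a j" t 1] Suc by simp
  also have "\<dots> = lagser \<alpha> a (Suc j) t"
    using lagser_has_derivative[of t j] Suc.prems by (simp add: DERIV_imp_deriv)
  finally show ?case .
qed simp

lemma Cr_on_lagser: "Cr_on r {0<..} (lagser \<alpha> a 0)"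
  unfolding Cr_on_def
proof (intro conjI allI impI ballI)
  fix j t assume j: "j < r" and t: "t \<in> {0 :: real<..}"
  have "(lagser \<alpha> a j) differentiable (at t)"
    using lagser_has_derivative[of t j] j t by (auto simp: real_differentiable_def)
  moreover have "eventually (\<lambda>u. (deriv ^^ j) (lagser \<alpha> a 0) u = lagser \<alpha> a j u) (nhds t)"
    using eventually_nhds_in_open[of "{0<..}" t] t j by (auto elim!: eventually_mono intro: higher_deriv_lagser)
  ultimately show "(deriv ^^ j) (lagser \<alpha> a 0) differentiable (at t)"
    unfolding real_differentiable_def by (metis DERIV_cong_ev)
next
  show "continuous_on {0<..} ((deriv ^^ r) (lagser \<alpha> a 0))"
    using lagser_continuous by (subst continuous_on_cong[OF refl, of _ _ "lagser \<alpha> a r"]) (auto simp: higher_deriv_lagser)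
qed

lemma lagser_bounded:
  "\<exists>D. \<forall>t>0. \<bar>lagser \<alpha> a 0 t\<bar> * sqrt (weight \<alpha> t) \<le> D"
proof -
  obtain C where C: "C > 0" "\<And>j k t. j \<le> r \<Longrightarrow> t > 0 \<Longrightarrow>
     \<bar>a k * poly ((pderiv ^^ j) (lonp \<alpha> k)) t\<bar> * sqrt (weight \<alpha> t) \<le> C * (\<bar>a k\<bar> * mx k ^ r)"
    using lagser_term_bound by blast
  have "\<bar>lagser \<alpha> a 0 t\<bar> * sqrt (weight \<alpha> t) \<le> (\<Sum>k. C * (\<bar>a k\<bar> * mx k ^ r))" if t: "t > 0" for t
  proof -
    have s: "summable (\<lambda>k. \<bar>a k * poly ((pderiv ^^ 0) (lonp \<alpha> k)) t\<bar>)" by (rule lagser_summable[OF t]) simp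
    have "\<bar>lagser \<alpha> a 0 t\<bar> * sqrt (weight \<alpha> t) \<le> (\<Sum>k. \<bar>a k * poly ((pderiv ^^ 0) (lonp \<alpha> k)) t\<bar>) * sqrt (weight \<alpha> t)"
      unfolding lagser_def by (intro mult_right_mono summable_rabs s) (simp add: weight_nonneg)
    also have "\<dots> = (\<Sum>k. \<bar>a k * poly ((pderiv ^^ 0) (lonp \<alpha> k)) t\<bar> * sqrt (weight \<alpha> t))"
      by (rule suminf_mult2[OF s])
    also have "\<dots> \<le> (\<Sum>k. C * (\<bar>a k\<bar> * mx k ^ r))"
      using C(2)[of 0 t] t by (intro suminf_le summable_mult2[OF s] summable_mult[OF a]) auto
    finally show ?thesis .
  qed
  then show ?thesis by blast
qed

text \<open>By \<open>lagser_bounded\<close> one factor sqrt w is used to bound the series; the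
  other still decays like exp(-t / 2), which leaves exp(-t / 4) after multiplication by exp(t /
  4).\<close>

lemma lagser_integrable_exp:
  "(\<lambda>t. indicator {0<..} t * lagser \<alpha> a 0 t) \<in> borel_measurable borel"
  "integrable lborel (\<lambda>t. indicator {0<..} t * (weight \<alpha> t * lagser \<alpha> a 0 t) * exp (t / 4))"
proof -
  show [measurable]: "(\<lambda>t. indicator {0<..} t * lagser \<alpha> a 0 t) \<in> borel_measurable borel"
    using borel_measurable_continuous_on_indicator[of "{0<..}" "lagser \<alpha> a 0"] Cr_on_continuous[OF Cr_on_lagser] by simp
  obtain D where D: "\<And>t. t > 0 \<Longrightarrow> \<bar>lagser \<alpha> a 0 t\<bar> * sqrt (weight \<alpha> t) \<le> D" using lagser_bounded by blast
  show "integrable lborel (\<lambda>t. indicator {0<..} t * (weight \<alpha> t * lagser \<alpha> a 0 t) * exp (t / 4))"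
  proof (rule Bochner_Integration.integrable_bound)
    show "integrable lborel (\<lambda>t. D * (indicator {0<..} t *\<^sub>R (t powr (\<alpha> / 2) * exp (- (1 / 4 * t)))))"
      using set_integrable_weight_exp[of "\<alpha> / 2" "1 / 4"] \<alpha> unfolding set_integrable_def by (intro integrable_mult_right) auto
    have "(\<lambda>t. weight \<alpha> t * (indicator {0<..} t * lagser \<alpha> a 0 t) * exp (t / 4)) \<in> borel_measurable borel" by measurable
    then show "(\<lambda>t. indicator {0<..} t * (weight \<alpha> t * lagser \<alpha> a 0 t) * exp (t / 4)) \<in> borel_measurable lborel"
      by (simp add: mult_ac)
    show "AE t in lborel. norm (indicator {0<..} t * (weight \<alpha> t * lagser \<alpha> a 0 t) * exp (t / 4))
        \<le> norm (D * (indicator {0<..} t *\<^sub>R (t powr (\<alpha> / 2) * exp (- (1 / 4 * t)))))"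
    proof (rule AE_I2)
      fix t :: real
      show "norm (indicator {0<..} t * (weight \<alpha> t * lagser \<alpha> a 0 t) * exp (t / 4))
        \<le> norm (D * (indicator {0<..} t *\<^sub>R (t powr (\<alpha> / 2) * exp (- (1 / 4 * t)))))"
      proof (cases "t > 0")
        case True
        have sw: "sqrt (weight \<alpha> t) * exp (t / 4) = t powr (\<alpha> / 2) * exp (- (1 / 4 * t))"
        proof -
          have "sqrt (exp (- t)) = exp (- t / 2)" by (rule real_sqrt_unique) (simp_all add: power2_eq_square flip: exp_add)
          then have "sqrt (weight \<alpha> t) = t powr (\<alpha> / 2) * exp (- t / 2)"
            by (simp add: weight_def real_sqrt_mult powr_half_sqrt[symmetric] powr_powr)
          then show ?thesis by (simp add: mult.assoc flip: exp_add)
        qed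
        have "weight \<alpha> t * \<bar>lagser \<alpha> a 0 t\<bar> * exp (t / 4)
            = (\<bar>lagser \<alpha> a 0 t\<bar> * sqrt (weight \<alpha> t)) * (sqrt (weight \<alpha> t) * exp (t / 4))"
        proof -
          have "sqrt (weight \<alpha> t) * sqrt (weight \<alpha> t) = weight \<alpha> t" by (simp add: weight_nonneg)
          then show ?thesis by (metis mult.assoc mult.commute)
        qed
        also have "\<dots> \<le> D * (t powr (\<alpha> / 2) * exp (- (1 / 4 * t)))"
          unfolding sw by (intro mult_right_mono D True) auto
        also have "\<dots> \<le> \<bar>D\<bar> * (t powr (\<alpha> / 2) * exp (- (1 / 4 * t)))" by (intro mult_right_mono) auto
        finally show ?thesis using True by (simp add: abs_mult weight_nonneg)
      qed simp
    qed
  qed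
qed

text \<open>From |f| exp(t / 4) \<le> f^2 + exp(t / 2): times w, the first term is integrable as f
  lies in L_{2,w}, and the second decays like exp(-t / 2).\<close>

lemma L2w_integrable_exp:
  assumes f: "f \<in> L2w \<alpha>"
  shows "(\<lambda>t. indicator {0<..} t * f t) \<in> borel_measurable borel"
    and "integrable lborel (\<lambda>t. indicator {0<..} t * (weight \<alpha> t * f t) * exp (t / 4))"
proof -
  show [measurable]: "(\<lambda>t. indicator {0<..} t * f t) \<in> borel_measurable borel"
    using f by (simp add: L2w_def set_borel_measurable_def)
  show "integrable lborel (\<lambda>t. indicator {0<..} t * (weight \<alpha> t * f t) * exp (t / 4))"
  proof (rule Bochner_Integration.integrable_bound)
    have "set_integrable lborel {0<..} (\<lambda>t. t powr \<alpha> * exp (- (1 / 2 * t)))"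
      using set_integrable_weight_exp[OF \<alpha>, of "1 / 2"] by simp
    moreover have "set_integrable lborel {0<..} (\<lambda>t. weight \<alpha> t * (f t)\<^sup>2)" using f by (simp add: L2w_def)
    ultimately show "integrable lborel (\<lambda>t. indicator {0<..} t *\<^sub>R (weight \<alpha> t * (f t)\<^sup>2) + indicator {0<..} t *\<^sub>R (t powr \<alpha> * exp (- (1 / 2 * t))))"
      unfolding set_integrable_def by (rule Bochner_Integration.integrable_add[rotated])
    have "(\<lambda>t. weight \<alpha> t * (indicator {0<..} t * f t) * exp (t / 4)) \<in> borel_measurable borel" by measurable
    then show "(\<lambda>t. indicator {0<..} t * (weight \<alpha> t * f t) * exp (t / 4)) \<in> borel_measurable lborel"
      by (simp add: mult_ac)
    show "AE t in lborel. norm (indicator {0<..} t * (weight \<alpha> t * f t) * exp (t / 4))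
        \<le> norm (indicator {0<..} t *\<^sub>R (weight \<alpha> t * (f t)\<^sup>2) + indicator {0<..} t *\<^sub>R (t powr \<alpha> * exp (- (1 / 2 * t))))"
    proof (rule AE_I2)
      fix t :: real
      have w: "weight \<alpha> t * (exp (t / 4))\<^sup>2 = t powr \<alpha> * exp (- (1 / 2 * t))"
        by (simp add: weight_def power2_eq_square mult.assoc flip: exp_add)
      have "2 * (\<bar>f t\<bar> * exp (t / 4)) \<le> (f t)\<^sup>2 + (exp (t / 4))\<^sup>2"
        using sum_squares_bound[of "\<bar>f t\<bar>" "exp (t / 4)"] by simp
      then have "\<bar>f t\<bar> * exp (t / 4) \<le> (f t)\<^sup>2 + (exp (t / 4))\<^sup>2"
        using mult_nonneg_nonneg[OF abs_ge_zero[of "f t"] exp_ge_zero[of "t / 4"]] by linarith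
      from mult_left_mono[OF this weight_nonneg[of \<alpha> t]]
      have "weight \<alpha> t * (\<bar>f t\<bar> * exp (t / 4)) \<le> weight \<alpha> t * (f t)\<^sup>2 + t powr \<alpha> * exp (- (1 / 2 * t))"
        unfolding distrib_left w .
      then show "norm (indicator {0<..} t * (weight \<alpha> t * f t) * exp (t / 4))
        \<le> norm (indicator {0<..} t *\<^sub>R (weight \<alpha> t * (f t)\<^sup>2) + indicator {0<..} t *\<^sub>R (t powr \<alpha> * exp (- (1 / 2 * t))))"
        by (simp add: abs_mult weight_nonneg mult.assoc indicator_def)
    qed
  qed
qed

text \<open>Sum and integral may be exchanged because the i-th term has L_1 norm at most |a_i|: the
  product of two normalized polynomials is bounded by half the sum of their squares.\<close>

lemma lagser_coeff:
  "(\<integral>t. indicator {0<..} t * (weight \<alpha> t * lagser \<alpha> a 0 t) * poly (lonp \<alpha> k) t \<partial>lborel) = a k"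
proof -
  define F where "F i t = a i * (indicator {0<..} t * (weight \<alpha> t * poly (lonp \<alpha> i * lonp \<alpha> k) t))" for i t
  have intF: "integrable lborel (F i)" for i
    using set_integrable_weight_poly[OF \<alpha>, of "lonp \<alpha> i * lonp \<alpha> k"] unfolding F_def set_integrable_def
    by (intro integrable_mult_right) simp
  have sum0: "summable (\<lambda>i. a i * poly (lonp \<alpha> i) t)" if "t > 0" for t
    using summable_rabs_cancel[OF lagser_summable[OF that, of 0]] by simp
  have "(\<integral>t. (\<Sum>i. F i t) \<partial>lborel) = (\<Sum>i. \<integral>t. F i t \<partial>lborel)"
  proof (rule integral_suminf[OF intF])
    show "AE t in lborel. summable (\<lambda>i. norm (F i t))"
    proof (rule AE_I2)
      fix t :: real
      show "summable (\<lambda>i. norm (F i t))"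
      proof (cases "t > 0")
        case True
        from summable_mult2[OF lagser_summable[OF True, of 0], of "weight \<alpha> t * \<bar>poly (lonp \<alpha> k) t\<bar>"]
        show ?thesis using True by (simp add: F_def abs_mult weight_nonneg mult_ac)
      qed (simp add: F_def)
    qed
    show "summable (\<lambda>i. \<integral>t. norm (F i t) \<partial>lborel)"
    proof (rule summable_comparison_test)
      show "\<exists>N. \<forall>i\<ge>N. norm (\<integral>t. norm (F i t) \<partial>lborel) \<le> \<bar>a i\<bar> * mx i ^ r"
      proof (intro exI allI impI)
        fix i :: nat
        have "(\<integral>t. norm (F i t) \<partial>lborel) = \<bar>a i\<bar> * (LINT t:{0<..}|lborel. weight \<alpha> t * \<bar>poly (lonp \<alpha> i * lonp \<alpha> k) t\<bar>)"
          by (simp add: F_def set_lebesgue_integral_def abs_mult weight_nonneg)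
        also have "\<dots> \<le> \<bar>a i\<bar> * wint \<alpha> (smult (1/2) (lonp \<alpha> i * lonp \<alpha> i + lonp \<alpha> k * lonp \<alpha> k))"
        proof (intro mult_left_mono integral_weight_abs_poly_le[OF \<alpha>])
          fix t :: real
          show "\<bar>poly (lonp \<alpha> i * lonp \<alpha> k) t\<bar> \<le> poly (smult (1/2) (lonp \<alpha> i * lonp \<alpha> i + lonp \<alpha> k * lonp \<alpha> k)) t"
            using sum_squares_bound[of "\<bar>poly (lonp \<alpha> i) t\<bar>" "\<bar>poly (lonp \<alpha> k) t\<bar>"]
            by (simp add: abs_mult power2_eq_square)
        qed simp
        also have "\<dots> = \<bar>a i\<bar>" by (simp add: wint_smult[OF \<alpha>] wint_add[OF \<alpha>] wint_lonp[OF \<alpha>])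
        also have "\<dots> \<le> \<bar>a i\<bar> * mx i ^ r" using mult_left_mono[OF one_le_power[of "mx i" r], of "\<bar>a i\<bar>"] by simp
        finally show "norm (\<integral>t. norm (F i t) \<partial>lborel) \<le> \<bar>a i\<bar> * mx i ^ r" by simp
      qed
    qed (rule a)
  qed
  also have "(\<lambda>i. \<integral>t. F i t \<partial>lborel) = (\<lambda>i. if i = k then a i else 0)"
  proof
    fix i
    have "(\<integral>t. F i t \<partial>lborel) = a i * wint \<alpha> (lonp \<alpha> i * lonp \<alpha> k)"
      by (simp add: F_def wint_def set_lebesgue_integral_def)
    then show "(\<integral>t. F i t \<partial>lborel) = (if i = k then a i else 0)" by (simp add: wint_lonp[OF \<alpha>])
  qed
  also have "(\<Sum>i. if i = k then a i else 0) = a k" using sums_single[of k a] by (simp add: sums_iff)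
  also have "(\<lambda>t. \<Sum>i. F i t) = (\<lambda>t. indicator {0<..} t * (weight \<alpha> t * lagser \<alpha> a 0 t) * poly (lonp \<alpha> k) t)"
  proof
    fix t :: real
    show "(\<Sum>i. F i t) = indicator {0<..} t * (weight \<alpha> t * lagser \<alpha> a 0 t) * poly (lonp \<alpha> k) t"
    proof (cases "t > 0")
      case True
      show ?thesis
        using suminf_mult[OF sum0[OF True], of "weight \<alpha> t * poly (lonp \<alpha> k) t"] True
        by (simp add: F_def lagser_def mult_ac)
    qed (simp add: F_def)
  qed
  finally show ?thesis .
qed

text \<open>The function H = w (f - series) is orthogonal to every L_k, since f and the series have
  the same coefficients. So all moments of H vanish, and determinacy gives H = 0.\<close>

lemma L2w_eq_lagser:
  assumes f: "f \<in> L2w \<alpha>" and fa: "Gcoeff \<alpha> f = a"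
  shows "AE t in lborel. t > 0 \<longrightarrow> lagser \<alpha> a 0 t = f t"
proof -
  define H1 where "H1 t = indicator {0<..} t * (weight \<alpha> t * f t)" for t
  define H2 where "H2 t = indicator {0<..} t * (weight \<alpha> t * lagser \<alpha> a 0 t)" for t
  define H where "H t = H1 t - H2 t" for t
  note [measurable] = L2w_integrable_exp(1)[OF f] lagser_integrable_exp(1)
  have "(\<lambda>t. weight \<alpha> t * (indicator {0<..} t * f t)) \<in> borel_measurable borel"
    "(\<lambda>t. weight \<alpha> t * (indicator {0<..} t * lagser \<alpha> a 0 t)) \<in> borel_measurable borel" by measurable
  then have m12 [measurable]: "H1 \<in> borel_measurable borel" "H2 \<in> borel_measurable borel"
    unfolding H1_def H2_def by (simp_all add: mult_ac)
  have mH: "H \<in> borel_measurable borel" unfolding H_def by measurable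
  have s12: "H1 t = 0" "H2 t = 0" if "t \<le> 0" for t using that by (auto simp: H1_def H2_def)
  then have sH: "H t = 0" if "t \<le> 0" for t using that by (simp add: H_def)
  have i12: "integrable lborel (\<lambda>t. H1 t * exp (t / 4))" "integrable lborel (\<lambda>t. H2 t * exp (t / 4))"
    unfolding H1_def H2_def using L2w_integrable_exp(2)[OF f] lagser_integrable_exp(2) by auto
  have iH: "integrable lborel (\<lambda>t. H t * exp (t / 4))"
    using Bochner_Integration.integrable_diff[OF i12] by (simp add: H_def left_diff_distrib)
  note int1 = integrable_poly[OF m12(1) s12(1) i12(1)] and int2 = integrable_poly[OF m12(2) s12(2) i12(2)]
    and intH = integrable_poly[OF mH sH iH]
  define J where "J P = (\<integral>t. H t * poly P t \<partial>lborel)" for P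
  have J_lin: "J (smult c P + Q) = c * J P + J Q" for c P Q
  proof -
    have "J (smult c P + Q) = (\<integral>t. c * (H t * poly P t) + H t * poly Q t \<partial>lborel)"
      by (simp add: J_def algebra_simps)
    also have "\<dots> = c * J P + J Q"
      unfolding J_def by (subst Bochner_Integration.integral_add) (auto intro!: integrable_mult_right intH)
    finally show ?thesis .
  qed
  have J_0: "J 0 = 0" by (simp add: J_def)
  have J_smult: "J (smult c P) = c * J P" for c P using J_lin[of c P 0] J_0 by simp
  have J_diff: "J (P - Q) = J P - J Q" for P Q using J_lin[of "-1" Q P] by simp
  have J_lonp: "J (lonp \<alpha> k) = 0" for k
  proof -
    have "J (lonp \<alpha> k) = (\<integral>t. H1 t * poly (lonp \<alpha> k) t - H2 t * poly (lonp \<alpha> k) t \<partial>lborel)"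
      by (simp add: J_def H_def left_diff_distrib)
    also have "\<dots> = (\<integral>t. H1 t * poly (lonp \<alpha> k) t \<partial>lborel) - (\<integral>t. H2 t * poly (lonp \<alpha> k) t \<partial>lborel)"
      by (rule Bochner_Integration.integral_diff[OF int1 int2])
    also have "(\<integral>t. H2 t * poly (lonp \<alpha> k) t \<partial>lborel) = a k"
      unfolding H2_def by (rule lagser_coeff)
    also have "(\<integral>t. H1 t * poly (lonp \<alpha> k) t \<partial>lborel) = Gcoeff \<alpha> f k"
      by (simp add: H1_def Gcoeff_def inner_w_def laguerre_on_eq_poly set_lebesgue_integral_def mult_ac)
    finally show ?thesis by (simp add: fa)
  qed
  have J_lagp: "J (lagp \<alpha> k) = 0" for k
    using J_lonp[of k] lagnorm2_pos[OF \<alpha>, of k] by (auto simp: lonp_def J_smult)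
  \<comment> \<open>Orthogonality to t^j L_k for all k passes from j to j + 1 by the three-term
    recurrence; k = 0 is then the j-th moment, and no expansion of t^j in Laguerre polynomials is
    required.\<close>
  have "J (monom 1 j * lagp \<alpha> k) = 0" for j k
  proof (induction j arbitrary: k)
    case 0
    then show ?case by (simp add: monom_0 J_lagp flip: one_pCons)
  next
    case (Suc j)
    have "monom 1 (Suc j) * lagp \<alpha> k = monom 1 j * ([:0, 1:] * lagp \<alpha> k)"
      by (simp add: monom_Suc)
    moreover have "J (monom 1 j * ([:0, 1:] * lagp \<alpha> k)) = 0"
    proof (cases k)
      case 0
      then show ?thesis unfolding 0 X_lagp_0 by (simp add: right_diff_distrib J_diff J_smult Suc.IH del: lagp_0)
    next
      case (Suc m)
      then show ?thesis unfolding Suc X_lagp by (simp only: right_diff_distrib mult_smult_right J_diff J_smult Suc.IH)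
    qed
    ultimately show ?case by simp
  qed
  from this[of _ 0] have moments: "(\<integral>t. H t * t ^ j \<partial>lborel) = 0" for j by (simp add: J_def poly_monom)
  have "AE t in lborel. H t = 0" by (rule AE_eq_0_of_moments[OF mH _ iH moments]) (rule sH)
  then show ?thesis
  proof eventually_elim
    case (elim t)
    then show ?case using weight_pos[of t \<alpha>] by (auto simp: H_def H1_def H2_def simp flip: right_diff_distrib)
  qed
qed

lemma rth_deriv_eq_lagser:
  assumes "f \<in> L2w \<alpha>" "Gcoeff \<alpha> f = a" "t > 0"
  shows "rth_deriv r f t = (\<Sum>k. a k * poly ((pderiv ^^ r) (lonp \<alpha> k)) t)"
proof -
  have "rth_deriv r f t = lagser \<alpha> a r t"
    using rth_deriv_eq[OF Cr_on_lagser L2w_eq_lagser[OF assms(1,2)] assms(3)] higher_deriv_lagser[OF order_refl assms(3)]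
    by (rule trans)
  then show ?thesis by (simp only: lagser_def)
qed

end

section \<open>Weighted sequence norms\<close>

lemma recip_top [simp]: "recip top = 0"
  by (simp add: recip_def)

lemma recip_finite:
  assumes "1 \<le> s" "s \<noteq> \<infinity>"
  shows "enn2real s \<ge> 1" "recip s = 1 / enn2real s"
proof -
  obtain S where S: "S \<ge> 0" "s = ennreal S" using assms(2) by (cases s) auto
  with assms(1) have "S \<ge> 1" by (metis ennreal_1 ennreal_le_iff2 not_one_le_zero)
  with S show "enn2real s \<ge> 1" by simp
  have "1 / ennreal S = ennreal (1 / S)" using divide_ennreal[of 1 S] \<open>S \<ge> 1\<close> by simp
  then show "recip s = 1 / enn2real s" using S by (simp add: recip_def)
qed

lemma recip_bounds:
  assumes "1 \<le> s"
  shows "0 \<le> recip s" "recip s \<le> 1"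
  using recip_finite[OF assms] by (cases "s = \<infinity>"; simp add: recip_def)+

text \<open>Hoelder's inequality against the constant 1 on A; with \<open>recip\<close> it reads the
  same for all s, including 1 and \<infinity>.\<close>

lemma sum_le_of_seq_norm:
  assumes s: "1 \<le> s" and norm: "seq_norm s \<mu> a \<le> ennreal D" and D: "D > 0"
    and A: "finite A" "real (card A) \<le> M"
  shows "(\<Sum>k\<in>A. mx k powr \<mu> * \<bar>a k\<bar>) \<le> D * M powr (1 - recip s)"
proof (cases "A = {}")
  case True
  then show ?thesis using D by simp
next
  case False
  define c where "c = real (card A)"
  have c: "c \<ge> 1" using False A(1) by (simp add: c_def Suc_le_eq card_gt_0_iff)
  have "(\<Sum>k\<in>A. mx k powr \<mu> * \<bar>a k\<bar>) \<le> D * c powr (1 - recip s)"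
  proof (cases "s = \<infinity>")
    case True
    have "mx k powr \<mu> * \<bar>a k\<bar> \<le> D" for k
    proof -
      have "ennreal (mx k powr \<mu> * \<bar>a k\<bar>) \<le> seq_norm s \<mu> a"
        unfolding seq_norm_def using True by (auto intro!: SUP_upper2[of k])
      from this norm have "ennreal (mx k powr \<mu> * \<bar>a k\<bar>) \<le> ennreal D" by (rule order.trans)
      then show ?thesis using D by (simp add: ennreal_le_iff)
    qed
    then have "(\<Sum>k\<in>A. mx k powr \<mu> * \<bar>a k\<bar>) \<le> (\<Sum>k\<in>A. D)" by (intro sum_mono)
    then show ?thesis using c True by (simp add: c_def mult_ac)
  next
    case False
    define S where "S = enn2real s"
    have S: "S \<ge> 1" "recip s = 1 / S" using recip_finite[OF s False] by (auto simp: S_def)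
    define b where "b k = mx k powr \<mu> * \<bar>a k\<bar>" for k
    have b0: "b k \<ge> 0" for k by (simp add: b_def)
    have x: "mx k powr (S * \<mu>) * \<bar>a k\<bar> powr S = b k powr S" for k
      by (simp add: b_def powr_mult powr_powr mult_ac)
    \<comment> \<open>A divergent series has norm \<infinity>, so the finite bound D yields
      summability.\<close>
    have sm: "summable (\<lambda>k. b k powr S)" and le: "(\<Sum>k. b k powr S) powr (1 / S) \<le> D"
    proof -
      have *: "(if summable (\<lambda>k. b k powr S) then ennreal ((\<Sum>k. b k powr S) powr (1 / S)) else \<infinity>) \<le> ennreal D"
        using norm False unfolding seq_norm_def S_def[symmetric] Let_def x by simp
      then show "summable (\<lambda>k. b k powr S)" by (auto split: if_splits simp: top_unique)
      with * D show "(\<Sum>k. b k powr S) powr (1 / S) \<le> D" by (simp add: ennreal_le_iff)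
    qed
    have "(\<Sum>k\<in>A. b k powr S) \<le> (\<Sum>k. b k powr S)"
      using A(1) sm by (intro sum_le_suminf) auto
    also have "\<dots> = ((\<Sum>k. b k powr S) powr (1 / S)) powr S"
      using S suminf_nonneg[OF sm] by (simp add: powr_powr)
    also have "\<dots> \<le> D powr S" using le S by (intro powr_mono2) auto
    finally have sum_le: "(\<Sum>k\<in>A. b k powr S) \<le> D powr S" .
    \<comment> \<open>Young's inequality for b_k^S / D^S and 1 / c. Over A the first quantities sum
      to at most 1 and the second to exactly 1, so the convex combination sums to at most 1.\<close>
    have Y: "b k * (1 / c) powr (1 - 1 / S) \<le> D * (b k powr S / D powr S * (1 / S) + (1 - 1 / S) / c)" for k
    proof (cases "b k = 0")
      case True
      then show ?thesis using D S c by simp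
    next
      case False
      then have "b k powr S / D powr S > 0" using D by simp
      then
      have "(b k powr S / D powr S) powr (1 / S) * (1 / c) powr (1 - 1 / S) \<le> 1 / S * (b k powr S / D powr S) + (1 - 1 / S) * (1 / c)"
        using S c D by (intro Youngs_inequality_0) auto
      moreover have "(b k powr S / D powr S) powr (1 / S) = b k / D"
        using b0[of k] D S by (simp add: powr_divide powr_powr)
      ultimately have "b k / D * (1 / c) powr (1 - 1 / S) \<le> 1 / S * (b k powr S / D powr S) + (1 - 1 / S) * (1 / c)"
        by simp
      from mult_left_mono[OF this, of D] D show ?thesis by (simp add: mult_ac)
    qed
    have "(\<Sum>k\<in>A. b k) * (1 / c) powr (1 - 1 / S) \<le> (\<Sum>k\<in>A. D * (b k powr S / D powr S * (1 / S) + (1 - 1 / S) / c))"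
      unfolding sum_distrib_right by (intro sum_mono Y)
    also have "\<dots> = D * ((\<Sum>k\<in>A. b k powr S) / D powr S * (1 / S) + (1 - 1 / S))"
      using c by (simp add: sum_distrib_left[symmetric] sum.distrib sum_distrib_right[symmetric] sum_divide_distrib[symmetric] c_def[symmetric])
    also have "\<dots> \<le> D * (1 * (1 / S) + (1 - 1 / S))"
      using sum_le D S by (intro mult_left_mono add_right_mono mult_right_mono) (auto simp: divide_le_eq)
    also have "\<dots> = D" by simp
    finally have *: "(\<Sum>k\<in>A. b k) * (1 / c) powr (1 - 1 / S) \<le> D" .
    have "(1 / c) powr (1 - 1 / S) * c powr (1 - 1 / S) = 1" using c by (simp flip: powr_mult)
    then have "(\<Sum>k\<in>A. b k) = ((\<Sum>k\<in>A. b k) * (1 / c) powr (1 - 1 / S)) * c powr (1 - 1 / S)"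
      by (simp add: mult.assoc)
    also have "\<dots> \<le> D * c powr (1 - 1 / S)" by (intro mult_right_mono *) simp
    finally show ?thesis by (simp add: b_def S)
  qed
  also have "\<dots> \<le> D * M powr (1 - recip s)"
    using D A(2) recip_bounds[OF s] c by (intro mult_left_mono powr_mono2) (auto simp: c_def)
  finally show ?thesis .
qed

lemma seq_norm_le:
  assumes s: "1 \<le> s" and A: "finite A" "real (card A) \<le> M"
    and a0: "\<And>k. k \<notin> A \<Longrightarrow> a k = 0" and aB: "\<And>k. k \<in> A \<Longrightarrow> mx k powr \<mu> * \<bar>a k\<bar> \<le> B" and B: "B \<ge> 0"
  shows "seq_norm s \<mu> a \<le> ennreal (B * M powr recip s)"
proof (cases "s = \<infinity>")
  case True
  have M0: "M \<ge> 0" using A(2) by linarith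
  \<comment> \<open>M may be 0 when A is empty; then \<open>M powr 0\<close> is 0 and not 1, so this
    case is separate.\<close>
  show ?thesis
  proof (cases "A = {}")
    case True
    then have "a k = 0" for k using a0 by auto
    then show ?thesis using \<open>s = \<infinity>\<close> by (simp add: seq_norm_def)
  next
    case False
    then have "card A \<ge> 1" using A(1) by (simp add: Suc_le_eq card_gt_0_iff)
    then have "M > 0" using A(2) by linarith
    moreover have "mx k powr \<mu> * \<bar>a k\<bar> \<le> B" for k using a0[of k] aB[of k] B by (cases "k \<in> A") auto
    ultimately show ?thesis using True by (auto simp: seq_norm_def intro!: SUP_least ennreal_leI)
  qed
next
  case False
  define S where "S = enn2real s"
  have S: "S \<ge> 1" "recip s = 1 / S" using recip_finite[OF s False] by (auto simp: S_def)
  define b where "b k = mx k powr \<mu> * \<bar>a k\<bar>" for k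
  have x: "mx k powr (S * \<mu>) * \<bar>a k\<bar> powr S = b k powr S" for k
    by (simp add: b_def powr_mult powr_powr mult_ac)
  have sums: "(\<lambda>k. b k powr S) sums (\<Sum>k\<in>A. b k powr S)"
    by (rule sums_finite[OF A(1)]) (simp add: b_def a0)
  have "(\<Sum>k\<in>A. b k powr S) \<le> (\<Sum>k\<in>A. B powr S)"
    using aB S by (intro sum_mono powr_mono2) (auto simp: b_def)
  also have "\<dots> \<le> M * B powr S" using A(2) by (simp add: mult_right_mono)
  finally have "(\<Sum>k\<in>A. b k powr S) powr (1 / S) \<le> (M * B powr S) powr (1 / S)"
    using S by (intro powr_mono2 sum_nonneg) auto
  also have "\<dots> = B * M powr (1 / S)" using B S A(2) by (simp add: powr_mult powr_powr)
  finally have "ennreal ((\<Sum>k\<in>A. b k powr S) powr (1 / S)) \<le> ennreal (B * M powr recip s)"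
    unfolding S by (rule ennreal_leI)
  then show ?thesis
    using False sums unfolding seq_norm_def S_def[symmetric] Let_def x by (simp add: sums_iff)
qed

text \<open>A block [m, 2m) with m = 2^l n has m indices; there k^(r - \<mu>) \<le> m^(r - \<mu>),
  and the finite Hoelder inequality contributes m^(1 - 1/s). The product is m^(-\<theta>), geometric
  in l. In this way no infinite conjugate series is needed and all s are treated alike.\<close>

lemma dyadic_sum_bound:
  assumes s: "1 \<le> s" and norm: "seq_norm s \<mu> a \<le> 1" and \<mu>: "\<mu> > real r + 1 - recip s"
    and n: "n \<ge> 1"
  shows "(\<Sum>k\<in>{n..<2 ^ i * n}. \<bar>a k\<bar> * mx k ^ r) \<le>
    (\<Sum>l<i. (2 powr - (\<mu> + recip s - 1 - real r)) ^ l) * real n powr - (\<mu> + recip s - 1 - real r)"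
proof (induction i)
  case (Suc i)
  define \<theta> where "\<theta> = \<mu> + recip s - 1 - real r"
  define A where "A = {2 ^ i * n..<2 ^ Suc i * n}"
  define m where "m = real (2 ^ i * n)"
  have "1 \<le> 2 ^ i * n" using n by simp
  then have "real 1 \<le> m" unfolding m_def by (simp only: of_nat_le_iff)
  then have m: "m \<ge> 1" by simp
  have r\<mu>: "real r - \<mu> \<le> 0" using \<mu> recip_bounds[OF s] by simp
  have "(\<Sum>k\<in>A. \<bar>a k\<bar> * mx k ^ r) \<le> (\<Sum>k\<in>A. m powr (real r - \<mu>) * (mx k powr \<mu> * \<bar>a k\<bar>))"
  proof (rule sum_mono)
    fix k assume k: "k \<in> A"
    then have "2 ^ i * n \<le> k" by (simp add: A_def)
    then have "m \<le> real k" unfolding m_def by (simp only: of_nat_le_iff)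
    then have km: "mx k \<ge> m" by simp
    have "mx k ^ r = mx k powr (real r - \<mu>) * mx k powr \<mu>"
      by (simp add: powr_realpow flip: powr_add)
    also have "\<dots> \<le> m powr (real r - \<mu>) * mx k powr \<mu>"
      using km m r\<mu> by (intro mult_right_mono powr_mono2') auto
    finally have "mx k ^ r \<le> m powr (real r - \<mu>) * mx k powr \<mu>" .
    from mult_left_mono[OF this, of "\<bar>a k\<bar>"]
    show "\<bar>a k\<bar> * mx k ^ r \<le> m powr (real r - \<mu>) * (mx k powr \<mu> * \<bar>a k\<bar>)" by (simp add: mult_ac)
  qed
  also have "\<dots> = m powr (real r - \<mu>) * (\<Sum>k\<in>A. mx k powr \<mu> * \<bar>a k\<bar>)" by (simp add: sum_distrib_left)
  also have "\<dots> \<le> m powr (real r - \<mu>) * (1 * m powr (1 - recip s))"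
    using norm by (intro mult_left_mono sum_le_of_seq_norm[OF s]) (auto simp: A_def m_def)
  also have "\<dots> = m powr - \<theta>" 
    using powr_add[of m "real r - \<mu>" "1 - recip s"] by (simp add: \<theta>_def algebra_simps)
  also have "\<dots> = (2 powr - \<theta>) ^ i * real n powr - \<theta>"
    by (simp add: m_def powr_mult powr_realpow[symmetric] powr_powr mult_ac flip: powr_realpow)
  finally have A: "(\<Sum>k\<in>A. \<bar>a k\<bar> * mx k ^ r) \<le> (2 powr - \<theta>) ^ i * real n powr - \<theta>" .
  have "n \<le> 2 ^ i * n" using mult_le_mono1[of 1 "2 ^ i" n] by simp
  then have "{n..<2 ^ i * n} \<union> {2 ^ i * n..<2 ^ Suc i * n} = {n..<2 ^ Suc i * n}"
    by (rule ivl_disj_un_two(3)) simp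
  then have "{n..<2 ^ Suc i * n} = {n..<2 ^ i * n} \<union> A" "{n..<2 ^ i * n} \<inter> A = {}"
    by (auto simp: A_def)
  then have "(\<Sum>k\<in>{n..<2 ^ Suc i * n}. \<bar>a k\<bar> * mx k ^ r) = (\<Sum>k\<in>{n..<2 ^ i * n}. \<bar>a k\<bar> * mx k ^ r) + (\<Sum>k\<in>A. \<bar>a k\<bar> * mx k ^ r)"
    by (simp only:) (intro sum.union_disjoint, auto simp: A_def)
  with A Suc.IH show ?case unfolding \<theta>_def[symmetric] by (simp only: sum.lessThan_Suc distrib_right)
qed simp

lemma tail_bound:
  assumes s: "1 \<le> s" and norm: "seq_norm s \<mu> a \<le> 1" and \<mu>: "\<mu> > real r + 1 - recip s"
  shows "summable (\<lambda>k. \<bar>a k\<bar> * mx k ^ r)"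
    and "n \<ge> 1 \<Longrightarrow> (\<Sum>k. \<bar>a (k + n)\<bar> * mx (k + n) ^ r) \<le>
      1 / (1 - 2 powr - (\<mu> + recip s - 1 - real r)) * real n powr - (\<mu> + recip s - 1 - real r)"
proof -
  define \<theta> where "\<theta> = \<mu> + recip s - 1 - real r"
  have \<theta>: "\<theta> > 0" using \<mu> by (simp add: \<theta>_def)
  define q where "q = 2 powr - \<theta>"
  have q: "0 < q" "q < 1" using \<theta> powr_less_mono[of "-\<theta>" 0 2] by (auto simp: q_def)
  have part: "(\<Sum>k<m. \<bar>a (k + n)\<bar> * mx (k + n) ^ r) \<le> 1 / (1 - q) * real n powr - \<theta>" if n: "n \<ge> 1" for n m
  proof -
    obtain i where i: "m + n \<le> 2 ^ i" using less_exp[of "m + n"] less_imp_le by blast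
    have "(\<Sum>k<m. \<bar>a (k + n)\<bar> * mx (k + n) ^ r) = (\<Sum>k\<in>{n..<m + n}. \<bar>a k\<bar> * mx k ^ r)"
      using sum.shift_bounds_nat_ivl[of "\<lambda>k. \<bar>a k\<bar> * mx k ^ r" 0 n m] by (simp add: atLeast0LessThan)
    also have "\<dots> \<le> (\<Sum>k\<in>{n..<2 ^ i * n}. \<bar>a k\<bar> * mx k ^ r)"
    proof (rule sum_mono2)
      have "m + n \<le> 2 ^ i * n" using mult_le_mono[OF i n] by simp
      then show "{n..<m + n} \<subseteq> {n..<2 ^ i * n}" by (rule ivl_subset[THEN iffD2, OF disjI2, OF conjI, OF order_refl])
    qed auto
    also have "\<dots> \<le> (\<Sum>l<i. q ^ l) * real n powr - \<theta>"
      using dyadic_sum_bound[OF s norm \<mu> n] by (simp add: q_def \<theta>_def)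
    also have "\<dots> \<le> 1 / (1 - q) * real n powr - \<theta>"
    proof (rule mult_right_mono)
      have "(\<Sum>l<i. q ^ l) \<le> (\<Sum>l. q ^ l)" using q by (intro sum_le_suminf) (auto intro: summable_geometric)
      then show "(\<Sum>l<i. q ^ l) \<le> 1 / (1 - q)" using q by (simp add: suminf_geometric)
    qed simp
    finally show ?thesis .
  qed
  have sm: "summable (\<lambda>k. \<bar>a (k + n)\<bar> * mx (k + n) ^ r)" if "n \<ge> 1" for n
    by (rule summableI_nonneg_bounded[OF _ part[OF that]]) simp
  show "summable (\<lambda>k. \<bar>a k\<bar> * mx k ^ r)"
    using summable_iff_shift[of "\<lambda>k. \<bar>a k\<bar> * mx k ^ r" 1] sm[of 1] by (simp only: le_refl)
  show "(\<Sum>k. \<bar>a (k + n)\<bar> * mx (k + n) ^ r) \<le> 1 / (1 - 2 powr - (\<mu> + recip s - 1 - real r)) * real n powr - (\<mu> + recip s - 1 - real r)"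
    if "n \<ge> 1"
    using suminf_le_const[OF sm[OF that] part[OF that]] unfolding q_def \<theta>_def .
qed

section \<open>Upper and lower bounds for the error\<close>

text \<open>The number n of coefficients in use is kept apart from the budget N: further noisy
  coefficients may enlarge the noise term, so the best n need not be N.\<close>

lemma radius_upper_bound:
  assumes \<alpha>: "\<alpha> \<ge> 0" and s: "1 \<le> s" and p: "1 \<le> p" and \<mu>: "\<mu> > real r + 1 - recip s"
  shows "\<exists>C>0. \<forall>\<delta> n N. 0 < \<delta> \<and> 1 \<le> n \<and> n \<le> N \<longrightarrow> radius \<alpha> r s \<mu> p N \<delta> \<le>
    ennreal (C * (real n powr - (\<mu> + recip s - 1 - real r) + \<delta> * real n powr (real r + 1 - recip p)))"
proof -
  define \<theta> where "\<theta> = \<mu> + recip s - 1 - real r"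
  have \<theta>: "\<theta> > 0" using \<mu> by (simp add: \<theta>_def)
  obtain C where C: "C > 0" "\<And>j k t. t > 0 \<Longrightarrow> \<bar>poly ((pderiv ^^ j) (lonp \<alpha> k)) t\<bar> * sqrt (weight \<alpha> t) \<le> C * mx k ^ j"
    using lonp_deriv_weighted_bound[OF \<alpha>] by blast
  define Ct where "Ct = 1 / (1 - 2 powr - \<theta>)"
  have Ct: "Ct > 0" using \<theta> powr_less_mono[of "-\<theta>" 0 2] by (simp add: Ct_def)
  define e where "e k t = poly ((pderiv ^^ r) (lonp \<alpha> k)) t" for k t
  have main: "radius \<alpha> r s \<mu> p N \<delta> \<le> ennreal (C * (Ct + 1) * (real n powr - \<theta> + \<delta> * real n powr (real r + 1 - recip p)))"
    if \<delta>: "0 < \<delta>" and n: "1 \<le> n" "n \<le> N" for \<delta> n N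
  proof -
    \<comment> \<open>The recovery is linear: the r-th derivative of the partial sum built from the
      noisy data.\<close>
    define \<psi> where "\<psi> y t = (\<Sum>k<n. y k * e k t)" for y t
    have "\<psi> \<in> lp_space (max p 2) \<rightarrow> C_space"
      by (auto simp: C_space_def \<psi>_def e_def intro!: continuous_intros)
    then have "(\<psi>, {..<n}) \<in> Psi p N" using n by (simp add: Psi_def)
    then have "radius \<alpha> r s \<mu> p N \<delta> \<le> err \<alpha> r s \<mu> p \<delta> \<psi> {..<n}"
      unfolding radius_def by (rule INF_lower2) simp
    also have "\<dots> \<le> ennreal (C * (Ct + 1) * (real n powr - \<theta> + \<delta> * real n powr (real r + 1 - recip p)))"
      unfolding err_def C_norm_def
    proof (intro SUP_least ennreal_leI)
      fix f \<xi> t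
      assume f: "f \<in> W_ball \<alpha> s \<mu>" and \<xi>: "\<xi> \<in> {\<xi>. lp_norm p \<xi> \<le> ennreal \<delta>}" and "t \<in> {0 :: real<..}"
      then have t: "t > 0" by simp
      define a where "a = Gcoeff \<alpha> f"
      have a: "seq_norm s \<mu> a \<le> 1" and fL: "f \<in> L2w \<alpha>" using f by (auto simp: W_ball_def a_def)
      let ?w = "sqrt (weight \<alpha> t)"
      have sm: "summable (\<lambda>k. \<bar>a k\<bar> * mx k ^ r)" by (rule tail_bound(1)[OF s a \<mu>])
      have se: "summable (\<lambda>k. \<bar>a k * e k t\<bar>)" unfolding e_def by (rule lagser_summable[OF \<alpha> sm t order_refl])
      have "rth_deriv r f t = (\<Sum>k. a k * e k t)"
        unfolding e_def by (rule rth_deriv_eq_lagser[OF \<alpha> sm fL a_def[symmetric] t])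
      also have "\<dots> = (\<Sum>k. a (k + n) * e (k + n) t) + (\<Sum>k<n. a k * e k t)"
        by (rule suminf_split_initial_segment[OF summable_rabs_cancel[OF se]])
      finally have "rth_deriv r f t - \<psi> (\<lambda>k. Pcoord {..<n} (Gcoeff \<alpha> f) k + \<xi> k) t =
          (\<Sum>k. a (k + n) * e (k + n) t) - (\<Sum>k<n. \<xi> k * e k t)"
        by (simp add: \<psi>_def Pcoord_def a_def[symmetric] distrib_right sum.distrib)
      then have "\<bar>(rth_deriv r f t - \<psi> (\<lambda>k. Pcoord {..<n} (Gcoeff \<alpha> f) k + \<xi> k) t) * ?w\<bar> =
          \<bar>(\<Sum>k. a (k + n) * e (k + n) t) - (\<Sum>k<n. \<xi> k * e k t)\<bar> * ?w"
        by (simp add: abs_mult weight_nonneg)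
      also have "\<dots> \<le> (\<bar>\<Sum>k. a (k + n) * e (k + n) t\<bar> + \<bar>\<Sum>k<n. \<xi> k * e k t\<bar>) * ?w"
        by (intro mult_right_mono abs_triangle_ineq4) (simp add: weight_nonneg)
      also have "\<dots> = \<bar>\<Sum>k. a (k + n) * e (k + n) t\<bar> * ?w + \<bar>\<Sum>k<n. \<xi> k * e k t\<bar> * ?w"
        by (rule distrib_right)
      also have "\<bar>\<Sum>k. a (k + n) * e (k + n) t\<bar> * ?w \<le> C * (Ct * real n powr - \<theta>)"
      proof -
        have se': "summable (\<lambda>k. \<bar>a (k + n) * e (k + n) t\<bar>)"
          using summable_iff_shift[of "\<lambda>k. \<bar>a k * e k t\<bar>" n] se by simp
        have sm': "summable (\<lambda>k. \<bar>a (k + n)\<bar> * mx (k + n) ^ r)"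
          using summable_iff_shift[of "\<lambda>k. \<bar>a k\<bar> * mx k ^ r" n] sm by simp
        have "\<bar>\<Sum>k. a (k + n) * e (k + n) t\<bar> * ?w \<le> (\<Sum>k. \<bar>a (k + n) * e (k + n) t\<bar>) * ?w"
          by (intro mult_right_mono summable_rabs se') (simp add: weight_nonneg)
        also have "\<dots> = (\<Sum>k. \<bar>a (k + n) * e (k + n) t\<bar> * ?w)" by (rule suminf_mult2[OF se'])
        also have "\<dots> \<le> (\<Sum>k. C * (\<bar>a (k + n)\<bar> * mx (k + n) ^ r))"
        proof (rule suminf_le[OF _ summable_mult2[OF se'] summable_mult[OF sm']])
          fix k
          from mult_left_mono[OF C(2)[OF t, where j = r and k = "k + n"], of "\<bar>a (k + n)\<bar>"]
          show "\<bar>a (k + n) * e (k + n) t\<bar> * ?w \<le> C * (\<bar>a (k + n)\<bar> * mx (k + n) ^ r)"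
            unfolding e_def abs_mult by (simp only: mult_ac abs_ge_zero)
        qed
        also have "\<dots> = C * (\<Sum>k. \<bar>a (k + n)\<bar> * mx (k + n) ^ r)" by (rule suminf_mult[OF sm'])
        also have "\<dots> \<le> C * (Ct * real n powr - \<theta>)"
          using tail_bound(2)[OF s a \<mu> n(1)] C(1) unfolding Ct_def \<theta>_def by (intro mult_left_mono) auto
        finally show ?thesis .
      qed
      also have "\<bar>\<Sum>k<n. \<xi> k * e k t\<bar> * ?w \<le> C * (\<delta> * real n powr (real r + 1 - recip p))"
      proof -
        have "\<bar>\<Sum>k<n. \<xi> k * e k t\<bar> * ?w \<le> (\<Sum>k<n. \<bar>\<xi> k * e k t\<bar>) * ?w"
          by (intro mult_right_mono sum_abs) (simp add: weight_nonneg)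
        also have "\<dots> = (\<Sum>k<n. \<bar>\<xi> k * e k t\<bar> * ?w)" by (rule sum_distrib_right)
        also have "\<dots> \<le> (\<Sum>k<n. (C * real n ^ r) * (mx k powr 0 * \<bar>\<xi> k\<bar>))"
        proof (rule sum_mono)
          fix k assume k: "k \<in> {..<n}"
          have "\<bar>e k t\<bar> * ?w \<le> C * mx k ^ r" unfolding e_def by (rule C(2)[OF t])
          also have "\<dots> \<le> C * real n ^ r" using k C(1) by (intro mult_left_mono power_mono) auto
          finally have "\<bar>\<xi> k\<bar> * (\<bar>e k t\<bar> * ?w) \<le> \<bar>\<xi> k\<bar> * (C * real n ^ r)" by (rule mult_left_mono) simp
          then show "\<bar>\<xi> k * e k t\<bar> * ?w \<le> (C * real n ^ r) * (mx k powr 0 * \<bar>\<xi> k\<bar>)"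
            by (simp add: abs_mult mult_ac)
        qed
        also have "\<dots> = (C * real n ^ r) * (\<Sum>k<n. mx k powr 0 * \<bar>\<xi> k\<bar>)" by (simp only: sum_distrib_left)
        also have "\<dots> \<le> (C * real n ^ r) * (\<delta> * real n powr (1 - recip p))"
          using \<xi> C(1) \<delta> by (intro mult_left_mono sum_le_of_seq_norm[OF p]) (auto simp: lp_norm_def)
        also have "\<dots> = C * (\<delta> * (real n powr real r * real n powr (1 - recip p)))"
          using n by (simp add: powr_realpow)
        also have "real n powr real r * real n powr (1 - recip p) = real n powr (real r + 1 - recip p)"
          by (simp flip: powr_add add: add_diff_eq)
        finally show ?thesis .
      qed
      also have "C * (Ct * real n powr - \<theta>) + C * (\<delta> * real n powr (real r + 1 - recip p))
          \<le> C * ((Ct + 1) * real n powr - \<theta>) + C * ((Ct + 1) * (\<delta> * real n powr (real r + 1 - recip p)))"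
      proof (intro add_mono mult_left_mono)
        show "Ct * real n powr - \<theta> \<le> (Ct + 1) * real n powr - \<theta>" by (intro mult_right_mono) auto
        have "1 * (\<delta> * real n powr (real r + 1 - recip p)) \<le> (Ct + 1) * (\<delta> * real n powr (real r + 1 - recip p))"
          using Ct \<delta> by (intro mult_right_mono) auto
        then show "\<delta> * real n powr (real r + 1 - recip p) \<le> (Ct + 1) * (\<delta> * real n powr (real r + 1 - recip p))"
          by simp
      qed (use C(1) in auto)
      also have "\<dots> = C * (Ct + 1) * (real n powr - \<theta> + \<delta> * real n powr (real r + 1 - recip p))"
        by (simp add: algebra_simps)
      finally show "\<bar>(rth_deriv r f t - \<psi> (\<lambda>k. Pcoord {..<n} (Gcoeff \<alpha> f) k + \<xi> k) t) * ?w\<bar>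
        \<le> C * (Ct + 1) * (real n powr - \<theta> + \<delta> * real n powr (real r + 1 - recip p))" by simp
    qed
    finally show ?thesis .
  qed
  show ?thesis
    by (rule exI[of _ "C * (Ct + 1)"]) (use main C(1) Ct in \<open>auto simp: \<theta>_def\<close>)
qed

text \<open>
  If the noise can cancel the coefficients of \<open>F\<close> in \<open>\<Omega>\<close>, then \<open>F\<close> and \<open>-F\<close> both
  produce the data \<open>0\<close>, and no reconstruction is close to both.
\<close>

lemma err_ge_fooling:
  assumes \<alpha>: "\<alpha> \<ge> 0" and A: "finite A"
    and W: "seq_norm s \<mu> (\<lambda>k. if k \<in> A then c else 0) \<le> 1"
    and noise: "lp_norm p (\<lambda>k. if k \<in> A \<inter> \<Omega> then c else 0) \<le> ennreal \<delta>"
    and t: "t > 0"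
  shows "ennreal (\<bar>c * (\<Sum>k\<in>A. poly ((pderiv ^^ r) (lonp \<alpha> k)) t)\<bar> * sqrt (weight \<alpha> t)) \<le> err \<alpha> r s \<mu> p \<delta> \<psi> \<Omega>"
proof -
  define v where "v = c * (\<Sum>k\<in>A. poly ((pderiv ^^ r) (lonp \<alpha> k)) t)"
  define z where "z = \<psi> (\<lambda>k. 0) t"
  have ge: "ennreal (\<bar>\<sigma> * v - z\<bar> * sqrt (weight \<alpha> t)) \<le> err \<alpha> r s \<mu> p \<delta> \<psi> \<Omega>" if \<sigma>: "\<bar>\<sigma>\<bar> = 1" for \<sigma> :: real
  proof -
    define f where "f = poly (\<Sum>k\<in>A. smult (\<sigma> * c) (lonp \<alpha> k))"
    define \<xi> where "\<xi> k = - (if k \<in> A \<inter> \<Omega> then \<sigma> * c else 0)" for k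
    have G: "Gcoeff \<alpha> f = (\<lambda>k. if k \<in> A then \<sigma> * c else 0)" unfolding f_def by (rule Gcoeff_poly[OF \<alpha> A])
    have abs_cong: "seq_norm q \<kappa> a = seq_norm q \<kappa> b" if "\<And>k. \<bar>a k\<bar> = \<bar>b k\<bar>" for q \<kappa> and a b :: "nat \<Rightarrow> real"
      using that by (simp add: seq_norm_def)
    have "seq_norm s \<mu> (Gcoeff \<alpha> f) \<le> 1"
      using W unfolding G by (subst abs_cong[where b = "\<lambda>k. if k \<in> A then c else 0"]) (use \<sigma> in \<open>auto simp: abs_mult\<close>)
    then have f: "f \<in> W_ball \<alpha> s \<mu>" unfolding W_ball_def f_def using poly_in_L2w[OF \<alpha>] by simp
    have \<xi>: "\<xi> \<in> {\<xi>. lp_norm p \<xi> \<le> ennreal \<delta>}"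
      using noise unfolding lp_norm_def mem_Collect_eq
      by (subst abs_cong[where b = "\<lambda>k. if k \<in> A \<inter> \<Omega> then c else 0"]) (use \<sigma> in \<open>auto simp: abs_mult \<xi>_def\<close>)
    have 0: "(\<lambda>k. Pcoord \<Omega> (Gcoeff \<alpha> f) k + \<xi> k) = (\<lambda>k. 0)"
      by (auto simp: Pcoord_def G \<xi>_def)
    have "rth_deriv r f t = \<sigma> * v"
      unfolding f_def rth_deriv_poly[OF t] v_def
      by (simp add: higher_pderiv_sum higher_pderiv_smult poly_sum sum_distrib_left mult_ac)
    then have "ennreal (\<bar>\<sigma> * v - z\<bar> * sqrt (weight \<alpha> t)) =
        ennreal \<bar>(rth_deriv r f t - \<psi> (\<lambda>k. Pcoord \<Omega> (Gcoeff \<alpha> f) k + \<xi> k) t) * sqrt (weight \<alpha> t)\<bar>"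
      unfolding 0 z_def by (simp add: abs_mult weight_nonneg)
    also have "\<dots> \<le> err \<alpha> r s \<mu> p \<delta> \<psi> \<Omega>"
      unfolding err_def C_norm_def using t by (intro SUP_upper2[OF f] SUP_upper2[OF \<xi>] SUP_upper2[of t]) auto
    finally show ?thesis .
  qed
  have "\<bar>v\<bar> \<le> \<bar>1 * v - z\<bar> \<or> \<bar>v\<bar> \<le> \<bar>- 1 * v - z\<bar>" by linarith
  then show ?thesis
  proof
    assume "\<bar>v\<bar> \<le> \<bar>1 * v - z\<bar>"
    then have "\<bar>v\<bar> * sqrt (weight \<alpha> t) \<le> \<bar>1 * v - z\<bar> * sqrt (weight \<alpha> t)"
      by (rule mult_right_mono) (simp add: weight_nonneg)
    from order.trans[OF ennreal_leI[OF this] ge[of 1]] show ?thesis by (simp add: v_def)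
  next
    assume "\<bar>v\<bar> \<le> \<bar>- 1 * v - z\<bar>"
    then have "\<bar>v\<bar> * sqrt (weight \<alpha> t) \<le> \<bar>- 1 * v - z\<bar> * sqrt (weight \<alpha> t)"
      by (rule mult_right_mono) (simp add: weight_nonneg)
    from order.trans[OF ennreal_leI[OF this] ge[of "-1"]] show ?thesis by (simp add: v_def)
  qed
qed

text \<open>Only m of the 2m indices in the block are required, which leaves room for removing up to
  m indices of \<open>\<Omega>\<close>. When the noise hides the data instead,
  \<open>\<Omega>\<close> is arbitrary. The bound \<mu> \<ge> 1 makes the powers with exponents
  \<mu> and \<mu> + 1/s - 1/p monotone.\<close>

lemma err_lower_bound:
  assumes \<alpha>: "\<alpha> \<ge> 0" and s: "1 \<le> s" and p: "1 \<le> p" and \<mu>: "\<mu> > real r + 1 - recip s" and \<mu>1: "\<mu> \<ge> 1"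
  shows "\<exists>c>0. \<forall>\<delta> m \<psi> \<Omega> A. 2 ^ r \<le> m \<and> A \<subseteq> {m..<3 * m} \<and> m \<le> card A \<and>
      (A \<inter> \<Omega> = {} \<or> real m powr - (\<mu> + recip s - recip p) \<le> \<delta>) \<longrightarrow>
    ennreal (c * real m powr - (\<mu> + recip s - 1 - real r)) \<le> err \<alpha> r s \<mu> p \<delta> \<psi> \<Omega>"
proof -
  define \<theta> where "\<theta> = \<mu> + recip s - 1 - real r"
  obtain c where c: "c > 0" "\<And>k t. 0 \<le> t \<Longrightarrow> real k * t \<le> 1 / 3 \<Longrightarrow> 2 ^ r \<le> k \<Longrightarrow>
      (-1) ^ r * poly ((pderiv ^^ r) (lonp \<alpha> k)) t \<ge> c * real k powr (\<alpha> / 2) * real k ^ r"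
    using lonp_deriv_lower_bound[OF \<alpha>, of r] by blast
  \<comment> \<open>The factor 3 comes from the coefficient at 3m; 9 and exp(-1) come from sqrt w at
    1 / (9m).\<close>
  define c1 where "c1 = 3 powr - (\<mu> + recip s) * c * (9 powr - (\<alpha> / 2) * exp (- 1))"
  have c1: "c1 > 0" using c by (simp add: c1_def)
  have main: "ennreal (c1 * real m powr - \<theta>) \<le> err \<alpha> r s \<mu> p \<delta> \<psi> \<Omega>"
    if m: "2 ^ r \<le> m" and A: "A \<subseteq> {m..<3 * m}" "m \<le> card A"
      and noise: "A \<inter> \<Omega> = {} \<or> real m powr - (\<mu> + recip s - recip p) \<le> \<delta>" for \<delta> m \<psi> \<Omega> A
  proof -
    have m1: "m \<ge> 1" using m one_le_power[of "2::nat" r] by linarith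
    have fA: "finite A" using A(1) by (rule finite_subset) simp
    have "card A \<le> card {m..<3 * m}" using A(1) by (intro card_mono) auto
    then have cA: "real (card A) \<le> real (3 * m)" by simp
    \<comment> \<open>The common coefficient: at most 3m of them, each weighted by at most
      (3m)^\<mu>, have norm at most 1.\<close>
    define b where "b = real (3 * m) powr - (\<mu> + recip s)"
    have b: "b > 0" using m1 by (simp add: b_def)
    have "seq_norm s \<mu> (\<lambda>k. if k \<in> A then b else 0) \<le> ennreal ((real (3 * m) powr \<mu> * b) * real (3 * m) powr recip s)"
    proof (rule seq_norm_le[OF s fA cA])
      fix k assume "k \<in> A"
      then have "mx k \<le> real (3 * m)" using A(1) m1 by auto
      then show "mx k powr \<mu> * \<bar>if k \<in> A then b else 0\<bar> \<le> real (3 * m) powr \<mu> * b"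
        using b \<mu>1 by (auto intro!: mult_right_mono powr_mono2)
    qed (use b in auto)
    also have "(real (3 * m) powr \<mu> * b) * real (3 * m) powr recip s = 1"
      using m1 by (simp add: b_def flip: powr_add)
    finally have W: "seq_norm s \<mu> (\<lambda>k. if k \<in> A then b else 0) \<le> 1" by simp
    have "lp_norm p (\<lambda>k. if k \<in> A \<inter> \<Omega> then b else 0) \<le> ennreal \<delta>"
      using noise
    proof
      assume "A \<inter> \<Omega> = {}"
      then have "lp_norm p (\<lambda>k. if k \<in> A \<inter> \<Omega> then b else 0) \<le> ennreal (0 * 1 powr recip p)"
        unfolding lp_norm_def by (intro seq_norm_le[OF p, of "{}"]) auto
      then show ?thesis by simp
    next
      assume d: "real m powr - (\<mu> + recip s - recip p) \<le> \<delta>"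
      have "lp_norm p (\<lambda>k. if k \<in> A \<inter> \<Omega> then b else 0) \<le> ennreal (b * real (3 * m) powr recip p)"
        unfolding lp_norm_def using b cA by (intro seq_norm_le[OF p fA]) auto
      also have "b * real (3 * m) powr recip p = real (3 * m) powr - (\<mu> + recip s - recip p)"
        by (simp add: b_def algebra_simps flip: powr_add)
      also have "ennreal \<dots> \<le> ennreal \<delta>"
      proof (rule ennreal_leI, rule order.trans[OF _ d])
        have "\<mu> + recip s - recip p \<ge> 0" using \<mu>1 recip_bounds[OF s] recip_bounds[OF p] by linarith
        then show "real (3 * m) powr - (\<mu> + recip s - recip p) \<le> real m powr - (\<mu> + recip s - recip p)"
          using m1 by (intro powr_mono2') auto
      qed
      finally show ?thesis .
    qed
    note low = err_ge_fooling[OF \<alpha> fA W this]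
    \<comment> \<open>All indices are below 3m, so k t \<le> 1/3, the range of
      \<open>lonp_deriv_lower_bound\<close>.\<close>
    define t where "t = 1 / (9 * real m)"
    have t: "t > 0" "t \<le> 1" using m1 by (auto simp: t_def)
    have "real m * (c * real m powr (\<alpha> / 2) * real m ^ r) \<le> real (card A) * (c * real m powr (\<alpha> / 2) * real m ^ r)"
      using A(2) c(1) by (intro mult_right_mono) auto
    also have "\<dots> = (\<Sum>k\<in>A. c * real m powr (\<alpha> / 2) * real m ^ r)" by simp
    also have "\<dots> \<le> (\<Sum>k\<in>A. (-1) ^ r * poly ((pderiv ^^ r) (lonp \<alpha> k)) t)"
    proof (rule sum_mono)
      fix k assume "k \<in> A"
      then have k: "m \<le> k" "k < 3 * m" using A(1) by auto
      have "real k * t \<le> real (3 * m) * t" using k t by (intro mult_right_mono) auto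
      also have "\<dots> = 1 / 3" using m1 by (simp add: t_def)
      finally have kt: "real k * t \<le> 1 / 3" .
      have "c * real m powr (\<alpha> / 2) * real m ^ r \<le> c * real k powr (\<alpha> / 2) * real k ^ r"
        using k c(1) \<alpha> by (intro mult_mono mult_left_mono powr_mono2 power_mono) auto
      also have "\<dots> \<le> (-1) ^ r * poly ((pderiv ^^ r) (lonp \<alpha> k)) t"
        using c(2)[of t k] t kt m k by auto
      finally show "c * real m powr (\<alpha> / 2) * real m ^ r \<le> (-1) ^ r * poly ((pderiv ^^ r) (lonp \<alpha> k)) t" .
    qed
    also have "\<dots> \<le> \<bar>\<Sum>k\<in>A. poly ((pderiv ^^ r) (lonp \<alpha> k)) t\<bar>"
      unfolding sum_distrib_left[symmetric]
      by (rule order.trans[OF abs_ge_self]) (simp add: abs_mult power_abs)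
    finally have S: "real m * (c * real m powr (\<alpha> / 2) * real m ^ r) \<le> \<bar>\<Sum>k\<in>A. poly ((pderiv ^^ r) (lonp \<alpha> k)) t\<bar>" .
    have w: "9 powr - (\<alpha> / 2) * exp (- 1) * real m powr - (\<alpha> / 2) \<le> sqrt (weight \<alpha> t)"
    proof -
      have "sqrt (exp (- t)) = exp (- t / 2)" by (rule real_sqrt_unique) (simp_all add: power2_eq_square flip: exp_add)
      then have "sqrt (weight \<alpha> t) = t powr (\<alpha> / 2) * exp (- t / 2)"
        by (simp add: weight_def real_sqrt_mult powr_half_sqrt[symmetric] powr_powr)
      moreover have "t powr (\<alpha> / 2) = 9 powr - (\<alpha> / 2) * real m powr - (\<alpha> / 2)"
        by (simp add: t_def powr_divide powr_mult powr_minus field_simps)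
      ultimately have "sqrt (weight \<alpha> t) = (9 powr - (\<alpha> / 2) * real m powr - (\<alpha> / 2)) * exp (- t / 2)"
        by simp
      moreover have "(9 powr - (\<alpha> / 2) * real m powr - (\<alpha> / 2)) * exp (- 1) \<le>
          (9 powr - (\<alpha> / 2) * real m powr - (\<alpha> / 2)) * exp (- t / 2)"
        using t by (intro mult_left_mono) auto
      ultimately show ?thesis by (simp only: mult_ac)
    qed
    have mp: "real m powr - \<theta> = real m powr - (\<mu> + recip s) * (real m * (real m powr (\<alpha> / 2) * real m ^ r)) * real m powr - (\<alpha> / 2)"
    proof -
      have "real m * (real m powr (\<alpha> / 2) * real m ^ r) = real m powr 1 * (real m powr (\<alpha> / 2) * real m powr real r)"
        using m1 by (simp add: powr_realpow)
      moreover have "real m powr - \<theta> = real m powr (- (\<mu> + recip s) + (1 + (\<alpha> / 2 + real r)) + - (\<alpha> / 2))"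
        by (simp add: \<theta>_def algebra_simps)
      ultimately show ?thesis by (simp only: powr_add)
    qed
    have "c1 * real m powr - \<theta> = b * (real m * (c * real m powr (\<alpha> / 2) * real m ^ r)) * (9 powr - (\<alpha> / 2) * exp (- 1) * real m powr - (\<alpha> / 2))"
      unfolding mp c1_def b_def by (simp add: powr_mult mult_ac)
    also have "\<dots> \<le> b * \<bar>\<Sum>k\<in>A. poly ((pderiv ^^ r) (lonp \<alpha> k)) t\<bar> * sqrt (weight \<alpha> t)"
      using b c(1) by (intro mult_mono mult_left_mono S w) auto
    also have "\<dots> = \<bar>b * (\<Sum>k\<in>A. poly ((pderiv ^^ r) (lonp \<alpha> k)) t)\<bar> * sqrt (weight \<alpha> t)"
      using b by (simp add: abs_mult)
    finally show ?thesis by (rule order.trans[OF ennreal_leI low[OF t(1), of r]])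
  qed
  show ?thesis by (rule exI[of _ c1]) (use main c1 in \<open>auto simp: \<theta>_def\<close>)
qed

section \<open>Balancing truncation, noise and the number of data\<close>

theorem theorem4p8:
  fixes \<alpha> \<mu> :: real and r :: nat and s p :: ennreal
  assumes "\<alpha> \<ge> 0" and "r \<ge> 1" and "1 \<le> s" and "1 \<le> p"
    and "\<mu> > real r + 1 - recip s"
  shows "(\<exists>C\<^sub>0. upper_const \<alpha> r s \<mu> p C\<^sub>0) \<and>
    (\<forall>C\<^sub>0 K. upper_const \<alpha> r s \<mu> p C\<^sub>0 \<and> C\<^sub>0 \<le> K \<longrightarrow>
       (\<forall>\<delta>. 0 < \<delta> \<and> \<delta> < 1 \<longrightarrow> admissible_N \<alpha> r s \<mu> p K \<delta> \<noteq> {}) \<and>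
       (\<exists>c' c''. 0 < c' \<and> c' \<le> c'' \<and>
          (\<forall>\<delta>. 0 < \<delta> \<and> \<delta> < 1 \<longrightarrow>
             c' * \<delta> powr info_exp s \<mu> p \<le> real (N_min \<alpha> r s \<mu> p K \<delta>) \<and>
             real (N_min \<alpha> r s \<mu> p K \<delta>) \<le> c'' * \<delta> powr info_exp s \<mu> p \<and>
             ennreal (c' * \<delta> powr rate_exp r s \<mu> p)
               \<le> radius \<alpha> r s \<mu> p (N_min \<alpha> r s \<mu> p K \<delta>) \<delta> \<and>
             radius \<alpha> r s \<mu> p (N_min \<alpha> r s \<mu> p K \<delta>) \<delta>
               \<le> ennreal (c'' * \<delta> powr rate_exp r s \<mu> p))))"
proof -
  define \<theta> where "\<theta> = \<mu> + recip s - 1 - real r"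
  define E where "E = \<mu> + recip s - recip p"
  have \<theta>: "\<theta> > 0" using assms(5) by (simp add: \<theta>_def)
  have E: "E > 0" using assms(2,5) recip_bounds[OF assms(4)] by (simp add: E_def)
  have \<mu>1: "\<mu> \<ge> 1" using assms(2,5) recip_bounds[OF assms(3)] by linarith
  \<comment> \<open>The critical number of coefficients, the solution of X^(-E) = \<delta>; powers
    of \<delta> are expressed as powers of X from here on.\<close>
  define X where "X \<delta> = \<delta> powr info_exp s \<mu> p" for \<delta>
  have X1: "X \<delta> \<ge> 1" and X\<theta>: "X \<delta> powr - \<theta> = \<delta> powr rate_exp r s \<mu> p"
    and XE: "X \<delta> powr - E = \<delta>" if \<delta>: "0 < \<delta>" "\<delta> < 1" for \<delta>
  proof -
    have ie: "info_exp s \<mu> p = - 1 / E" by (simp add: info_exp_def E_def)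
    have "\<delta> powr 0 \<le> \<delta> powr info_exp s \<mu> p" using \<delta> E by (intro powr_mono') (auto simp: ie)
    then show "X \<delta> \<ge> 1" using \<delta> by (simp add: X_def)
    show "X \<delta> powr - \<theta> = \<delta> powr rate_exp r s \<mu> p"
    proof -
      have "rate_exp r s \<mu> p = \<theta> / E" by (simp add: rate_exp_def \<theta>_def E_def)
      then show ?thesis unfolding X_def powr_powr ie by simp
    qed
    show "X \<delta> powr - E = \<delta>" unfolding X_def powr_powr ie using \<delta> E by simp
  qed
  have "\<exists>C\<^sub>0. upper_const \<alpha> r s \<mu> p C\<^sub>0"
  proof -
    obtain C where C: "C > 0" "\<And>\<delta> n N. 0 < \<delta> \<Longrightarrow> 1 \<le> n \<Longrightarrow> n \<le> N \<Longrightarrow> radius \<alpha> r s \<mu> p N \<delta> \<le>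
        ennreal (C * (real n powr - \<theta> + \<delta> * real n powr (real r + 1 - recip p)))"
      using radius_upper_bound[OF assms(1,3,4,5)] unfolding \<theta>_def by blast
    have "radius \<alpha> r s \<mu> p N \<delta> \<le> ennreal (C * (2 powr \<theta> + 1) * \<delta> powr rate_exp r s \<mu> p)"
      if \<delta>: "0 < \<delta>" "\<delta> < 1" and N: "real N \<ge> X \<delta>" for \<delta> N
    proof -
      \<comment> \<open>Rounding down keeps n \<le> N whenever N \<ge> X, and still n \<ge> X / 2
        because X \<ge> 1.\<close>
      define n where "n = nat \<lfloor>X \<delta>\<rfloor>"
      have fl: "1 \<le> \<lfloor>X \<delta>\<rfloor>" using X1[OF \<delta>] by simp
      then have rn: "real n = of_int \<lfloor>X \<delta>\<rfloor>" by (simp add: n_def)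
      have le: "1 \<le> real n" "real n \<le> X \<delta>" "X \<delta> < real n + 1"
        using fl floor_correct[of "X \<delta>"] unfolding rn by auto
      then have n: "1 \<le> n" "real n \<le> X \<delta>" "X \<delta> / 2 \<le> real n" "n \<le> N" using N by linarith+
      have "real n powr - \<theta> \<le> (X \<delta> / 2) powr - \<theta>"
        using n \<theta> X1[OF \<delta>] by (intro powr_mono2') auto
      also have "\<dots> = 2 powr \<theta> * \<delta> powr rate_exp r s \<mu> p"
        using X1[OF \<delta>] by (simp add: powr_divide powr_minus_divide flip: X\<theta>[OF \<delta>])
      finally have 1: "real n powr - \<theta> \<le> 2 powr \<theta> * \<delta> powr rate_exp r s \<mu> p" .
      have "\<delta> * real n powr (real r + 1 - recip p) \<le> \<delta> * X \<delta> powr (real r + 1 - recip p)"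
        using n \<delta> recip_bounds[OF assms(4)] by (intro mult_left_mono powr_mono2) auto
      also have "\<dots> = X \<delta> powr - E * X \<delta> powr (real r + 1 - recip p)" by (simp add: XE[OF \<delta>])
      \<comment> \<open>The balance: E - (r + 1 - 1/p) = \<theta>.\<close>
      also have "\<dots> = X \<delta> powr - \<theta>" using X1[OF \<delta>] by (simp add: E_def \<theta>_def algebra_simps flip: powr_add)
      finally have 2: "\<delta> * real n powr (real r + 1 - recip p) \<le> \<delta> powr rate_exp r s \<mu> p" by (simp add: X\<theta>[OF \<delta>])
      have "C * (real n powr - \<theta> + \<delta> * real n powr (real r + 1 - recip p))
        \<le> C * (2 powr \<theta> * \<delta> powr rate_exp r s \<mu> p + \<delta> powr rate_exp r s \<mu> p)"
        using 1 2 C(1) by (intro mult_left_mono add_mono) auto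
      also have "\<dots> = C * (2 powr \<theta> + 1) * \<delta> powr rate_exp r s \<mu> p" by (simp add: algebra_simps)
      finally show ?thesis by (rule order.trans[OF C(2)[OF \<delta>(1) n(1,4)] ennreal_leI])
    qed
    then have "upper_const \<alpha> r s \<mu> p (C * (2 powr \<theta> + 1))"
      using C(1) by (auto simp: upper_const_def X_def intro!: mult_pos_pos add_pos_pos)
    then show ?thesis by blast
  qed
  moreover
  obtain c where c0: "c > 0" and low: "\<forall>\<delta> m \<psi> \<Omega> A. 2 ^ r \<le> m \<and> A \<subseteq> {m..<3 * m} \<and> m \<le> card A \<and>
      (A \<inter> \<Omega> = {} \<or> real m powr - E \<le> \<delta>) \<longrightarrow> ennreal (c * real m powr - \<theta>) \<le> err \<alpha> r s \<mu> p \<delta> \<psi> \<Omega>"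
    using err_lower_bound[OF assms(1,3,4,5) \<mu>1, folded \<theta>_def E_def] by (elim exE conjE)
  have c: "ennreal (c * real m powr - \<theta>) \<le> err \<alpha> r s \<mu> p \<delta> \<psi> \<Omega>"
    if "2 ^ r \<le> m" "A \<subseteq> {m..<3 * m}" "m \<le> card A" "A \<inter> \<Omega> = {} \<or> real m powr - E \<le> \<delta>" for \<delta> m \<psi> \<Omega> A
    by (rule low[rule_format, where A = A], intro conjI that)
  \<comment> \<open>These are c m^(-\<theta>) for m = 2^r N and for m \<le> 2 * 2^r X, with the
    powers of N and X split off.\<close>
  define cB where "cB = c * (2 ^ r) powr - \<theta>"
  define cA where "cA = c * (2 * 2 ^ r) powr - \<theta>"
  have cAB: "cA > 0" "cB > 0" using c0 by (auto simp: cA_def cB_def)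
  have few_data: "ennreal (cB * real N powr - \<theta>) \<le> radius \<alpha> r s \<mu> p N \<delta>" if N: "N \<ge> 1" for N \<delta>
  proof -
    have "ennreal (cB * real N powr - \<theta>) \<le> err \<alpha> r s \<mu> p \<delta> \<psi> \<Omega>" if "(\<psi>, \<Omega>) \<in> Psi p N" for \<psi> \<Omega>
    proof -
      have \<Omega>: "finite \<Omega>" "card \<Omega> \<le> N" using that by (auto simp: Psi_def)
      \<comment> \<open>The factor 2^r meets the condition \<open>2 ^ r \<le> m\<close>; since m
        \<ge> N, at least m of the 2m indices in the block lie outside
        \<open>\<Omega>\<close>.\<close>
      define m where "m = 2 ^ r * N"
      have m: "2 ^ r \<le> m" "N \<le> m" using N by (auto simp: m_def)
      define A where "A = {m..<3 * m} - \<Omega>"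
      have "card {m..<3 * m} - card \<Omega> \<le> card A" unfolding A_def by (rule diff_card_le_card_Diff[OF \<Omega>(1)])
      then have "m \<le> card A" using m \<Omega>(2) by simp
      then have "ennreal (c * real m powr - \<theta>) \<le> err \<alpha> r s \<mu> p \<delta> \<psi> \<Omega>"
        by (intro c[of m A] m) (auto simp: A_def)
      then show ?thesis by (simp add: m_def cB_def powr_mult mult_ac)
    qed
    then show ?thesis unfolding radius_def by (intro INF_greatest) auto
  qed
  \<comment> \<open>Here m depends on \<delta> alone, rounded up so that m^(-E) \<le> \<delta>. The
    whole block is hidden by the noise, so more data do not help and N is unrestricted.\<close>
  have noise: "ennreal (cA * \<delta> powr rate_exp r s \<mu> p) \<le> radius \<alpha> r s \<mu> p N \<delta>" if \<delta>: "0 < \<delta>" "\<delta> < 1" for N \<delta>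
  proof -
    define n where "n = nat \<lceil>X \<delta>\<rceil>"
    have n: "1 \<le> n" "X \<delta> \<le> real n" "real n \<le> 2 * X \<delta>" using X1[OF \<delta>] unfolding n_def by linarith+
    define m where "m = 2 ^ r * n"
    have m: "2 ^ r \<le> m" "n \<le> m" using n by (auto simp: m_def)
    have mX: "X \<delta> \<le> real m" using m(2) n(2) by linarith
    have "real m powr - E \<le> X \<delta> powr - E" using mX X1[OF \<delta>] E by (intro powr_mono2') auto
    then have mE: "real m powr - E \<le> \<delta>" by (simp add: XE[OF \<delta>])
    have "real m \<le> 2 * 2 ^ r * X \<delta>" using n(3) by (simp add: m_def)
    then have "(2 * 2 ^ r * X \<delta>) powr - \<theta> \<le> real m powr - \<theta>"
      using \<theta> mX X1[OF \<delta>] by (intro powr_mono2') auto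
    then have "cA * \<delta> powr rate_exp r s \<mu> p \<le> c * real m powr - \<theta>"
      unfolding X\<theta>[OF \<delta>, symmetric] cA_def using c0 by (simp add: powr_mult mult.assoc)
    then have "ennreal (cA * \<delta> powr rate_exp r s \<mu> p) \<le> ennreal (c * real m powr - \<theta>)"
      by (rule ennreal_leI)
    also have "ennreal (c * real m powr - \<theta>) \<le> err \<alpha> r s \<mu> p \<delta> \<psi> \<Omega>" for \<psi> \<Omega>
      by (rule c[of m "{m..<3 * m}"]) (use m mE in auto)
    finally have "ennreal (cA * \<delta> powr rate_exp r s \<mu> p) \<le> err \<alpha> r s \<mu> p \<delta> \<psi> \<Omega>" for \<psi> \<Omega> .
    then show ?thesis unfolding radius_def by (intro INF_greatest) auto
  qed
  have "(\<forall>\<delta>. 0 < \<delta> \<and> \<delta> < 1 \<longrightarrow> admissible_N \<alpha> r s \<mu> p K \<delta> \<noteq> {}) \<and>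
       (\<exists>c' c''. 0 < c' \<and> c' \<le> c'' \<and>
          (\<forall>\<delta>. 0 < \<delta> \<and> \<delta> < 1 \<longrightarrow>
             c' * \<delta> powr info_exp s \<mu> p \<le> real (N_min \<alpha> r s \<mu> p K \<delta>) \<and>
             real (N_min \<alpha> r s \<mu> p K \<delta>) \<le> c'' * \<delta> powr info_exp s \<mu> p \<and>
             ennreal (c' * \<delta> powr rate_exp r s \<mu> p)
               \<le> radius \<alpha> r s \<mu> p (N_min \<alpha> r s \<mu> p K \<delta>) \<delta> \<and>
             radius \<alpha> r s \<mu> p (N_min \<alpha> r s \<mu> p K \<delta>) \<delta>
               \<le> ennreal (c'' * \<delta> powr rate_exp r s \<mu> p)))"
    if UC: "upper_const \<alpha> r s \<mu> p C\<^sub>0" and K: "C\<^sub>0 \<le> K" for C\<^sub>0 K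
  proof (intro conjI)
    have K0: "K > 0" using UC K by (simp add: upper_const_def)
    define M where "M = N_min \<alpha> r s \<mu> p K"
    \<comment> \<open>Besides nonemptiness this gives \<open>N_min\<close> \<le> ceiling of X \<le>
      2 X, the source of the 2 in \<open>c''\<close>.\<close>
    have ceil: "nat \<lceil>X \<delta>\<rceil> \<in> admissible_N \<alpha> r s \<mu> p K \<delta>" if \<delta>: "0 < \<delta>" "\<delta> < 1" for \<delta>
    proof -
      have n: "nat \<lceil>X \<delta>\<rceil> \<ge> 1" "X \<delta> \<le> real (nat \<lceil>X \<delta>\<rceil>)" using X1[OF \<delta>] by linarith+
      have "radius \<alpha> r s \<mu> p (nat \<lceil>X \<delta>\<rceil>) \<delta> \<le> ennreal (C\<^sub>0 * \<delta> powr rate_exp r s \<mu> p)"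
        using UC n(2) \<delta> unfolding upper_const_def X_def by blast
      also have "\<dots> \<le> ennreal (K * \<delta> powr rate_exp r s \<mu> p)"
        using K by (intro ennreal_leI mult_right_mono) auto
      finally show ?thesis using n(1) by (simp add: admissible_N_def)
    qed
    then show "\<forall>\<delta>. 0 < \<delta> \<and> \<delta> < 1 \<longrightarrow> admissible_N \<alpha> r s \<mu> p K \<delta> \<noteq> {}" by blast
    \<comment> \<open>At M = \<open>N_min\<close> the few-data bound and admissibility give cB
      M^(-\<theta>) \<le> K X^(-\<theta>); solving for M yields M \<ge> c1 X.\<close>
    define c1 where "c1 = (cB / K) powr (1 / \<theta>)"
    have c1: "c1 > 0" using cAB K0 by (simp add: c1_def)
    \<comment> \<open>The 1 in the minimum only serves to guarantee c' \<le> c''.\<close>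
    define c' where "c' = min 1 (min c1 cA)"
    define c'' where "c'' = max 2 K"
    have M: "c' * X \<delta> \<le> real (M \<delta>)" "real (M \<delta>) \<le> c'' * X \<delta>"
      "radius \<alpha> r s \<mu> p (M \<delta>) \<delta> \<le> ennreal (c'' * \<delta> powr rate_exp r s \<mu> p)"
      "ennreal (c' * \<delta> powr rate_exp r s \<mu> p) \<le> radius \<alpha> r s \<mu> p (M \<delta>) \<delta>"
      if \<delta>: "0 < \<delta>" "\<delta> < 1" for \<delta>
    proof -
      have "M \<delta> \<in> admissible_N \<alpha> r s \<mu> p K \<delta>"
        unfolding M_def N_min_def by (rule LeastI[of "\<lambda>N. N \<in> admissible_N \<alpha> r s \<mu> p K \<delta>", OF ceil[OF \<delta>]])
      then have adm: "M \<delta> \<ge> 1" "radius \<alpha> r s \<mu> p (M \<delta>) \<delta> \<le> ennreal (K * \<delta> powr rate_exp r s \<mu> p)"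
        by (auto simp: admissible_N_def)
      have "M \<delta> \<le> nat \<lceil>X \<delta>\<rceil>"
        unfolding M_def N_min_def by (rule Least_le[of "\<lambda>N. N \<in> admissible_N \<alpha> r s \<mu> p K \<delta>", OF ceil[OF \<delta>]])
      then have "real (M \<delta>) \<le> 2 * X \<delta>" using X1[OF \<delta>] by linarith
      also have "\<dots> \<le> c'' * X \<delta>" using X1[OF \<delta>] by (intro mult_right_mono) (auto simp: c''_def)
      finally show "real (M \<delta>) \<le> c'' * X \<delta>" .
      have "ennreal (K * \<delta> powr rate_exp r s \<mu> p) \<le> ennreal (c'' * \<delta> powr rate_exp r s \<mu> p)"
        by (intro ennreal_leI mult_right_mono) (auto simp: c''_def)
      with adm(2) show "radius \<alpha> r s \<mu> p (M \<delta>) \<delta> \<le> ennreal (c'' * \<delta> powr rate_exp r s \<mu> p)" by (rule order.trans)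
      have "ennreal (c' * \<delta> powr rate_exp r s \<mu> p) \<le> ennreal (cA * \<delta> powr rate_exp r s \<mu> p)"
        by (intro ennreal_leI mult_right_mono) (auto simp: c'_def)
      from order.trans[OF this noise[OF \<delta>]]
      show "ennreal (c' * \<delta> powr rate_exp r s \<mu> p) \<le> radius \<alpha> r s \<mu> p (M \<delta>) \<delta>" .
      have "ennreal (cB * real (M \<delta>) powr - \<theta>) \<le> ennreal (K * X \<delta> powr - \<theta>)"
        using order.trans[OF few_data[OF adm(1)] adm(2)] by (simp add: X\<theta>[OF \<delta>])
      then have "cB * real (M \<delta>) powr - \<theta> \<le> K * X \<delta> powr - \<theta>" using K0 by (simp add: ennreal_le_iff)
      then have "cB / K * X \<delta> powr \<theta> \<le> real (M \<delta>) powr \<theta>"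
        using K0 X1[OF \<delta>] adm(1) by (simp add: powr_minus field_simps)
      then have "(cB / K * X \<delta> powr \<theta>) powr (1 / \<theta>) \<le> (real (M \<delta>) powr \<theta>) powr (1 / \<theta>)"
        using \<theta> cAB K0 by (intro powr_mono2) auto
      moreover have "(cB / K * X \<delta> powr \<theta>) powr (1 / \<theta>) = c1 * (X \<delta> powr \<theta>) powr (1 / \<theta>)"
        unfolding c1_def using cAB K0 by (subst powr_mult) auto
      ultimately have "c1 * X \<delta> \<le> real (M \<delta>)" using \<theta> X1[OF \<delta>] by (simp add: powr_powr)
      moreover have "c' * X \<delta> \<le> c1 * X \<delta>" using X1[OF \<delta>] by (intro mult_right_mono) (auto simp: c'_def)
      ultimately show "c' * X \<delta> \<le> real (M \<delta>)" by linarith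
    qed
    have c_pos: "0 < c'" "c' \<le> c''" using c1 cAB by (auto simp: c'_def c''_def)
    show "\<exists>c' c''. 0 < c' \<and> c' \<le> c'' \<and>
          (\<forall>\<delta>. 0 < \<delta> \<and> \<delta> < 1 \<longrightarrow>
             c' * \<delta> powr info_exp s \<mu> p \<le> real (N_min \<alpha> r s \<mu> p K \<delta>) \<and>
             real (N_min \<alpha> r s \<mu> p K \<delta>) \<le> c'' * \<delta> powr info_exp s \<mu> p \<and>
             ennreal (c' * \<delta> powr rate_exp r s \<mu> p)
               \<le> radius \<alpha> r s \<mu> p (N_min \<alpha> r s \<mu> p K \<delta>) \<delta> \<and>
             radius \<alpha> r s \<mu> p (N_min \<alpha> r s \<mu> p K \<delta>) \<delta>
               \<le> ennreal (c'' * \<delta> powr rate_exp r s \<mu> p))"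
    proof (rule exI[of _ c'], rule exI[of _ c''], intro conjI c_pos allI impI)
      fix \<delta> :: real assume "0 < \<delta> \<and> \<delta> < 1"
      then have \<delta>: "0 < \<delta>" "\<delta> < 1" by auto
      show "c' * \<delta> powr info_exp s \<mu> p \<le> real (N_min \<alpha> r s \<mu> p K \<delta>)"
        using M(1)[OF \<delta>] unfolding M_def X_def .
      show "real (N_min \<alpha> r s \<mu> p K \<delta>) \<le> c'' * \<delta> powr info_exp s \<mu> p"
        using M(2)[OF \<delta>] unfolding M_def X_def .
      show "ennreal (c' * \<delta> powr rate_exp r s \<mu> p) \<le> radius \<alpha> r s \<mu> p (N_min \<alpha> r s \<mu> p K \<delta>) \<delta>"
        using M(4)[OF \<delta>] unfolding M_def .
      show "radius \<alpha> r s \<mu> p (N_min \<alpha> r s \<mu> p K \<delta>) \<delta> \<le> ennreal (c'' * \<delta> powr rate_exp r s \<mu> p)"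
        using M(3)[OF \<delta>] unfolding M_def .
    qed
  qed
  ultimately show ?thesis by blast
qed

end
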